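(* Let $1\le p<\infty$. If a Banach space $X$ fails the Complete Continuity Property (CCP), then each of the lattices $\mathrm{FBL}^{(p)}[X]$, $\overline{I}_{w^*}^{p}[X]$, and $H_{w^*}^{p}[X]$ fails the $\lambda$-Fatou property, for every $\lambda>0$.
   Context: All Banach spaces are real. Let $1/p+1/p'=1$. For $z_1,\dots,z_n$ in a Banach space, $\|(z_i)_{i=1}^n\|_{p,\mathrm{weak}}=\sup\{\|\sum_i\alpha_i z_i\| : \|(\alpha_i)_i\|_{\ell_{p'}}\le 1\}$. For a Banach space $X$, $H_{w^*}[X]$ is the vector lattice (pointwise operations and order) of positively homogeneous functions $f:X^*\to\mathbb R$ that are weak$^*$-continuous on bounded sets. For $f\in H_{w^*}[X]$, $\|f\|_p$ is the infimum of all $C\ge 0$ such that $(\sum_{i=1}^n|f(x_i^* )|^p)^{1/p}\le C\|(x_i^* )_{i=1}^n\|_{p,\mathrm{weak}}$ for all $n$ and all $x_1^*,\dots,x_n^*\in X^*$. $H_{w^*}^p[X]=\{f\in H_{w^*}[X]:\|f\|_p<\infty\}$, normed by $\|\cdot\|_p$. For $x\in X$, $\delta_x(x^* )=\langle x^*,x\rangle$. $\mathrm{FVL}[X]$ is the vector sublattice of $H_{w^*}[X]$ generated by $\{\delta_x:x\in X\}$; $\mathrm{FBL}^{(p)}[X]$ is the closure of $\mathrm{FVL}[X]$ in $H_{w^*}^p[X]$; $I_{w^*}[X]$ is the (order) ideal of $H_{w^*}[X]$ generated by $\{\delta_x:x\in X\}$; $\overline{I}_{w^*}^p[X]$ is the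 closure of $I_{w^*}[X]$ in $H_{w^*}^p[X]$. A Banach lattice $Z$ has the $\lambda$-Fatou property if for every upward directed set $\mathcal S\subset Z_+$ having a supremum $z_0$ in $Z$, one has $\|z_0\|\le\lambda\sup_{z\in\mathcal S}\|z\|$. $X$ has the CCP if every bounded linear operator $T:L_1(0,1)\to X$ is Dunford–Pettis (completely continuous), i.e. maps weakly convergent sequences to norm convergent sequences. *)

theory Defs
  imports "HOL-Analysis.Analysis"
begin

subsection \<open>Finite \<open>\<ell>\<close>-norms and the weak \<open>p\<close>-norm\<close>

definition conj_exponent :: "real \<Rightarrow> ereal" where
  "conj_exponent p = (if p = 1 then \<infinity> else ereal (p / (p - 1)))"

lemma conj_exponent: "1 \<le> p \<Longrightarrow> 1 / ereal p + 1 / conj_exponent p = 1"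
  by (auto simp: conj_exponent_def one_ereal_def field_simps)

text \<open>Finite families are given by the first \<open>n\<close> values of a sequence.  The \<open>insert 0\<close>
  only matters for \<open>n = 0\<close>.\<close>

definition lq_norm :: "ereal \<Rightarrow> nat \<Rightarrow> (nat \<Rightarrow> real) \<Rightarrow> real" where
  "lq_norm q n a =
    (if q = \<infinity> then Max (insert 0 ((\<lambda>i. \<bar>a i\<bar>) ` {..<n}))
     else (\<Sum>i<n. \<bar>a i\<bar> powr real_of_ereal q) powr (1 / real_of_ereal q))"

definition weak_norm :: "real \<Rightarrow> nat \<Rightarrow> (nat \<Rightarrow> 'b::real_normed_vector) \<Rightarrow> real" where
  "weak_norm p n z =
    Sup {norm (\<Sum>i<n. a i *\<^sub>R z i) |a. lq_norm (conj_exponent p) n a \<le> 1}"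


subsection \<open>Positively homogeneous functions on the dual\<close>

text \<open>The dual of \<open>'a\<close> is \<open>'a \<Rightarrow>\<^sub>L real\<close>.  For scalar-valued operators the strong operator topology,
  i.e. the topology of pointwise convergence on \<open>'a\<close>, is the weak-star topology.\<close>

definition Hw :: "(('a::banach \<Rightarrow>\<^sub>L real) \<Rightarrow> real) set" where
  "Hw = {f. (\<forall>c\<ge>0. \<forall>x. f (c *\<^sub>R x) = c * f x) \<and>
            (\<forall>B. bounded B \<longrightarrow>
               continuous_map (subtopology strong_operator_topology B) euclideanreal f)}"

text \<open>The value is \<open>\<infinity>\<close> if there is no admissible constant.\<close>

definition Hp_norm :: "real \<Rightarrow> (('a::banach \<Rightarrow>\<^sub>L real) \<Rightarrow> real) \<Rightarrow> ennreal" where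
  "Hp_norm p f =
    (INF C \<in> {C. 0 \<le> C \<and> (\<forall>n (x :: nat \<Rightarrow> 'a \<Rightarrow>\<^sub>L real).
                  lq_norm (ereal p) n (\<lambda>i. f (x i)) \<le> C * weak_norm p n x)}. ennreal C)"

definition Hwp :: "real \<Rightarrow> (('a::banach \<Rightarrow>\<^sub>L real) \<Rightarrow> real) set" where
  "Hwp p = {f \<in> Hw. Hp_norm p f < \<infinity>}"

definition closure_Hwp ::
  "real \<Rightarrow> (('a::banach \<Rightarrow>\<^sub>L real) \<Rightarrow> real) set \<Rightarrow> (('a \<Rightarrow>\<^sub>L real) \<Rightarrow> real) set" where
  "closure_Hwp p A =
    {f \<in> Hwp p. \<forall>e>0. \<exists>g\<in>A. Hp_norm p (\<lambda>x. f x - g x) < ennreal e}"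


subsection \<open>Sublattices and ideals of function lattices\<close>

definition linear_subspace :: "('s \<Rightarrow> real) set \<Rightarrow> bool" where
  "linear_subspace V \<longleftrightarrow>
    (\<lambda>_. 0) \<in> V \<and>
    (\<forall>f\<in>V. \<forall>g\<in>V. (\<lambda>t. f t + g t) \<in> V) \<and>
    (\<forall>c. \<forall>f\<in>V. (\<lambda>t. c * f t) \<in> V)"

definition vector_sublattice :: "('s \<Rightarrow> real) set \<Rightarrow> ('s \<Rightarrow> real) set \<Rightarrow> bool" where
  "vector_sublattice E V \<longleftrightarrow>
    V \<subseteq> E \<and> linear_subspace V \<and>
    (\<forall>f\<in>V. \<forall>g\<in>V. (\<lambda>t. max (f t) (g t)) \<in> V \<and> (\<lambda>t. min (f t) (g t)) \<in> V)"

definition order_ideal :: "('s \<Rightarrow> real) set \<Rightarrow> ('s \<Rightarrow> real) set \<Rightarrow> bool" where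
  "order_ideal E V \<longleftrightarrow>
    V \<subseteq> E \<and> linear_subspace V \<and>
    (\<forall>f\<in>E. \<forall>g\<in>V. (\<forall>t. \<bar>f t\<bar> \<le> \<bar>g t\<bar>) \<longrightarrow> f \<in> V)"

definition delta :: "'a::banach \<Rightarrow> ('a \<Rightarrow>\<^sub>L real) \<Rightarrow> real" where
  "delta x = (\<lambda>x'. blinfun_apply x' x)"

definition FVL :: "(('a::banach \<Rightarrow>\<^sub>L real) \<Rightarrow> real) set" where
  "FVL = vector_sublattice Hw hull range delta"

definition FBL :: "real \<Rightarrow> (('a::banach \<Rightarrow>\<^sub>L real) \<Rightarrow> real) set" where
  "FBL p = closure_Hwp p FVL"

definition Iw :: "(('a::banach \<Rightarrow>\<^sub>L real) \<Rightarrow> real) set" where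
  "Iw = order_ideal Hw hull range delta"

definition Iw_closure :: "real \<Rightarrow> (('a::banach \<Rightarrow>\<^sub>L real) \<Rightarrow> real) set" where
  "Iw_closure p = closure_Hwp p Iw"


subsection \<open>The Fatou property\<close>

text \<open>For a lattice \<open>Z\<close> of real functions with pointwise order and norm \<open>N\<close>.  The supremum is
  taken within \<open>Z\<close>; it need not be the pointwise supremum.\<close>

definition is_supremum_in :: "('s \<Rightarrow> real) set \<Rightarrow> ('s \<Rightarrow> real) set \<Rightarrow> ('s \<Rightarrow> real) \<Rightarrow> bool" where
  "is_supremum_in Z S z0 \<longleftrightarrow>
    z0 \<in> Z \<and> (\<forall>z\<in>S. z \<le> z0) \<and> (\<forall>w\<in>Z. (\<forall>z\<in>S. z \<le> w) \<longrightarrow> z0 \<le> w)"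

definition upward_directed :: "('s \<Rightarrow> real) set \<Rightarrow> bool" where
  "upward_directed S \<longleftrightarrow> S \<noteq> {} \<and> (\<forall>f\<in>S. \<forall>g\<in>S. \<exists>h\<in>S. f \<le> h \<and> g \<le> h)"

definition Fatou_property ::
  "real \<Rightarrow> ('s \<Rightarrow> real) set \<Rightarrow> (('s \<Rightarrow> real) \<Rightarrow> ennreal) \<Rightarrow> bool" where
  "Fatou_property lam Z N \<longleftrightarrow>
    (\<forall>S z0. S \<subseteq> {z \<in> Z. \<forall>t. 0 \<le> z t} \<and> upward_directed S \<and> is_supremum_in Z S z0
       \<longrightarrow> N z0 \<le> ennreal lam * (SUP z\<in>S. N z))"


subsection \<open>The complete continuity property\<close>

text \<open>Elements of the Lebesgue space over \<open>(0,1)\<close> are represented by integrable functions.  A map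
  bounded with respect to the seminorm \<open>\<integral>\<bar>f\<bar>\<close> and linear on integrable functions takes equal
  values on functions that agree almost everywhere, so such maps are exactly the bounded linear
  operators on the quotient.  Values outside \<open>L1\<close> are irrelevant.\<close>

definition L1 :: "(real \<Rightarrow> real) set" where
  "L1 = {f. integrable (lebesgue_on {0<..<1}) f}"

definition L1_norm :: "(real \<Rightarrow> real) \<Rightarrow> real" where
  "L1_norm f = (\<integral>t. \<bar>f t\<bar> \<partial>lebesgue_on {0<..<1})"

definition L1_bounded_linear :: "((real \<Rightarrow> real) \<Rightarrow> 'b::real_normed_vector) \<Rightarrow> bool" where
  "L1_bounded_linear T \<longleftrightarrow>
    (\<forall>f\<in>L1. \<forall>g\<in>L1. T (\<lambda>t. f t + g t) = T f + T g) \<and>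
    (\<forall>c. \<forall>f\<in>L1. T (\<lambda>t. c * f t) = c *\<^sub>R T f) \<and>
    (\<exists>C. \<forall>f\<in>L1. norm (T f) \<le> C * L1_norm f)"

definition L1_weakly_converges :: "(nat \<Rightarrow> real \<Rightarrow> real) \<Rightarrow> (real \<Rightarrow> real) \<Rightarrow> bool" where
  "L1_weakly_converges f g \<longleftrightarrow>
    (\<forall>n. f n \<in> L1) \<and> g \<in> L1 \<and>
    (\<forall>\<phi> :: (real \<Rightarrow> real) \<Rightarrow> real. L1_bounded_linear \<phi> \<longrightarrow> (\<lambda>n. \<phi> (f n)) \<longlonglongrightarrow> \<phi> g)"

definition Dunford_Pettis :: "((real \<Rightarrow> real) \<Rightarrow> 'b::real_normed_vector) \<Rightarrow> bool" where
  "Dunford_Pettis T \<longleftrightarrow>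
    (\<forall>f g. L1_weakly_converges f g \<longrightarrow> (\<lambda>n. T (f n)) \<longlonglongrightarrow> T g)"

definition CCP :: "'a::banach itself \<Rightarrow> bool" where
  "CCP X \<longleftrightarrow> (\<forall>T :: (real \<Rightarrow> real) \<Rightarrow> 'a. L1_bounded_linear T \<longrightarrow> Dunford_Pettis T)"

end

theory Submission
  imports Defs
begin

text \<open>Let \<open>T : L\<^sub>1 \<rightarrow> X\<close> fail to be completely continuous.  For a finite measurable partition \<open>(A\<^sub>j)\<close> of the
  interval put \<open>g(x) = \<Sum>j. \<bar>x (T 1\<^bsub>A\<^sub>j\<^esub>)\<bar>\<close>; these functions lie in \<open>FVL\<close>, increase under refinement, and
  have \<open>p\<close>-norm at most \<open>\<parallel>T\<parallel>\<close>.  Weakly null sequences in \<open>L\<^sub>1\<close> are uniformly integrable, so the failure of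
  complete continuity gives a constant \<open>c > 0\<close> such that every weak-star neighbourhood of \<open>0\<close> contains
  some \<open>v\<close> in the dual unit ball with \<open>g(v) \<ge> c\<close> for some partition.  Hence for every \<open>z \<in> FVL\<close> with
  \<open>0 \<le> z(x) \<le> \<parallel>x\<parallel>\<close> the truncations \<open>min z (2/c g)\<close> agree with \<open>z\<close> at points weak-star close (and
  boundedly so) to any given functional, and therefore have supremum \<open>z\<close> in each of the three lattices,
  while their norms stay below \<open>2 \<parallel>T\<parallel> / c\<close>.  By the Dvoretzky--Rogers theorem the \<open>p\<close>-norm of
  \<open>z = max\<^sub>i \<bar>\<delta>\<^bsub>x\<^sub>i\<^esub>\<bar>\<close> with \<open>\<parallel>x\<^sub>i\<parallel> \<le> 1\<close> can be arbitrarily large.\<close>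

subsection \<open>Norming functionals\<close>

text \<open>A partition sum \<open>g\<close> controls \<open>v (T h)\<close> only for bounded
  \<open>h\<close>: if \<open>h\<close> has values in \<open>[-B, B]\<close>, then
  \<open>v (T h)\<close> is at most \<open>B * g v\<close> up to a small error. Uniform
  integrability supplies one \<open>B\<close> for the whole weakly null sequence \<open>h n\<close>,
  so that \<open>c\<close> does not depend on the neighbourhood. Functionals norming the vectors
  \<open>T (h n)\<close> need not be weak-star small. The difference of two of them that nearly
  agree on the prescribed finite set is small there, and it is still large at \<open>T (h n)\<close>
  when the second functional is fixed and \<open>n\<close> is late, because \<open>h n\<close> is
  weakly null. The oscillation also makes the dual infinite-dimensional:
  \<open>g v \<le> K * norm v\<close>, so every weak-star neighbourhood of 0 contains functionals of
  norm at least \<open>c / K\<close>. Hence Dvoretzky--Rogers applies in the dual, where the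
  families that test the p-norm live. An upper bound taken from any of the three lattices is
  weak-star continuous on bounded sets, and each lattice contains the elements of \<open>FVL\<close>
  of finite p-norm; so one directed set refutes the property in all three.\<close>

definition sublinear :: "('a::real_normed_vector \<Rightarrow> real) \<Rightarrow> bool" where
  "sublinear q \<longleftrightarrow> (\<forall>x y. q (x + y) \<le> q x + q y) \<and> (\<forall>c\<ge>0. \<forall>x. q (c *\<^sub>R x) \<le> c * q x)"

text \<open>For sublinear \<open>q\<close> this is the largest sublinear functional below
  \<open>q\<close> whose value at \<open>- y\<close> is at most \<open>- q y\<close>: any such
  \<open>r\<close> satisfies \<open>r x \<le> r (x + t *\<^sub>R y) + t * r (- y)\<close>.\<close>

definition lower_along :: "('a::real_normed_vector \<Rightarrow> real) \<Rightarrow> 'a \<Rightarrow> 'a \<Rightarrow> real" where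
  "lower_along q y x = (INF t\<in>{0..}. q (x + t *\<^sub>R y) - t * q y)"

lemma sublinear_norm: "sublinear norm"
  by (auto simp: sublinear_def norm_triangle_ineq)

lemma sublinear_zero:
  assumes "sublinear q"
  shows "q 0 = 0"
proof -
  have "q (0 + 0) \<le> q 0 + q 0" "q (0 *\<^sub>R 0) \<le> 0 * q 0"
    using assms unfolding sublinear_def by blast+
  then show ?thesis by simp
qed

lemma sublinear_minus:
  assumes "sublinear q"
  shows "- q (- x) \<le> q x"
proof -
  have "q (x + - x) \<le> q x + q (- x)" using assms unfolding sublinear_def by blast
  then show ?thesis using sublinear_zero[OF assms] by simp
qed

lemma sublinear_scale:
  assumes "sublinear q" "0 \<le> c"
  shows "q (c *\<^sub>R x) = c * q x"
proof (cases "c = 0")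
  case True
  then show ?thesis using sublinear_zero[OF assms(1)] by simp
next
  case False
  then have "c > 0" using assms by simp
  have "q (inverse c *\<^sub>R (c *\<^sub>R x)) \<le> inverse c * q (c *\<^sub>R x)"
    using assms \<open>c > 0\<close> unfolding sublinear_def by (meson less_imp_le positive_imp_inverse_positive)
  then have "c * q x \<le> q (c *\<^sub>R x)"
    using \<open>c > 0\<close> by (simp add: field_simps)
  then show ?thesis using assms unfolding sublinear_def by (meson antisym)
qed

lemma lower_along_bdd:
  assumes "sublinear q"
  shows "bdd_below ((\<lambda>t. q (x + t *\<^sub>R y) - t * q y) ` {0..})"
proof (rule bdd_belowI2[where m = "- q (- x)"])
  fix t :: real assume "t \<in> {0..}"
  then have "t * q y = q (t *\<^sub>R y)" using sublinear_scale[OF assms, of t y] by simp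
  also have "\<dots> = q ((x + t *\<^sub>R y) + (- x))" by simp
  also have "\<dots> \<le> q (x + t *\<^sub>R y) + q (- x)" using assms unfolding sublinear_def by blast
  finally show "- q (- x) \<le> q (x + t *\<^sub>R y) - t * q y" by simp
qed

lemma lower_along_le:
  assumes "sublinear q" "0 \<le> t"
  shows "lower_along q y x \<le> q (x + t *\<^sub>R y) - t * q y"
  unfolding lower_along_def by (rule cINF_lower[OF lower_along_bdd[OF assms(1)]]) (use assms in auto)

lemma lower_along_sublinear:
  assumes q: "sublinear q"
  shows "sublinear (lower_along q y)"
  unfolding sublinear_def
proof (intro conjI allI impI)
  fix x z
  have *: "lower_along q y (x + z) - (q (z + s *\<^sub>R y) - s * q y) \<le> q (x + t *\<^sub>R y) - t * q y"
    if "0 \<le> t" "0 \<le> s" for t s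
  proof -
    have "lower_along q y (x + z) \<le> q ((x + z) + (t + s) *\<^sub>R y) - (t + s) * q y"
      by (rule lower_along_le) (use q that in auto)
    also have "(x + z) + (t + s) *\<^sub>R y = (x + t *\<^sub>R y) + (z + s *\<^sub>R y)"
      by (simp add: algebra_simps)
    also have "q \<dots> \<le> q (x + t *\<^sub>R y) + q (z + s *\<^sub>R y)" using q unfolding sublinear_def by blast
    finally show ?thesis by (simp add: algebra_simps)
  qed
  have "lower_along q y (x + z) - (q (z + s *\<^sub>R y) - s * q y) \<le> lower_along q y x" if "0 \<le> s" for s
    unfolding lower_along_def[of q y x] by (rule cINF_greatest) (use * that in auto)
  then have "lower_along q y (x + z) - lower_along q y x \<le> q (z + s *\<^sub>R y) - s * q y" if "0 \<le> s" for s
    using that by (smt (verit))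
  then have "lower_along q y (x + z) - lower_along q y x \<le> lower_along q y z"
    unfolding lower_along_def[of q y z] by (intro cINF_greatest) auto
  then show "lower_along q y (x + z) \<le> lower_along q y x + lower_along q y z" by simp
next
  fix c :: real and x assume c: "0 \<le> c"
  have zero: "lower_along q y 0 \<le> 0"
    using lower_along_le[OF q, of 0 y 0] sublinear_zero[OF q] by simp
  show "lower_along q y (c *\<^sub>R x) \<le> c * lower_along q y x"
  proof (cases "c = 0")
    case True
    then show ?thesis using zero by simp
  next
    case False
    with c have c: "c > 0" by simp
    have "lower_along q y (c *\<^sub>R x) / c \<le> q (x + t *\<^sub>R y) - t * q y" if t: "0 \<le> t" for t
    proof -
      have "lower_along q y (c *\<^sub>R x) \<le> q (c *\<^sub>R x + (c * t) *\<^sub>R y) - (c * t) * q y"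
        by (rule lower_along_le) (use q c t in auto)
      also have "c *\<^sub>R x + (c * t) *\<^sub>R y = c *\<^sub>R (x + t *\<^sub>R y)" by (simp add: algebra_simps)
      also have "q \<dots> = c * q (x + t *\<^sub>R y)" using sublinear_scale[OF q] c by simp
      finally show ?thesis using c by (simp add: field_simps)
    qed
    then have "lower_along q y (c *\<^sub>R x) / c \<le> lower_along q y x"
      unfolding lower_along_def[of q y x] by (intro cINF_greatest) auto
    then show ?thesis using c by (simp add: field_simps)
  qed
qed

lemma lower_along_below:
  assumes "sublinear q"
  shows "lower_along q y \<le> q"
  using lower_along_le[OF assms, of 0] by (auto simp: le_fun_def)

lemma lower_along_opposite:
  assumes "sublinear q"
  shows "lower_along q y (- y) \<le> - q y"
  using lower_along_le[OF assms, of 1 y "- y"] sublinear_zero[OF assms] by simp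

text \<open>Infima of arbitrary families need not be subadditive. In a chain, one of two members
  \<open>q\<close>, \<open>r\<close> lies below both, and it bounds the infimum at
  \<open>x + y\<close> by \<open>q x + r y\<close>. The common majorant \<open>q0\<close> keeps the
  infimum finite: \<open>- q0 (- x) \<le> q x\<close>.\<close>

lemma INF_chain_sublinear:
  fixes C :: "('a::real_normed_vector \<Rightarrow> real) set"
  assumes ne: "C \<noteq> {}" and sub: "\<And>q. q \<in> C \<Longrightarrow> sublinear q \<and> q \<le> q0"
    and chain: "\<And>q r. q \<in> C \<Longrightarrow> r \<in> C \<Longrightarrow> q \<le> r \<or> r \<le> q"
  shows "sublinear (\<lambda>x. INF q\<in>C. q x)" and "\<forall>q\<in>C. (\<lambda>x. INF q\<in>C. q x) \<le> q"
proof -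
  have bdd: "bdd_below ((\<lambda>q. q x) ` C)" for x
  proof (rule bdd_belowI2[where m = "- q0 (- x)"])
    fix q assume "q \<in> C"
    then have "q (- x) \<le> q0 (- x)" "- q (- x) \<le> q x"
      using sub sublinear_minus by (auto simp: le_fun_def)
    then show "- q0 (- x) \<le> q x" by simp
  qed
  let ?u = "\<lambda>x. INF q\<in>C. q x"
  have le: "?u x \<le> q x" if "q \<in> C" for q x
    by (rule cINF_lower[OF bdd that])
  then show "\<forall>q\<in>C. ?u \<le> q" by (simp add: le_fun_def)
  show "sublinear ?u"
    unfolding sublinear_def
  proof (intro conjI allI impI)
    fix x y
    have *: "?u (x + y) - r y \<le> q x" if "q \<in> C" "r \<in> C" for q r
    proof -
      have "\<exists>s\<in>C. s \<le> q \<and> s \<le> r" using chain[OF that] that by blast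
      then obtain s where s: "s \<in> C" "s \<le> q" "s \<le> r" by blast
      have "?u (x + y) \<le> s (x + y)" using le s by simp
      also have "\<dots> \<le> s x + s y" using sub[OF s(1)] unfolding sublinear_def by blast
      also have "\<dots> \<le> q x + r y" using s by (intro add_mono) (auto simp: le_fun_def)
      finally show ?thesis by simp
    qed
    have "?u (x + y) - r y \<le> ?u x" if "r \<in> C" for r
      by (rule cINF_greatest) (use * that ne in auto)
    then have "?u (x + y) - ?u x \<le> r y" if "r \<in> C" for r using that by (smt (verit))
    then have "?u (x + y) - ?u x \<le> ?u y" by (intro cINF_greatest ne)
    then show "?u (x + y) \<le> ?u x + ?u y" by simp
  next
    fix c :: real and x assume c: "0 \<le> c"
    show "?u (c *\<^sub>R x) \<le> c * ?u x"
    proof (cases "c = 0")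
      case True
      have "?u 0 \<le> 0" using le ne sub sublinear_zero by (metis ex_in_conv)
      then show ?thesis using True by simp
    next
      case False
      with c have c: "c > 0" by simp
      have "?u (c *\<^sub>R x) / c \<le> q x" if "q \<in> C" for q
        using le[OF that, of "c *\<^sub>R x"] sublinear_scale[of q c x] sub[OF that] c by (simp add: field_simps)
      then have "?u (c *\<^sub>R x) / c \<le> ?u x" by (intro cINF_greatest ne)
      then show ?thesis using c by (simp add: field_simps)
    qed
  qed
qed

lemma minimal_sublinear_exists:
  assumes q0: "sublinear q0"
  obtains q where "sublinear q" "q \<le> q0" "\<And>r. sublinear r \<Longrightarrow> r \<le> q \<Longrightarrow> r = q"
proof -
  define A where "A = {q. sublinear q \<and> q \<le> q0}"
  have "\<exists>m\<in>A. \<forall>a\<in>A. a \<le> m \<longrightarrow> a = m"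
  \<comment> \<open>The order is reversed, so a maximal element is minimal for the pointwise
    order.\<close>
  proof (rule predicate_Zorn[of A "\<lambda>f g. g \<le> f"])
    show "partial_order_on A (relation_of (\<lambda>f g. g \<le> f) A)"
      by (auto simp: partial_order_on_def preorder_on_def refl_on_def trans_def antisym_def relation_of_def)
  next
    fix C assume "C \<in> Chains (relation_of (\<lambda>f g. g \<le> f) A)"
    then have C: "\<And>q r. q \<in> C \<Longrightarrow> r \<in> C \<Longrightarrow> q \<le> r \<or> r \<le> q" "\<And>q. q \<in> C \<Longrightarrow> q \<in> A"
      by (auto simp: Chains_def relation_of_def)
    show "\<exists>u\<in>A. \<forall>a\<in>C. u \<le> a"
    proof (cases "C = {}")
      case True
      then show ?thesis using q0 by (auto simp: A_def)
    next
      case False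
      then obtain r where "r \<in> C" by blast
      have 1: "\<And>q. q \<in> C \<Longrightarrow> sublinear q \<and> q \<le> q0" using C(2) by (auto simp: A_def)
      have u: "sublinear (\<lambda>x. INF q\<in>C. q x)" "\<forall>q\<in>C. (\<lambda>x. INF q\<in>C. q x) \<le> q"
        using INF_chain_sublinear[of C q0, OF False] 1 C(1) by blast+
      have "(\<lambda>x. INF q\<in>C. q x) \<le> q0" using bspec[OF u(2) \<open>r \<in> C\<close>] 1[OF \<open>r \<in> C\<close>] by (meson order_trans)
      then have "(\<lambda>x. INF q\<in>C. q x) \<in> A" using u(1) by (simp add: A_def)
      then show ?thesis using u(2) by (intro bexI[where x = "\<lambda>x. INF q\<in>C. q x"]) auto
    qed
  qed
  then obtain m where m: "m \<in> A" "\<And>a. a \<in> A \<Longrightarrow> a \<le> m \<Longrightarrow> a = m" by blast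
  show thesis
  proof (rule that[of m])
    show "sublinear m" "m \<le> q0" using m(1) by (auto simp: A_def)
    fix r assume "sublinear r" "r \<le> m"
    then have "r \<in> A" using m(1) by (auto simp: A_def)
    then show "r = m" using m(2) \<open>r \<le> m\<close> by blast
  qed
qed

text \<open>Lowering a sublinear functional along \<open>y\<close> makes it smaller unless it is odd at \<open>y\<close>, so
  minimal sublinear functionals are linear.\<close>

lemma norming_functional:
  fixes x0 :: "'a::real_normed_vector"
  obtains w :: "'a \<Rightarrow>\<^sub>L real" where "norm w \<le> 1" "blinfun_apply w x0 = norm x0"
proof -
  \<comment> \<open>Starting below \<open>lower_along norm x0\<close> instead of \<open>norm\<close>
    forces \<open>q (- x0) \<le> - norm x0\<close>; once \<open>q\<close> is odd, this says that the
    norm is attained at \<open>x0\<close>.\<close>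
  obtain q where q: "sublinear q" "q \<le> lower_along norm x0"
      and min: "\<And>r. sublinear r \<Longrightarrow> r \<le> q \<Longrightarrow> r = q"
    using minimal_sublinear_exists[OF lower_along_sublinear[OF sublinear_norm]] by blast
  have odd: "q (- y) = - q y" for y
  proof -
    have "lower_along q y = q"
      by (intro min lower_along_sublinear lower_along_below q)
    then show ?thesis using lower_along_opposite[OF q(1), of y] sublinear_minus[OF q(1), of y] by simp
  qed
  have add: "q (x + y) = q x + q y" for x y
  proof -
    have "q (x + y) \<le> q x + q y" "q (- x + - y) \<le> q (- x) + q (- y)"
      using q(1) unfolding sublinear_def by blast+
    moreover have "q (- x + - y) = - q (x + y)" using odd[of "x + y"] by simp
    ultimately show ?thesis by (simp add: odd)
  qed
  have scale: "q (c *\<^sub>R x) = c * q x" for c x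
  proof (cases "c \<ge> 0")
    case False
    then have "q ((- c) *\<^sub>R x) = (- c) * q x" using sublinear_scale[OF q(1), of "- c" x] by simp
    then show ?thesis using odd[of "(- c) *\<^sub>R x"] by simp
  qed (use sublinear_scale[OF q(1)] in auto)
  have le: "q x \<le> norm x" for x
    using q(2) lower_along_below[OF sublinear_norm, of x0] by (meson le_funD order_trans)
  have bound: "norm (q x) \<le> norm x * 1" for x
    using le[of x] le[of "- x"] odd[of x] by simp
  have bl: "bounded_linear q"
    by (rule bounded_linear_intro[where K = 1]) (use add scale bound in auto)
  show thesis
  proof (rule that[of "Blinfun q"])
    show "norm (Blinfun q) \<le> 1"
      by (rule norm_blinfun_bound) (use bound bl in \<open>auto simp: bounded_linear_Blinfun_apply\<close>)
    have "- q x0 \<le> - norm x0"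
      using q(2) lower_along_opposite[OF sublinear_norm, of x0] odd[of x0] by (metis le_funD order_trans)
    then show "blinfun_apply (Blinfun q) x0 = norm x0"
      using le[of x0] bl by (simp add: bounded_linear_Blinfun_apply)
  qed
qed

subsection \<open>The weak \<open>p\<close>-norm\<close>

lemma lq_norm_conj_gt1:
  assumes "1 < p"
  shows "lq_norm (conj_exponent p) n a = (\<Sum>i<n. \<bar>a i\<bar> powr (p / (p - 1))) powr (1 / (p / (p - 1)))"
  using assms by (simp add: lq_norm_def conj_exponent_def)

lemma lq_norm_conj_1: "lq_norm (conj_exponent 1) n a = Max (insert 0 ((\<lambda>i. \<bar>a i\<bar>) ` {..<n}))"
  by (simp add: lq_norm_def conj_exponent_def)

lemma lq_norm_ereal: "lq_norm (ereal p) n b = (\<Sum>i<n. \<bar>b i\<bar> powr p) powr (1 / p)"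
  by (simp add: lq_norm_def)

lemma lq_norm_cong_abs:
  assumes "\<And>i. i < n \<Longrightarrow> \<bar>a i\<bar> = \<bar>b i\<bar>"
  shows "lq_norm q n a = lq_norm q n b"
proof -
  have "(\<lambda>i. \<bar>a i\<bar>) ` {..<n} = (\<lambda>i. \<bar>b i\<bar>) ` {..<n}" using assms by (intro image_cong) auto
  then show ?thesis using assms by (simp add: lq_norm_def)
qed

lemma lq_norm_conj_le_1:
  assumes "1 < p" "lq_norm (conj_exponent p) n a \<le> 1"
  shows "(\<Sum>i<n. \<bar>a i\<bar> powr (p / (p - 1))) \<le> 1"
proof (rule ccontr)
  assume "\<not> ?thesis"
  then have "1 powr (1 / (p / (p - 1))) < (\<Sum>i<n. \<bar>a i\<bar> powr (p / (p - 1))) powr (1 / (p / (p - 1)))"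
    using assms(1) by (intro powr_less_mono2) auto
  then show False using assms lq_norm_conj_gt1[of p n a] by simp
qed

lemma lq_norm_conj_coord:
  assumes "1 \<le> p" "lq_norm (conj_exponent p) n a \<le> 1" "i < n"
  shows "\<bar>a i\<bar> \<le> 1"
proof (cases "p = 1")
  case True
  then have "Max (insert 0 ((\<lambda>i. \<bar>a i\<bar>) ` {..<n})) \<le> 1" using assms lq_norm_conj_1 by simp
  then show ?thesis using assms(3) by (subst (asm) Max_le_iff) auto
next
  case False
  with assms have p: "1 < p" by simp
  have "\<bar>a i\<bar> powr (p / (p - 1)) \<le> (\<Sum>i<n. \<bar>a i\<bar> powr (p / (p - 1)))"
    by (rule member_le_sum) (use assms in auto)
  also have "\<dots> \<le> 1" using lq_norm_conj_le_1[OF p assms(2)] .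
  finally have le: "\<bar>a i\<bar> powr (p / (p - 1)) \<le> 1" .
  show ?thesis
  proof (rule ccontr)
    assume "\<not> ?thesis"
    then have "1 powr (p / (p - 1)) < \<bar>a i\<bar> powr (p / (p - 1))"
      using p by (intro powr_less_mono2) auto
    then show False using le by simp
  qed
qed

lemma norm_sum_le_weak_norm:
  assumes "1 \<le> p" "lq_norm (conj_exponent p) n a \<le> 1"
  shows "norm (\<Sum>i<n. a i *\<^sub>R z i) \<le> weak_norm p n z"
  unfolding weak_norm_def
proof (rule cSup_upper)
  show "bdd_above {norm (\<Sum>i<n. a i *\<^sub>R z i) |a. lq_norm (conj_exponent p) n a \<le> 1}"
  proof (rule bdd_aboveI[where M = "\<Sum>i<n. norm (z i)"])
    fix s assume "s \<in> {norm (\<Sum>i<n. a i *\<^sub>R z i) |a. lq_norm (conj_exponent p) n a \<le> 1}"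
    then obtain b where b: "lq_norm (conj_exponent p) n b \<le> 1" "s = norm (\<Sum>i<n. b i *\<^sub>R z i)" by blast
    have "norm (b i *\<^sub>R z i) \<le> norm (z i)" if "i < n" for i
      using lq_norm_conj_coord[OF assms(1) b(1) that] mult_right_mono[of "\<bar>b i\<bar>" 1 "norm (z i)"] by simp
    then show "s \<le> (\<Sum>i<n. norm (z i))"
      unfolding b(2) by (intro sum_norm_le) auto
  qed
qed (use assms in auto)

lemma lq_norm_zero: "1 \<le> p \<Longrightarrow> lq_norm (conj_exponent p) n (\<lambda>_. 0) \<le> 1"
  by (cases "p = 1") (auto simp: lq_norm_conj_1 lq_norm_conj_gt1 intro!: Max.boundedI)

text \<open>The equality case of Hoelder's inequality. With \<open>B\<close> the norm of
  \<open>b\<close>, the vector \<open>(b i / B) powr (p - 1)\<close> has conjugate norm 1, because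
  its power \<open>p / (p - 1)\<close> is \<open>(b i / B) powr p\<close>; for \<open>p = 1\<close>
  the constant 1 serves.\<close>

lemma lq_norm_dual_vector:
  assumes p: "1 \<le> p" and b: "\<And>i. 0 \<le> b i"
  obtains a where "\<And>i. 0 \<le> a i" "lq_norm (conj_exponent p) n a \<le> 1"
    "(\<Sum>i<n. a i * b i) = lq_norm (ereal p) n b"
proof (cases "p = 1")
  case True
  have "Max (insert 0 ((\<lambda>i. \<bar>1\<bar>) ` {..<n})) \<le> (1::real)" by (intro Max.boundedI) auto
  then have "lq_norm (conj_exponent p) n (\<lambda>_. 1) \<le> 1" using True lq_norm_conj_1 by simp
  moreover have "lq_norm (ereal p) n b = (\<Sum>i<n. b i)"
    using True b by (simp add: lq_norm_ereal sum_nonneg)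
  ultimately show ?thesis using that[of "\<lambda>_. 1"] by simp
next
  case False
  with p have p: "1 < p" by simp
  define s where "s = (\<Sum>i<n. b i powr p)"
  define B where "B = s powr (1 / p)"
  have norm_b: "lq_norm (ereal p) n b = B" using b by (simp add: lq_norm_ereal B_def s_def)
  have "s \<ge> 0" unfolding s_def by (simp add: sum_nonneg)
  show ?thesis
  proof (cases "s = 0")
    case True
    show ?thesis using that[of "\<lambda>_. 0"] lq_norm_zero[of p n] p True norm_b by (simp add: B_def)
  next
    case False
    then have s: "s > 0" using \<open>s \<ge> 0\<close> by simp
    then have B: "B > 0" by (simp add: B_def)
    have Bp: "B powr p = s" using s p by (simp add: B_def powr_powr)
    define a where "a i = (b i / B) powr (p - 1)" for i
    have one: "(\<Sum>i<n. (b i / B) powr p) = 1"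
      using b B s Bp by (simp add: powr_divide flip: sum_divide_distrib s_def)
    have "\<bar>a i\<bar> powr (p / (p - 1)) = (b i / B) powr p" for i
      using p by (simp add: a_def powr_powr)
    then have "lq_norm (conj_exponent p) n a \<le> 1"
      using one p by (simp add: lq_norm_conj_gt1)
    moreover have "a i * b i = B * (b i / B) powr p" for i
    proof (cases "b i = 0")
      case False
      then have "b i / B > 0" using b[of i] B by simp
      then have "(b i / B) powr p = (b i / B) powr (p - 1) * (b i / B)"
        by (metis powr_mult_base diff_add_cancel mult.commute less_imp_le add.commute)
      then show ?thesis using B by (simp add: a_def)
    qed (use p in auto)
    then have "(\<Sum>i<n. a i * b i) = B" using one by (simp flip: sum_distrib_left)
    ultimately show ?thesis using that[of a] norm_b by (simp add: a_def)
  qed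
qed

text \<open>Dualizing the \<open>\<ell>\<^sub>p\<close>-norm against one vector reduces the domination to the triangle inequality
  in the dual of \<open>'a\<close>, so Minkowski's inequality is not needed.\<close>

lemma lq_norm_le_of_dominated:
  fixes f :: "('a::banach \<Rightarrow>\<^sub>L real) \<Rightarrow> real" and y :: "'i \<Rightarrow> 'a"
  assumes p: "1 \<le> p" and dom: "\<And>x. \<bar>f x\<bar> \<le> (\<Sum>j\<in>J. \<bar>blinfun_apply x (y j)\<bar>)"
  shows "lq_norm (ereal p) n (\<lambda>i. f (x i)) \<le> (\<Sum>j\<in>J. norm (y j)) * weak_norm p n x"
proof -
  obtain a where a: "\<And>i. 0 \<le> a i" "lq_norm (conj_exponent p) n a \<le> 1"
      "(\<Sum>i<n. a i * \<bar>f (x i)\<bar>) = lq_norm (ereal p) n (\<lambda>i. \<bar>f (x i)\<bar>)"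
    by (rule lq_norm_dual_vector[OF p, of "\<lambda>i. \<bar>f (x i)\<bar>" n]) auto
  have "lq_norm (ereal p) n (\<lambda>i. f (x i)) = (\<Sum>i<n. a i * \<bar>f (x i)\<bar>)"
    unfolding a(3) by (rule lq_norm_cong_abs) simp
  also have "\<dots> \<le> (\<Sum>i<n. a i * (\<Sum>j\<in>J. \<bar>blinfun_apply (x i) (y j)\<bar>))"
    by (intro sum_mono mult_left_mono dom a(1))
  also have "\<dots> = (\<Sum>j\<in>J. \<Sum>i<n. a i * \<bar>blinfun_apply (x i) (y j)\<bar>)"
    unfolding sum_distrib_left by (rule sum.swap)
  also have "\<dots> \<le> (\<Sum>j\<in>J. norm (y j) * weak_norm p n x)"
  proof (rule sum_mono)
    fix j
    \<comment> \<open>A change of signs leaves the conjugate norm alone and turns the sum of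
      absolute values into a single value of the functional
      \<open>\<Sum>i<n. d i *\<^sub>R x i\<close>.\<close>
    define d where "d i = (if blinfun_apply (x i) (y j) < 0 then - a i else a i)" for i
    have "lq_norm (conj_exponent p) n d \<le> 1"
      using a(2) lq_norm_cong_abs[of n d a] by (simp add: d_def)
    note le = norm_sum_le_weak_norm[OF p this, of x]
    have "(\<Sum>i<n. a i * \<bar>blinfun_apply (x i) (y j)\<bar>) = blinfun_apply (\<Sum>i<n. d i *\<^sub>R x i) (y j)"
      by (auto simp: d_def blinfun.sum_left blinfun.scaleR_left intro!: sum.cong)
    also have "\<dots> \<le> norm (\<Sum>i<n. d i *\<^sub>R x i) * norm (y j)"
      using norm_blinfun[of "\<Sum>i<n. d i *\<^sub>R x i" "y j"] by simp
    also have "\<dots> \<le> norm (y j) * weak_norm p n x"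
      using mult_left_mono[OF le norm_ge_zero[of "y j"]] by (simp only: mult.commute)
    finally show "(\<Sum>i<n. a i * \<bar>blinfun_apply (x i) (y j)\<bar>) \<le> norm (y j) * weak_norm p n x" .
  qed
  finally show ?thesis by (simp add: sum_distrib_right)
qed

text \<open>All upper bounds for p-norms come from here: for the truncations, for \<open>z\<close>
  and for the zero function. The bound is the same for every \<open>p\<close>.\<close>

lemma Hp_norm_le_of_dominated:
  fixes f :: "('a::banach \<Rightarrow>\<^sub>L real) \<Rightarrow> real" and y :: "'i \<Rightarrow> 'a"
  assumes "1 \<le> p" "\<And>x. \<bar>f x\<bar> \<le> (\<Sum>j\<in>J. \<bar>blinfun_apply x (y j)\<bar>)"
  shows "Hp_norm p f \<le> ennreal (\<Sum>j\<in>J. norm (y j))"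
  unfolding Hp_norm_def
  by (rule INF_lower) (use lq_norm_le_of_dominated[where p = p and f = f and J = J and y = y] assms in \<open>auto simp: sum_nonneg\<close>)

text \<open>The norm of a functional is a supremum over the unit ball of \<open>'a\<close>, so the
  bidual never enters. Both sums are at most 1, hence Young's inequality already gives
  \<open>1 / q + 1 / p = 1\<close>.\<close>

lemma weak_norm_le_1:
  fixes u :: "nat \<Rightarrow> ('a::banach \<Rightarrow>\<^sub>L real)"
  assumes p: "1 \<le> p" and u: "\<And>x. norm x \<le> 1 \<Longrightarrow> (\<Sum>i<n. \<bar>blinfun_apply (u i) x\<bar> powr p) \<le> 1"
  shows "weak_norm p n u \<le> 1"
  unfolding weak_norm_def
proof (rule cSup_least)
  show "{norm (\<Sum>i<n. a i *\<^sub>R u i) |a. lq_norm (conj_exponent p) n a \<le> 1} \<noteq> {}"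
    using lq_norm_zero[OF p] by auto
next
  fix s assume "s \<in> {norm (\<Sum>i<n. a i *\<^sub>R u i) |a. lq_norm (conj_exponent p) n a \<le> 1}"
  then obtain a where a: "lq_norm (conj_exponent p) n a \<le> 1" and s: "s = norm (\<Sum>i<n. a i *\<^sub>R u i)" by blast
  have ball: "\<bar>blinfun_apply (\<Sum>i<n. a i *\<^sub>R u i) x\<bar> \<le> 1" if x: "norm x \<le> 1" for x
  proof -
    have "\<bar>blinfun_apply (\<Sum>i<n. a i *\<^sub>R u i) x\<bar> \<le> (\<Sum>i<n. \<bar>a i\<bar> * \<bar>blinfun_apply (u i) x\<bar>)"
      by (simp add: blinfun.sum_left blinfun.scaleR_left flip: abs_mult)
    also have "\<dots> \<le> 1"
    proof (cases "p = 1")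
      case True
      have "(\<Sum>i<n. \<bar>a i\<bar> * \<bar>blinfun_apply (u i) x\<bar>) \<le> (\<Sum>i<n. \<bar>blinfun_apply (u i) x\<bar> powr p)"
        using lq_norm_conj_coord[OF p a] True by (intro sum_mono) (auto intro: mult_left_le_one_le)
      then show ?thesis using u[OF x] by simp
    next
      case False
      with p have p: "1 < p" by simp
      define q where "q = p / (p - 1)"
      have q: "q > 1" "1 / q + 1 / p = 1" using p by (auto simp: q_def field_simps)
      have "(\<Sum>i<n. \<bar>a i\<bar> * \<bar>blinfun_apply (u i) x\<bar>)
          \<le> (\<Sum>i<n. \<bar>a i\<bar> powr q / q + \<bar>blinfun_apply (u i) x\<bar> powr p / p)"
        by (intro sum_mono Youngs_inequality) (use p q in auto)
      also have "\<dots> = (\<Sum>i<n. \<bar>a i\<bar> powr q) / q + (\<Sum>i<n. \<bar>blinfun_apply (u i) x\<bar> powr p) / p"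
        by (simp add: sum.distrib sum_divide_distrib)
      also have "\<dots> \<le> 1 / q + 1 / p"
        using lq_norm_conj_le_1[OF p a] u[OF x] p q by (intro add_mono divide_right_mono) (auto simp: q_def)
      finally show ?thesis using q by simp
    qed
    finally show ?thesis .
  qed
  show "s \<le> 1"
    unfolding s
  proof (rule norm_blinfun_bound)
    fix x
    show "norm (blinfun_apply (\<Sum>i<n. a i *\<^sub>R u i) x) \<le> 1 * norm x"
    proof (cases "x = 0")
      case False
      then show ?thesis
        using ball[of "x /\<^sub>R norm x"] by (simp add: blinfun.scaleR_right field_simps)
    qed simp
  qed simp
qed

text \<open>The \<open>u i\<close> form an admissible test family of weak norm at most 1.
  Functionals need not attain their norms, so only half of \<open>norm (u i)\<close> is asked of
  \<open>f\<close>; the factor in \<open>2 * r\<close> compensates.\<close>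

lemma Hp_norm_ge:
  fixes u :: "nat \<Rightarrow> ('a::banach \<Rightarrow>\<^sub>L real)"
  assumes p: "1 \<le> p" and u: "\<And>x. norm x \<le> 1 \<Longrightarrow> (\<Sum>i<n. \<bar>blinfun_apply (u i) x\<bar> powr p) \<le> 1"
    and f: "\<And>i. i < n \<Longrightarrow> norm (u i) / 2 \<le> f (u i)"
    and r: "0 \<le> r" "(2 * r) powr p \<le> (\<Sum>i<n. norm (u i) powr p)"
  shows "ennreal r \<le> Hp_norm p f"
  unfolding Hp_norm_def
proof (rule INF_greatest)
  fix C assume "C \<in> {C. 0 \<le> C \<and> (\<forall>n x. lq_norm (ereal p) n (\<lambda>i. f (x i)) \<le> C * weak_norm p n x)}"
  then have C: "0 \<le> C" "lq_norm (ereal p) n (\<lambda>i. f (u i)) \<le> C * weak_norm p n u" by auto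
  have "r powr p * 2 powr p \<le> (\<Sum>i<n. norm (u i) powr p)"
    using r by (simp add: powr_mult mult.commute)
  then have "r powr p \<le> (\<Sum>i<n. (norm (u i) / 2) powr p)"
    by (simp add: powr_divide field_simps flip: sum_divide_distrib)
  also have "\<dots> \<le> (\<Sum>i<n. \<bar>f (u i)\<bar> powr p)"
    using f p by (intro sum_mono powr_mono2) fastforce+
  finally have le: "r powr p \<le> (\<Sum>i<n. \<bar>f (u i)\<bar> powr p)" .
  have "r = (r powr p) powr (1 / p)" using r p by (simp add: powr_powr)
  also have "\<dots> \<le> lq_norm (ereal p) n (\<lambda>i. f (u i))"
    unfolding lq_norm_ereal using le p by (intro powr_mono2) auto
  also have "\<dots> \<le> C * 1"
    using C mult_left_mono[OF weak_norm_le_1[OF p u] C(1)] by linarith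
  finally show "ennreal r \<le> ennreal C" by (simp add: ennreal_leI)
qed

subsection \<open>The function lattices\<close>

lemma HwI:
  assumes "\<And>c x. 0 \<le> c \<Longrightarrow> f (c *\<^sub>R x) = c * f x"
    and "\<And>B. bounded B \<Longrightarrow> continuous_map (subtopology strong_operator_topology B) euclideanreal f"
  shows "f \<in> Hw"
  using assms by (simp add: Hw_def)

lemma Hw_scale: "f \<in> Hw \<Longrightarrow> 0 \<le> c \<Longrightarrow> f (c *\<^sub>R x) = c * f x"
  by (simp add: Hw_def)

lemma Hw_continuous:
  "f \<in> Hw \<Longrightarrow> bounded B \<Longrightarrow> continuous_map (subtopology strong_operator_topology B) euclideanreal f"
  by (simp add: Hw_def)

lemma delta_in_Hw: "delta y \<in> Hw"
  by (rule HwI)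
    (auto simp: delta_def blinfun.scaleR_left
      intro!: continuous_map_from_subtopology strong_operator_topology_continuous_evaluation)

lemma linear_subspace_Hw: "linear_subspace Hw"
  unfolding linear_subspace_def
proof (intro conjI ballI allI)
  show "(\<lambda>_. 0) \<in> Hw" by (rule HwI) auto
  fix f g :: "('a \<Rightarrow>\<^sub>L real) \<Rightarrow> real" assume fg: "f \<in> Hw" "g \<in> Hw"
  show "(\<lambda>t. f t + g t) \<in> Hw"
    by (rule HwI)
      (auto simp: fg[THEN Hw_scale] distrib_left intro!: continuous_map_add fg[THEN Hw_continuous])
next
  fix c and f :: "('a \<Rightarrow>\<^sub>L real) \<Rightarrow> real" assume f: "f \<in> Hw"
  show "(\<lambda>t. c * f t) \<in> Hw"
    by (rule HwI) (auto simp: f[THEN Hw_scale] intro!: continuous_map_real_mult_left f[THEN Hw_continuous])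
qed

lemma vector_sublattice_Hw: "vector_sublattice Hw Hw"
  unfolding vector_sublattice_def
proof (intro conjI ballI linear_subspace_Hw subset_refl)
  fix f g :: "('a \<Rightarrow>\<^sub>L real) \<Rightarrow> real" assume fg: "f \<in> Hw" "g \<in> Hw"
  show "(\<lambda>t. max (f t) (g t)) \<in> Hw"
    by (rule HwI)
      (auto simp: fg[THEN Hw_scale] max_mult_distrib_left intro!: continuous_map_real_max fg[THEN Hw_continuous])
  show "(\<lambda>t. min (f t) (g t)) \<in> Hw"
    by (rule HwI)
      (auto simp: fg[THEN Hw_scale] min_mult_distrib_left intro!: continuous_map_real_min fg[THEN Hw_continuous])
qed

lemma linear_subspaceD:
  assumes "linear_subspace V"
  shows "(\<lambda>_. 0) \<in> V" "f \<in> V \<Longrightarrow> g \<in> V \<Longrightarrow> (\<lambda>t. f t + g t) \<in> V" "f \<in> V \<Longrightarrow> (\<lambda>t. c * f t) \<in> V"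
  using assms by (auto simp: linear_subspace_def)

lemma vector_sublatticeD:
  assumes "vector_sublattice E V"
  shows "V \<subseteq> E" "(\<lambda>_. 0) \<in> V" "f \<in> V \<Longrightarrow> g \<in> V \<Longrightarrow> (\<lambda>t. f t + g t) \<in> V"
    "f \<in> V \<Longrightarrow> (\<lambda>t. c * f t) \<in> V" "f \<in> V \<Longrightarrow> g \<in> V \<Longrightarrow> (\<lambda>t. max (f t) (g t)) \<in> V"
    "f \<in> V \<Longrightarrow> g \<in> V \<Longrightarrow> (\<lambda>t. min (f t) (g t)) \<in> V"
  using assms by (auto simp: vector_sublattice_def linear_subspace_def)

lemma vector_sublattice_abs:
  assumes "vector_sublattice E V" "f \<in> V"
  shows "(\<lambda>t. \<bar>f t\<bar>) \<in> V"
proof -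
  have "(\<lambda>t. max (f t) ((- 1) * f t)) \<in> V"
    by (intro vector_sublatticeD[OF assms(1)] assms(2))
  moreover have "(\<lambda>t. max (f t) ((- 1) * f t)) = (\<lambda>t. \<bar>f t\<bar>)" by (auto simp: abs_real_def)
  ultimately show ?thesis by simp
qed

text \<open>\<open>max\<close> and \<open>min\<close> of \<open>f\<close> and \<open>g\<close> are
  dominated by the sum of the absolute values, which lies in \<open>V\<close>; that they belong to
  \<open>E\<close> at all comes from \<open>E\<close> being a lattice.\<close>

lemma order_ideal_sublattice:
  assumes E: "vector_sublattice E E" and V: "order_ideal E V"
  shows "vector_sublattice E V"
proof -
  have VE: "V \<subseteq> E" and lin: "linear_subspace V"
    and ideal: "\<And>f g. f \<in> E \<Longrightarrow> g \<in> V \<Longrightarrow> (\<And>t. \<bar>f t\<bar> \<le> \<bar>g t\<bar>) \<Longrightarrow> f \<in> V"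
    using V by (auto simp: order_ideal_def)
  have abs: "(\<lambda>t. \<bar>f t\<bar>) \<in> V" if "f \<in> V" for f
    by (rule ideal[OF _ that]) (use vector_sublattice_abs[OF E] that VE in auto)
  have "(\<lambda>t. max (f t) (g t)) \<in> V \<and> (\<lambda>t. min (f t) (g t)) \<in> V" if "f \<in> V" "g \<in> V" for f g
  proof -
    have s: "(\<lambda>t. \<bar>f t\<bar> + \<bar>g t\<bar>) \<in> V" by (intro linear_subspaceD(2)[OF lin] abs that)
    have fg: "f \<in> E" "g \<in> E" using that VE by auto
    show ?thesis
      by (intro conjI ideal[OF _ s] vector_sublatticeD(5,6)[OF E] fg) auto
  qed
  then show ?thesis using VE lin by (auto simp: vector_sublattice_def)
qed

text \<open>Sublattices are stable under intersection, and \<open>Hw\<close> is one of the sets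
  intersected, which keeps the hull inside \<open>Hw\<close>.\<close>

lemma vector_sublattice_FVL: "vector_sublattice Hw FVL"
proof -
  have "FVL \<subseteq> Hw"
    unfolding FVL_def by (rule hull_minimal) (auto simp: delta_in_Hw vector_sublattice_Hw)
  have memI: "f \<in> FVL" if "\<And>V. vector_sublattice Hw V \<Longrightarrow> range delta \<subseteq> V \<Longrightarrow> f \<in> V"
    for f :: "('a \<Rightarrow>\<^sub>L real) \<Rightarrow> real"
    using that by (auto simp: FVL_def hull_def)
  have memD: "f \<in> V" if "f \<in> FVL" "vector_sublattice Hw V" "range delta \<subseteq> V"
    for f :: "('a \<Rightarrow>\<^sub>L real) \<Rightarrow> real" and V
    using that by (auto simp: FVL_def hull_def)
  have "linear_subspace (FVL :: (('a \<Rightarrow>\<^sub>L real) \<Rightarrow> real) set)"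
    unfolding linear_subspace_def
  proof (intro conjI ballI allI)
    show "(\<lambda>_. 0) \<in> (FVL :: (('a \<Rightarrow>\<^sub>L real) \<Rightarrow> real) set)"
      by (rule memI) (rule vector_sublatticeD(2))
    fix f g :: "('a \<Rightarrow>\<^sub>L real) \<Rightarrow> real" and c :: real assume fg: "f \<in> FVL"
    show "(\<lambda>t. c * f t) \<in> FVL"
      by (rule memI, rule vector_sublatticeD(4), assumption) (rule memD[OF fg])
    assume "g \<in> FVL"
    note fg = fg this
    show "(\<lambda>t. f t + g t) \<in> FVL"
      by (rule memI, rule vector_sublatticeD(3), assumption) (rule fg[THEN memD]; assumption)+
  qed
  moreover have "(\<lambda>t. max (f t) (g t)) \<in> FVL \<and> (\<lambda>t. min (f t) (g t)) \<in> FVL"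
    if fg: "f \<in> FVL" "g \<in> FVL" for f g :: "('a \<Rightarrow>\<^sub>L real) \<Rightarrow> real"
  proof
    show "(\<lambda>t. max (f t) (g t)) \<in> FVL"
      by (rule memI, rule vector_sublatticeD(5), assumption) (rule fg[THEN memD]; assumption)+
    show "(\<lambda>t. min (f t) (g t)) \<in> FVL"
      by (rule memI, rule vector_sublatticeD(6), assumption) (rule fg[THEN memD]; assumption)+
  qed
  ultimately show ?thesis using \<open>FVL \<subseteq> Hw\<close> by (simp add: vector_sublattice_def)
qed

text \<open>Ideals of \<open>Hw\<close> are sublattices, so \<open>Iw\<close> is an intersection of
  fewer sets.\<close>

lemma FVL_subset_Iw: "FVL \<subseteq> Iw"
  unfolding FVL_def Iw_def
  by (rule hull_antimono) (use order_ideal_sublattice vector_sublattice_Hw in blast)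

lemma delta_in_FVL: "delta y \<in> FVL"
  by (simp add: FVL_def hull_inc)

lemmas FVL_closed = vector_sublatticeD[OF vector_sublattice_FVL]

lemma abs_eval_in_FVL: "(\<lambda>x. \<bar>blinfun_apply x y\<bar>) \<in> FVL"
  using vector_sublattice_abs[OF vector_sublattice_FVL delta_in_FVL[of y]] by (simp add: delta_def)

lemma sum_abs_eval_in_FVL:
  fixes y :: "'i \<Rightarrow> 'a::banach"
  assumes "finite J"
  shows "(\<lambda>x. \<Sum>j\<in>J. \<bar>blinfun_apply x (y j)\<bar>) \<in> FVL"
  using assms by induction (auto intro!: FVL_closed(2,3) abs_eval_in_FVL)

text \<open>The witness is the pointwise maximum. Its lower bounds will make the p-norm large, the
  bound by the sum makes it finite, and the last clause yields \<open>z x \<le> norm x\<close> when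
  the \<open>y i\<close> lie in the unit ball.\<close>

lemma max_abs_eval_in_FVL:
  fixes y :: "nat \<Rightarrow> 'a::banach"
  shows "\<exists>z\<in>FVL. (\<forall>x. 0 \<le> z x) \<and> (\<forall>x. \<forall>i<n. \<bar>blinfun_apply x (y i)\<bar> \<le> z x) \<and>
    (\<forall>x. z x \<le> (\<Sum>i<n. \<bar>blinfun_apply x (y i)\<bar>)) \<and>
    (\<forall>x. \<forall>b\<ge>0. (\<forall>i<n. \<bar>blinfun_apply x (y i)\<bar> \<le> b) \<longrightarrow> z x \<le> b)"
proof (induction n)
  case 0
  show ?case by (rule bexI[of _ "\<lambda>_. 0"]) (auto simp: FVL_closed)
next
  case (Suc n)
  then obtain z where z: "z \<in> FVL" "\<forall>x. 0 \<le> z x" "\<forall>x. \<forall>i<n. \<bar>blinfun_apply x (y i)\<bar> \<le> z x"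
    "\<forall>x. z x \<le> (\<Sum>i<n. \<bar>blinfun_apply x (y i)\<bar>)"
    "\<forall>x. \<forall>b\<ge>0. (\<forall>i<n. \<bar>blinfun_apply x (y i)\<bar> \<le> b) \<longrightarrow> z x \<le> b"
    by blast
  show ?case
  proof (intro bexI[of _ "\<lambda>x. max (z x) \<bar>blinfun_apply x (y n)\<bar>"] conjI allI impI)
    show "(\<lambda>x. max (z x) \<bar>blinfun_apply x (y n)\<bar>) \<in> FVL" by (intro FVL_closed z(1) abs_eval_in_FVL)
    show "max (z x) \<bar>blinfun_apply x (y n)\<bar> \<le> (\<Sum>i<Suc n. \<bar>blinfun_apply x (y i)\<bar>)" for x
      using z(4)[rule_format, of x] sum_nonneg[of "{..<n}" "\<lambda>i. \<bar>blinfun_apply x (y i)\<bar>"] by auto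
    show "\<bar>blinfun_apply x (y i)\<bar> \<le> max (z x) \<bar>blinfun_apply x (y n)\<bar>" if "i < Suc n" for x i
      using z(3)[rule_format, of i x] that by (cases "i = n") auto
  qed (use z in \<open>auto simp: le_max_iff_disj\<close>)
qed

lemma Hp_norm_diff_self:
  assumes "1 \<le> p"
  shows "Hp_norm p (\<lambda>x. f x - f x) = 0"
proof -
  have "Hp_norm p (\<lambda>x. f x - f x) \<le> ennreal (\<Sum>j\<in>({}::nat set). norm (0::'a))"
    by (rule Hp_norm_le_of_dominated) (use assms in auto)
  then show ?thesis by simp
qed

text \<open>These two facts are all that the argument uses about the three lattices, so it need not
  distinguish them.\<close>

lemma FVL_lattices:
  assumes p: "1 \<le> p" and Z: "Z = FBL p \<or> Z = Iw_closure p \<or> Z = Hwp p"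
  shows "Z \<subseteq> Hw" "f \<in> FVL \<Longrightarrow> Hp_norm p f < \<infinity> \<Longrightarrow> f \<in> Z"
proof -
  show "Z \<subseteq> Hw" using Z by (auto simp: FBL_def Iw_closure_def closure_Hwp_def Hwp_def)
  assume f: "f \<in> FVL" "Hp_norm p f < \<infinity>"
  then have "f \<in> Hwp p" using FVL_closed(1) by (auto simp: Hwp_def)
  moreover have "f \<in> closure_Hwp p A" if "f \<in> A" for A
    unfolding closure_Hwp_def using \<open>f \<in> Hwp p\<close> that Hp_norm_diff_self[OF p, of f]
    by (auto simp del: diff_self intro!: bexI[of _ f])
  ultimately show "f \<in> Z" using Z f(1) FVL_subset_Iw by (auto simp: FBL_def Iw_closure_def)
qed

text \<open>The topology is the pullback of the product topology under \<open>blinfun_apply\<close>,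
  and a basic open set of a product restricts finitely many coordinates. The radius \<open>R\<close>
  appears because continuity holds on bounded sets only.\<close>

lemma Hw_positive_nhd:
  fixes f :: "('a::banach \<Rightarrow>\<^sub>L real) \<Rightarrow> real"
  assumes f: "f \<in> Hw" and x0: "0 < f x0" "norm x0 \<le> R"
  obtains F d where "finite F" "0 < d"
    "\<And>v. norm v \<le> R \<Longrightarrow> (\<And>y. y \<in> F \<Longrightarrow> \<bar>blinfun_apply v y - blinfun_apply x0 y\<bar> < d) \<Longrightarrow> 0 < f v"
proof -
  let ?B = "cball (0 :: 'a \<Rightarrow>\<^sub>L real) R"
  have "openin (subtopology strong_operator_topology ?B)
      {v \<in> topspace (subtopology strong_operator_topology ?B). f v \<in> {0<..}}"
    by (rule openin_continuous_map_preimage[OF Hw_continuous[OF f bounded_cball]]) simp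
  moreover have "topspace (subtopology strong_operator_topology ?B) = ?B"
    by (simp add: strong_operator_topology_topspace)
  ultimately have "\<exists>U. openin strong_operator_topology U \<and> {v \<in> ?B. f v \<in> {0<..}} = U \<inter> ?B"
    by (simp only: openin_subtopology)
  then obtain U where U: "openin strong_operator_topology U" "{v \<in> ?B. f v \<in> {0<..}} = U \<inter> ?B"
    by blast
  have "\<exists>V. openin euclidean V \<and> U = blinfun_apply -` V \<inter> UNIV"
    using U(1) unfolding strong_operator_topology_def openin_pullback_topology .
  then obtain V where V: "open V" "U = blinfun_apply -` V"
    by auto
  have x0V: "blinfun_apply x0 \<in> V" using U(2) V(2) x0 by auto
  have "openin (product_topology (\<lambda>_::'a. euclideanreal) UNIV) V"
    using V(1) by (simp add: euclidean_product_topology)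
  from product_topology_open_contains_basis[OF this x0V]
  have "\<exists>X. blinfun_apply x0 \<in> Pi\<^sub>E UNIV X \<and> (\<forall>i. open (X i)) \<and> finite {i. X i \<noteq> UNIV} \<and> Pi\<^sub>E UNIV X \<subseteq> V"
    by simp
  then obtain X where X: "blinfun_apply x0 \<in> Pi\<^sub>E UNIV X" "\<forall>i. open (X i)" "finite {i. X i \<noteq> UNIV}"
      "Pi\<^sub>E UNIV X \<subseteq> V"
    by blast
  have "blinfun_apply x0 i \<in> X i" for i using X(1) by (simp add: PiE_iff)
  then have "\<exists>e>0. ball (blinfun_apply x0 i) e \<subseteq> X i" for i
    using X(2) open_contains_ball by blast
  then obtain e where e: "\<And>i. e i > 0" "\<And>i. ball (blinfun_apply x0 i) (e i) \<subseteq> X i" by metis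
  define F where "F = {i. X i \<noteq> UNIV}"
  \<comment> \<open>The \<open>1\<close> covers the case of empty \<open>F\<close>.\<close>
  define d where "d = Min (insert 1 (e ` F))"
  have F: "finite F" using X(3) by (simp add: F_def)
  have "d > 0" unfolding d_def using F e(1) by (subst Min_gr_iff) auto
  moreover have "d \<le> e i" if "i \<in> F" for i unfolding d_def using F that by (intro Min_le) auto
  ultimately have d: "d > 0" "\<And>i. i \<in> F \<Longrightarrow> d \<le> e i" by blast+
  show thesis
  proof (rule that[OF F d(1)])
    fix v assume v: "norm v \<le> R" "\<And>y. y \<in> F \<Longrightarrow> \<bar>blinfun_apply v y - blinfun_apply x0 y\<bar> < d"
    have "blinfun_apply v i \<in> X i" for i
    proof (cases "i \<in> F")
      case True
      then have "blinfun_apply v i \<in> ball (blinfun_apply x0 i) (e i)"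
        using v(2)[OF True] d(2)[OF True] by (simp add: dist_real_def abs_minus_commute)
      then show ?thesis using e(2) by blast
    qed (auto simp: F_def)
    then have "blinfun_apply v \<in> Pi\<^sub>E UNIV X" by (simp add: PiE_UNIV_domain)
    then have "v \<in> U" using X(4) V(2) by blast
    then have "v \<in> U \<inter> ?B" using v(1) by simp
    then show "0 < f v" unfolding U(2)[symmetric] by simp
  qed
qed

subsection \<open>Suprema of truncations\<close>

text \<open>If \<open>z\<close> were not below \<open>w\<close> at some functional \<open>x\<close>, then the same would hold on a neighbourhood
  of \<open>x\<close>, bounded by \<open>2 * norm x\<close>; one of \<open>x + norm x *\<^sub>R v\<close> and \<open>x - norm x *\<^sub>R v\<close>, with \<open>v\<close>
  from \<open>osc\<close>, makes some \<open>g\<close> as large as \<open>c * norm x\<close>, so truncation by \<open>2 / c * g\<close> has no effect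
  there.\<close>

lemma truncation_supremum:
  fixes z w :: "('a::banach \<Rightarrow>\<^sub>L real) \<Rightarrow> real" and G :: "(('a \<Rightarrow>\<^sub>L real) \<Rightarrow> real) set"
  assumes z: "z \<in> Hw" "\<And>x. z x \<le> norm x" and w: "w \<in> Hw"
    and above: "\<And>g x. g \<in> G \<Longrightarrow> min (z x) (2 / c * g x) \<le> w x"
    and G: "\<And>g. g \<in> G \<Longrightarrow> (\<exists>(J::nat set) y. g = (\<lambda>x. \<Sum>j\<in>J. \<bar>blinfun_apply x (y j)\<bar>))"
    and c: "0 < c"
    and osc: "\<And>F d. finite F \<Longrightarrow> 0 < d \<Longrightarrow>
      \<exists>v g. g \<in> G \<and> norm v \<le> 1 \<and> (\<forall>y\<in>F. \<bar>blinfun_apply v y\<bar> < d) \<and> c \<le> g v"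
  shows "z x \<le> w x"
proof (rule ccontr)
  assume "\<not> z x \<le> w x"
  then have pos: "0 < z x + (-1) * w x" by simp
  have "(\<lambda>t. z t + (-1) * w t) \<in> Hw"
    by (intro vector_sublatticeD(3,4)[OF vector_sublattice_Hw] z w)
  from Hw_positive_nhd[OF this pos, of "2 * norm x"]
  obtain F d where F: "finite F" "0 < d" "\<And>v. norm v \<le> 2 * norm x \<Longrightarrow>
      (\<And>y. y \<in> F \<Longrightarrow> \<bar>blinfun_apply v y - blinfun_apply x y\<bar> < d) \<Longrightarrow> 0 < z v + (-1) * w v"
    by auto
  define R where "R = norm x"
  have R: "R \<ge> 0" by (simp add: R_def)
  \<comment> \<open>\<open>R + 1\<close> rather than \<open>R\<close>, since \<open>x\<close> may be
    0.\<close>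
  have "0 < d / (R + 1)" using F(2) R by simp
  from osc[OF F(1) this] obtain v g where v: "g \<in> G" "norm v \<le> 1"
      "\<And>y. y \<in> F \<Longrightarrow> \<bar>blinfun_apply v y\<bar> < d / (R + 1)" "c \<le> g v" by blast
  obtain J y where g: "g = (\<lambda>x. \<Sum>j\<in>(J::nat set). \<bar>blinfun_apply x (y j)\<bar>)" using G[OF v(1)] by blast
  \<comment> \<open>The values of \<open>x\<close> cancel in the difference of the two points, so
    nothing about the size of \<open>g\<close> at \<open>x\<close> is required.\<close>
  have "2 * R * g v \<le> g (x + R *\<^sub>R v) + g (x - R *\<^sub>R v)"
    unfolding g sum_distrib_left sum.distrib[symmetric]
  proof (rule sum_mono)
    fix j
    have "2 * R * \<bar>blinfun_apply v (y j)\<bar> = \<bar>2 * (R * blinfun_apply v (y j))\<bar>"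
      using R by (simp add: abs_mult)
    also have "\<dots> \<le> \<bar>blinfun_apply x (y j) + R * blinfun_apply v (y j)\<bar>
        + \<bar>blinfun_apply x (y j) - R * blinfun_apply v (y j)\<bar>" by linarith
    finally show "2 * R * \<bar>blinfun_apply v (y j)\<bar> \<le> \<bar>blinfun_apply (x + R *\<^sub>R v) (y j)\<bar>
        + \<bar>blinfun_apply (x - R *\<^sub>R v) (y j)\<bar>"
      by (simp add: blinfun.add_left blinfun.diff_left blinfun.scaleR_left)
  qed
  moreover have "2 * R * c \<le> 2 * R * g v" using v(4) R by (intro mult_left_mono) auto
  ultimately have "R * c \<le> g (x + R *\<^sub>R v) \<or> R * c \<le> g (x + (- R) *\<^sub>R v)" by auto
  then obtain s where s: "\<bar>s\<bar> = R" "R * c \<le> g (x + s *\<^sub>R v)" using R by (metis abs_minus_cancel abs_of_nonneg)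
  let ?u = "x + s *\<^sub>R v"
  have u: "norm ?u \<le> 2 * R"
  proof -
    have "norm ?u \<le> norm x + \<bar>s\<bar> * norm v" by (metis norm_scaleR norm_triangle_ineq)
    also have "\<dots> \<le> R + R * 1" unfolding s(1) R_def by (intro add_mono mult_left_mono v) auto
    finally show ?thesis by simp
  qed
  have "0 < z ?u + (-1) * w ?u"
  proof (rule F(3))
    show "norm ?u \<le> 2 * norm x" using u by (simp add: R_def)
    fix y assume "y \<in> F"
    have "\<bar>blinfun_apply ?u y - blinfun_apply x y\<bar> = R * \<bar>blinfun_apply v y\<bar>"
      by (simp add: blinfun.add_left blinfun.scaleR_left abs_mult s(1))
    also have "\<dots> \<le> (R + 1) * \<bar>blinfun_apply v y\<bar>" by (simp add: algebra_simps)
    also have "\<dots> < d" using v(3)[OF \<open>y \<in> F\<close>] R by (simp add: field_simps)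
    finally show "\<bar>blinfun_apply ?u y - blinfun_apply x y\<bar> < d" .
  qed
  \<comment> \<open>Origin of the factor \<open>2 / c\<close>: \<open>z ?u\<close> can be as large
    as \<open>2 * R\<close>, while only \<open>R * c\<close> is guaranteed for
    \<open>g ?u\<close>.\<close>
  moreover have "z ?u \<le> 2 / c * g ?u"
  proof -
    have "z ?u \<le> 2 * R" using z(2)[of ?u] u by simp
    also have "\<dots> = 2 / c * (R * c)" using c by simp
    also have "\<dots> \<le> 2 / c * g ?u" using s(2) c by (intro mult_left_mono) auto
    finally show ?thesis .
  qed
  then have "z ?u \<le> w ?u" using above[OF v(1), of ?u] by simp
  ultimately show False by simp
qed

text \<open>The bound \<open>2 / c * K\<close> for the truncations does not involve
  \<open>z\<close>. Hence \<open>z\<close> may be chosen after \<open>lam\<close>, and every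
  \<open>lam\<close> can be defeated.\<close>

lemma not_Fatou_property:
  fixes z :: "('a::banach \<Rightarrow>\<^sub>L real) \<Rightarrow> real" and G :: "(('a \<Rightarrow>\<^sub>L real) \<Rightarrow> real) set"
    and Z :: "(('a \<Rightarrow>\<^sub>L real) \<Rightarrow> real) set"
  assumes p: "1 \<le> p" and Z: "Z = FBL p \<or> Z = Iw_closure p \<or> Z = Hwp p"
    and G: "\<And>g. g \<in> G \<Longrightarrow> \<exists>(J::nat set) y. finite J \<and> (\<Sum>j\<in>J. norm (y j)) \<le> K \<and>
      g = (\<lambda>x. \<Sum>j\<in>J. \<bar>blinfun_apply x (y j)\<bar>)"
    and dir: "upward_directed G"
    and c: "0 < c"
    and osc: "\<And>F d. finite F \<Longrightarrow> 0 < d \<Longrightarrow>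
      \<exists>v g. g \<in> G \<and> norm v \<le> 1 \<and> (\<forall>y\<in>F. \<bar>blinfun_apply v y\<bar> < d) \<and> c \<le> g v"
    and z: "z \<in> FVL" "Hp_norm p z < \<infinity>" "\<And>x. 0 \<le> z x" "\<And>x. z x \<le> norm x"
    and large: "ennreal lam * ennreal (2 / c * K) < Hp_norm p z"
  shows "\<not> Fatou_property lam Z (Hp_norm p)"
proof
  assume Fatou: "Fatou_property lam Z (Hp_norm p)"
  define t where "t g = (\<lambda>x. min (z x) (2 / c * g x))" for g :: "('a \<Rightarrow>\<^sub>L real) \<Rightarrow> real"
  have t_le: "t g \<le> z" for g by (auto simp: t_def le_fun_def)
  have t_mono: "t g \<le> t h" if "g \<le> h" for g h
    using that c by (auto simp: t_def le_fun_def intro!: min.coboundedI2 divide_right_mono)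
  have t: "t g \<in> FVL \<and> (\<forall>x. 0 \<le> t g x) \<and> Hp_norm p (t g) \<le> ennreal (2 / c * K)" if g: "g \<in> G" for g
  proof -
    obtain J y where J: "finite (J::nat set)" "(\<Sum>j\<in>J. norm (y j)) \<le> K"
        "g = (\<lambda>x. \<Sum>j\<in>J. \<bar>blinfun_apply x (y j)\<bar>)" using G[OF g] by blast
    have "g \<in> FVL" unfolding J(3) by (rule sum_abs_eval_in_FVL[OF J(1)])
    then have "t g \<in> FVL" unfolding t_def by (intro FVL_closed(4,6) z(1))
    moreover have nonneg: "0 \<le> t g x" for x
      using z(3) c by (auto simp: t_def J(3) sum_nonneg)
    moreover have "Hp_norm p (t g) \<le> ennreal (\<Sum>j\<in>J. norm ((2 / c) *\<^sub>R y j))"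
    proof (rule Hp_norm_le_of_dominated[OF p])
      fix x
      have "\<bar>t g x\<bar> \<le> 2 / c * g x" using nonneg[of x] by (simp add: t_def)
      also have "\<dots> = (\<Sum>j\<in>J. \<bar>blinfun_apply x ((2 / c) *\<^sub>R y j)\<bar>)"
        using c unfolding J(3) by (simp add: blinfun.scaleR_right abs_mult sum_distrib_left)
      finally show "\<bar>t g x\<bar> \<le> (\<Sum>j\<in>J. \<bar>blinfun_apply x ((2 / c) *\<^sub>R y j)\<bar>)" .
    qed
    moreover have "(\<Sum>j\<in>J. norm ((2 / c) *\<^sub>R y j)) \<le> 2 / c * K"
    proof -
      have "(\<Sum>j\<in>J. norm ((2 / c) *\<^sub>R y j)) = 2 / c * (\<Sum>j\<in>J. norm (y j))"
        using c by (simp add: sum_distrib_left)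
      also have "\<dots> \<le> 2 / c * K" using J(2) c by (intro mult_left_mono) auto
      finally show ?thesis .
    qed
    ultimately show ?thesis by (meson ennreal_leI order_trans)
  qed
  have "t ` G \<subseteq> {z \<in> Z. \<forall>x. 0 \<le> z x}"
  proof safe
    fix g assume "g \<in> G"
    then have "Hp_norm p (t g) < \<infinity>" using t by (metis ennreal_less_top infinity_ennreal_def le_less_trans)
    then show "t g \<in> Z" using FVL_lattices(2)[OF p Z] t[OF \<open>g \<in> G\<close>] by blast
  qed (use t in auto)
  moreover have "upward_directed (t ` G)"
    using dir t_mono unfolding upward_directed_def by (smt (verit) empty_is_image image_iff)
  moreover have "is_supremum_in Z (t ` G) z"
    unfolding is_supremum_in_def
  proof (intro conjI ballI impI)
    show "z \<in> Z" using FVL_lattices(2)[OF p Z z(1,2)] .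
    show "s \<le> z" if "s \<in> t ` G" for s using that t_le by auto
    fix w assume w: "w \<in> Z" "\<forall>s\<in>t ` G. s \<le> w"
    show "z \<le> w"
    proof (rule le_funI)
      fix x
      show "z x \<le> w x"
      proof (rule truncation_supremum[where G = G and c = c])
        show "z \<in> Hw" using z(1) FVL_closed(1) by blast
        show "w \<in> Hw" using w(1) FVL_lattices(1)[OF p Z] by blast
        show "min (z x) (2 / c * g x) \<le> w x" if "g \<in> G" for g x
          using w(2) that by (auto simp: t_def le_fun_def)
        show "\<exists>(J::nat set) y. g = (\<lambda>x. \<Sum>j\<in>J. \<bar>blinfun_apply x (y j)\<bar>)" if "g \<in> G" for g
          using G[OF that] by blast
      qed (use z c osc in auto)
    qed
  qed
  ultimately have "Hp_norm p z \<le> ennreal lam * (SUP s\<in>t ` G. Hp_norm p s)"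
    using Fatou unfolding Fatou_property_def by blast
  also have "\<dots> \<le> ennreal lam * ennreal (2 / c * K)"
    using t by (intro mult_left_mono SUP_least) auto
  finally show False using large by simp
qed

subsection \<open>The Dvoretzky--Rogers theorem\<close>

text \<open>On a finite-dimensional dual, smallness on a basis would force a small norm;
  \<open>osc\<close> excludes this, and the system is built from it one functional at a
  time.\<close>

lemma biorthogonal_system:
  fixes c :: real
  assumes c: "0 < c"
    and osc: "\<And>(F :: 'a::real_normed_vector set) d. finite F \<Longrightarrow> 0 < d \<Longrightarrow>
      \<exists>v :: 'a \<Rightarrow>\<^sub>L real. c \<le> norm v \<and> (\<forall>y\<in>F. \<bar>blinfun_apply v y\<bar> < d)"
  shows "\<exists>(u :: nat \<Rightarrow> 'a \<Rightarrow>\<^sub>L real) x. \<forall>i<n. \<forall>j<n. blinfun_apply (u i) (x j) = (if i = j then 1 else 0)"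
proof (induction n)
  case (Suc n)
  then obtain u :: "nat \<Rightarrow> 'a \<Rightarrow>\<^sub>L real" and x
    where ux: "\<And>i j. i < n \<Longrightarrow> j < n \<Longrightarrow> blinfun_apply (u i) (x j) = (if i = j then 1 else 0)" by blast
  \<comment> \<open>With this \<open>d\<close> the correction subtracted from \<open>v\<close> below
    has norm at most \<open>c - d\<close>, so it cannot cancel \<open>v\<close>.\<close>
  define d where "d = c / (1 + (\<Sum>i<n. norm (u i)))"
  have pos: "1 + (\<Sum>i<n. norm (u i)) > 0" by (simp add: add_pos_nonneg sum_nonneg)
  then have d: "d > 0" using c by (simp add: d_def)
  obtain v :: "'a \<Rightarrow>\<^sub>L real" where v: "c \<le> norm v" "\<And>i. i < n \<Longrightarrow> \<bar>blinfun_apply v (x i)\<bar> < d"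
    using osc[of "x ` {..<n}" d] d by auto
  define w where "w = v - (\<Sum>i<n. blinfun_apply v (x i) *\<^sub>R u i)"
  have "norm (\<Sum>i<n. blinfun_apply v (x i) *\<^sub>R u i) \<le> (\<Sum>i<n. d * norm (u i))"
    using v(2) by (intro sum_norm_le) (simp add: mult_right_mono less_imp_le)
  also have "\<dots> = d * (1 + (\<Sum>i<n. norm (u i))) - d" by (simp add: algebra_simps sum_distrib_left)
  also have "\<dots> = c - d" using pos by (simp add: d_def)
  finally have "norm (\<Sum>i<n. blinfun_apply v (x i) *\<^sub>R u i) < norm v" using d v(1) by linarith
  then have "w \<noteq> 0" by (auto simp: w_def)
  then obtain y0 where y0: "blinfun_apply w y0 \<noteq> 0" by (metis blinfun_eqI zero_blinfun.rep_eq)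
  have wx: "blinfun_apply w (x j) = 0" if "j < n" for j
    using that by (simp add: w_def blinfun.diff_left blinfun.sum_left blinfun.scaleR_left ux if_distrib cong: if_cong)
  \<comment> \<open>Removing the components along the \<open>x i\<close> does not change the value
    of \<open>w\<close>, which vanishes at all of them.\<close>
  define y where "y = (y0 - (\<Sum>i<n. blinfun_apply (u i) y0 *\<^sub>R x i)) /\<^sub>R blinfun_apply w y0"
  have "blinfun_apply w y = 1"
    using y0 wx by (simp add: y_def blinfun.scaleR_right blinfun.diff_right blinfun.sum_right)
  moreover have "blinfun_apply (u j) y = 0" if "j < n" for j
    using that by (simp add: y_def blinfun.scaleR_right blinfun.diff_right blinfun.sum_right ux if_distrib cong: if_cong)
  ultimately show ?case
    using ux wx by (intro exI[of _ "u(n := w)"] exI[of _ "x(n := y)"]) (auto simp: less_Suc_eq)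
qed auto

text \<open>Minimax without a separation theorem: one Frank--Wolfe step from a near minimizer of
  \<open>\<Sum>i<N. (max 0 (\<theta> - k i))\<^sup>2\<close> would decrease this potential below its infimum, were it positive.\<close>

lemma minimax_Frank_Wolfe:
  fixes C K :: "(nat \<Rightarrow> real) set"
  assumes ne: "C \<noteq> {}"
    and conv: "\<And>k l t. k \<in> C \<Longrightarrow> l \<in> K \<Longrightarrow> 0 \<le> t \<Longrightarrow> t \<le> 1 \<Longrightarrow> (\<lambda>i. (1 - t) * k i + t * l i) \<in> C"
    and bnd: "\<And>k i. k \<in> C \<union> K \<Longrightarrow> i < N \<Longrightarrow> 0 \<le> k i \<and> k i \<le> 1"
    and th: "\<theta> \<le> 1"
    and dual: "\<And>c. (\<And>i. 0 \<le> c i) \<Longrightarrow> \<exists>l\<in>K. \<theta> * (\<Sum>i<N. c i) \<le> (\<Sum>i<N. c i * l i)"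
    and e: "0 < e"
  shows "\<exists>k\<in>C. \<forall>i<N. \<theta> - e \<le> k i"
proof (cases "N = 0")
  case True
  then show ?thesis using ne by auto
next
  case False
  define \<phi> where "\<phi> k = (\<Sum>i<N. (max 0 (\<theta> - k i))\<^sup>2)" for k
  define I where "I = (INF k\<in>C. \<phi> k)"
  have nonneg: "0 \<le> \<phi> k" for k by (simp add: \<phi>_def sum_nonneg)
  then have bdd: "bdd_below (\<phi> ` C)" by (intro bdd_belowI2)
  have I_le: "I \<le> \<phi> k" if "k \<in> C" for k unfolding I_def by (rule cINF_lower[OF bdd that])
  have near: "\<exists>k\<in>C. \<phi> k < r" if "I < r" for r
    using that cINF_less_iff[OF ne bdd] by (auto simp: I_def)
  have "I \<ge> 0" unfolding I_def by (rule cINF_greatest[OF ne nonneg])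
  have "I \<le> 0"
  proof (rule ccontr)
    assume "\<not> I \<le> 0"
    then have I: "I > 0" by simp
    \<comment> \<open>The slack \<open>I\<^sup>2 / N\<close> is the decrease that one step is going
      to guarantee.\<close>
    obtain k where k: "k \<in> C" "\<phi> k < I + I\<^sup>2 / N" using near[of "I + I\<^sup>2 / N"] I False by auto
    \<comment> \<open>Up to the factor -2 this is the gradient of the potential at \<open>k\<close>;
      the duality hypothesis supplies a direction of descent.\<close>
    define c where "c i = max 0 (\<theta> - k i)" for i
    obtain l where l: "l \<in> K" "\<theta> * (\<Sum>i<N. c i) \<le> (\<Sum>i<N. c i * l i)"
      using dual[of c] by (auto simp: c_def)
    have c1: "0 \<le> c i \<and> c i \<le> 1" if "i < N" for i using bnd[of k i] k(1) th that by (auto simp: c_def)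
    have "\<phi> k \<le> (\<Sum>i<N. 1)"
      unfolding \<phi>_def using c1 by (intro sum_mono) (auto simp: c_def power_le_one)
    then have t: "0 \<le> \<phi> k / N" "\<phi> k / N \<le> 1" using nonneg[of k] False by (auto simp: field_simps)
    \<comment> \<open>The minimizer of the quadratic bound
      \<open>\<phi> k - 2 * t * \<phi> k + t\<^sup>2 * N\<close>.\<close>
    define t where "t = \<phi> k / N"
    let ?k' = "\<lambda>i. (1 - t) * k i + t * l i"
    have "\<phi> ?k' \<le> (\<Sum>i<N. (c i - t * (l i - k i))\<^sup>2)"
      unfolding \<phi>_def
    proof (rule sum_mono)
      fix i
      have "\<theta> - ?k' i \<le> c i - t * (l i - k i)" by (simp add: c_def algebra_simps)
      then show "(max 0 (\<theta> - ?k' i))\<^sup>2 \<le> (c i - t * (l i - k i))\<^sup>2"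
        by (cases "0 \<le> \<theta> - ?k' i") (auto intro: power_mono)
    qed
    also have "\<dots> = \<phi> k - 2 * t * (\<Sum>i<N. c i * (l i - k i)) + t\<^sup>2 * (\<Sum>i<N. (l i - k i)\<^sup>2)"
    proof -
      have "(c i - t * (l i - k i))\<^sup>2 = (c i)\<^sup>2 - 2 * t * (c i * (l i - k i)) + t\<^sup>2 * (l i - k i)\<^sup>2" for i
        by (simp add: power2_eq_square algebra_simps)
      moreover have "\<phi> k = (\<Sum>i<N. (c i)\<^sup>2)" by (simp add: \<phi>_def c_def)
      ultimately show ?thesis by (simp add: sum.distrib sum_subtractf flip: sum_distrib_left)
    qed
    also have "\<dots> \<le> \<phi> k - 2 * t * \<phi> k + t\<^sup>2 * N"
    proof -
      have "\<phi> k = (\<Sum>i<N. c i * (\<theta> - k i))"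
        unfolding \<phi>_def by (rule sum.cong) (auto simp: c_def max_def power2_eq_square)
      also have "\<dots> = \<theta> * (\<Sum>i<N. c i) - (\<Sum>i<N. c i * k i)"
        by (simp add: algebra_simps sum_subtractf sum_distrib_left)
      also have "\<dots> \<le> (\<Sum>i<N. c i * (l i - k i))" using l(2) by (simp add: algebra_simps sum_subtractf)
      finally have 1: "2 * t * \<phi> k \<le> 2 * t * (\<Sum>i<N. c i * (l i - k i))"
        using t by (intro mult_left_mono) (auto simp: t_def)
      have "(\<Sum>i<N. (l i - k i)\<^sup>2) \<le> (\<Sum>i<N. 1)"
      proof (rule sum_mono)
        fix i assume "i \<in> {..<N}"
        then have "\<bar>l i - k i\<bar> \<le> 1" using bnd[of k i] bnd[of l i] k(1) l(1) by auto
        then show "(l i - k i)\<^sup>2 \<le> 1" by (simp add: abs_square_le_1)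
      qed
      then have "t\<^sup>2 * (\<Sum>i<N. (l i - k i)\<^sup>2) \<le> t\<^sup>2 * N" by (intro mult_left_mono) auto
      with 1 show ?thesis by linarith
    qed
    also have "\<dots> = \<phi> k - (\<phi> k)\<^sup>2 / N" using False by (simp add: t_def power2_eq_square field_simps)
    also have "\<dots> \<le> \<phi> k - I\<^sup>2 / N"
      using I_le[OF k(1)] I by (intro diff_left_mono divide_right_mono power_mono) auto
    also have "\<dots> < I" using k(2) by simp
    finally have "\<phi> ?k' < I" .
    moreover have "?k' \<in> C" by (rule conv[OF k(1) l(1)]) (use t in \<open>simp_all add: t_def\<close>)
    ultimately show False using I_le by fastforce
  qed
  then obtain k where k: "k \<in> C" "\<phi> k < e\<^sup>2" using near[of "e\<^sup>2"] e by (metis le_less_trans zero_less_power)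
  have "\<theta> - e \<le> k i" if "i < N" for i
  proof -
    have "(max 0 (\<theta> - k i))\<^sup>2 \<le> \<phi> k"
      unfolding \<phi>_def using that by (intro member_le_sum[of i "{..<N}" "\<lambda>i. (max 0 (\<theta> - k i))\<^sup>2"]) auto
    then have "(max 0 (\<theta> - k i))\<^sup>2 < e\<^sup>2" using k(2) by simp
    then have "max 0 (\<theta> - k i) < e" by (rule power2_less_imp_less) (use e in simp)
    then show ?thesis by simp
  qed
  then show ?thesis using k(1) by blast
qed

text \<open>Serves to make the unit sphere of a finite-dimensional span of functionals totally
  bounded: there a biorthogonal system bounds the coordinates.\<close>

lemma compact_bounded_combinations:
  fixes u :: "nat \<Rightarrow> 'v::real_normed_vector"
  shows "\<exists>K. compact K \<and> (\<forall>a. (\<forall>i<d. \<bar>a i\<bar> \<le> R) \<longrightarrow> (\<Sum>i<d. a i *\<^sub>R u i) \<in> K)"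
proof (induction d)
  case 0
  show ?case by (rule exI[of _ "{0}"]) auto
next
  case (Suc d)
  then obtain K where K: "compact K" "\<And>a. (\<forall>i<d. \<bar>a i\<bar> \<le> R) \<Longrightarrow> (\<Sum>i<d. a i *\<^sub>R u i) \<in> K" by blast
  have "compact ((\<lambda>t. t *\<^sub>R u d) ` {-R..R})"
    by (intro compact_continuous_image continuous_intros) auto
  from compact_sums[OF K(1) this]
  show ?case
  proof (intro exI conjI allI impI)
    fix a assume a: "\<forall>i<Suc d. \<bar>a i\<bar> \<le> R"
    then have "(\<Sum>i<d. a i *\<^sub>R u i) \<in> K" "a d \<in> {-R..R}" using K(2) by (auto simp: abs_le_iff minus_le_iff)
    then show "(\<Sum>i<Suc d. a i *\<^sub>R u i) \<in> {x + y |x y. x \<in> K \<and> y \<in> (\<lambda>t. t *\<^sub>R u d) ` {-R..R}}"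
      unfolding sum.lessThan_Suc by blast
  qed
qed

text \<open>The inner product of \<open>v\<close> and \<open>w\<close> as functions on
  \<open>A\<close> in the L2 space of the discrete measure with weights \<open>m\<close>.\<close>

definition sq_form :: "'a set \<Rightarrow> ('a \<Rightarrow> real) \<Rightarrow> ('a::real_normed_vector \<Rightarrow>\<^sub>L real) \<Rightarrow> ('a \<Rightarrow>\<^sub>L real) \<Rightarrow> real" where
  "sq_form A m v w = (\<Sum>x\<in>A. m x * (blinfun_apply v x * blinfun_apply w x))"

lemma sq_form_commute: "sq_form A m v w = sq_form A m w v"
  by (simp add: sq_form_def mult.commute)

lemma sq_form_scaleR_left: "sq_form A m (c *\<^sub>R v) w = c * sq_form A m v w"
  by (simp add: sq_form_def blinfun.scaleR_left sum_distrib_left mult.assoc mult.left_commute)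

lemma sq_form_diff_left: "sq_form A m (v - v') w = sq_form A m v w - sq_form A m v' w"
  by (simp add: sq_form_def blinfun.diff_left left_diff_distrib right_diff_distrib sum_subtractf)

lemma sq_form_sum_left: "sq_form A m (\<Sum>i\<in>I. v i) w = (\<Sum>i\<in>I. sq_form A m (v i) w)"
  by (simp add: sq_form_def blinfun.sum_left sum_distrib_left sum_distrib_right sum.swap[of _ A I])

lemma sq_form_scaleR_right: "sq_form A m v (c *\<^sub>R w) = c * sq_form A m v w"
  by (metis sq_form_commute sq_form_scaleR_left)

lemma sq_form_sum_right: "sq_form A m w (\<Sum>i\<in>I. v i) = (\<Sum>i\<in>I. sq_form A m w (v i))"
  using sq_form_sum_left[of A m v I w] by (simp add: sq_form_commute[of A m _ w])

text \<open>The first part bounds coordinates of unit vectors; the second keeps Gram--Schmidt from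
  degenerating.\<close>

lemma span_biorthogonal:
  fixes u :: "nat \<Rightarrow> 'a::real_normed_vector \<Rightarrow>\<^sub>L real"
  assumes ux: "\<And>i j. i < d \<Longrightarrow> j < d \<Longrightarrow> blinfun_apply (u i) (x j) = (if i = j then 1 else 0)"
    and "k \<le> d" "v \<in> span (u ` {..<k})"
  shows "v = (\<Sum>i<k. blinfun_apply v (x i) *\<^sub>R u i)" and "k \<le> j \<Longrightarrow> j < d \<Longrightarrow> blinfun_apply v (x j) = 0"
proof -
  show v_eq: "v = (\<Sum>i<k. blinfun_apply v (x i) *\<^sub>R u i)"
    using assms(3)
  proof (induction rule: span_induct_alt)
    case (step c w v)
    then obtain l where l: "l < k" "w = u l" by auto
    have "(\<Sum>i<k. blinfun_apply w (x i) *\<^sub>R u i) = (\<Sum>i<k. if i = l then u i else 0)"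
      using l \<open>k \<le> d\<close> by (intro sum.cong) (auto simp: ux)
    also have "\<dots> = w" using l by simp
    finally have w: "(\<Sum>i<k. blinfun_apply w (x i) *\<^sub>R u i) = w" .
    have "(\<Sum>i<k. blinfun_apply (c *\<^sub>R w + v) (x i) *\<^sub>R u i)
        = c *\<^sub>R (\<Sum>i<k. blinfun_apply w (x i) *\<^sub>R u i) + (\<Sum>i<k. blinfun_apply v (x i) *\<^sub>R u i)"
      by (simp add: blinfun.add_left blinfun.scaleR_left scaleR_left.add scaleR_sum_right sum.distrib)
    also have "\<dots> = c *\<^sub>R w + v" by (simp only: w step(2)[symmetric])
    finally show ?case by (rule sym)
  qed simp
  have "blinfun_apply v (x j) = blinfun_apply (\<Sum>i<k. blinfun_apply v (x i) *\<^sub>R u i) (x j)"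
    using arg_cong[OF v_eq, of "\<lambda>f. blinfun_apply f (x j)"] .
  also have "\<dots> = (\<Sum>i<k. blinfun_apply v (x i) * blinfun_apply (u i) (x j))"
    by (simp add: blinfun.sum_left blinfun.scaleR_left)
  finally show "blinfun_apply v (x j) = 0" if "k \<le> j" "j < d"
    using that \<open>k \<le> d\<close> by (simp add: ux)
qed

text \<open>The new vector is nonzero because it takes the value 1 at \<open>x k\<close>, where the
  span of the earlier ones vanishes; \<open>posdef\<close> then permits its normalization.\<close>

lemma Gram_Schmidt_sq_form:
  fixes u :: "nat \<Rightarrow> 'a::real_normed_vector \<Rightarrow>\<^sub>L real"
  assumes ux: "\<And>i j. i < d \<Longrightarrow> j < d \<Longrightarrow> blinfun_apply (u i) (x j) = (if i = j then 1 else 0)"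
    and posdef: "\<And>v. v \<in> span (u ` {..<d}) \<Longrightarrow> v \<noteq> 0 \<Longrightarrow> 0 < sq_form A m v v"
    and "k \<le> d"
  shows "\<exists>v. (\<forall>i<k. v i \<in> span (u ` {..<k})) \<and>
    (\<forall>i<k. \<forall>j<k. sq_form A m (v i) (v j) = (if i = j then 1 else 0))"
  using \<open>k \<le> d\<close>
proof (induction k)
  case (Suc k)
  then obtain v where v: "\<And>i. i < k \<Longrightarrow> v i \<in> span (u ` {..<k})"
    "\<And>i j. i < k \<Longrightarrow> j < k \<Longrightarrow> sq_form A m (v i) (v j) = (if i = j then 1 else 0)" by auto
  have mono: "span (u ` {..<k}) \<subseteq> span (u ` {..<Suc k})" "span (u ` {..<Suc k}) \<subseteq> span (u ` {..<d})"
    using Suc.prems by (auto intro!: span_mono)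
  define s where "s = (\<Sum>i<k. sq_form A m (u k) (v i) *\<^sub>R v i)"
  define w where "w = u k - s"
  have s: "s \<in> span (u ` {..<k})" unfolding s_def by (intro span_sum span_scale v(1)) auto
  have "blinfun_apply s (x k) = 0" using span_biorthogonal(2)[OF ux _ s, of d k] Suc.prems by simp
  then have "blinfun_apply w (x k) = 1" using ux[of k k] Suc.prems by (simp add: w_def blinfun.diff_left)
  then have "w \<noteq> 0" by auto
  have w: "w \<in> span (u ` {..<Suc k})"
    unfolding w_def
  proof (rule span_diff)
    show "u k \<in> span (u ` {..<Suc k})" by (rule span_base) simp
    show "s \<in> span (u ` {..<Suc k})" using s mono(1) by blast
  qed
  then have pos: "0 < sq_form A m w w" using posdef[of w] mono \<open>w \<noteq> 0\<close> by blast
  have orth: "sq_form A m w (v j) = 0" if "j < k" for j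
    using that by (simp add: w_def s_def sq_form_diff_left sq_form_sum_left sq_form_scaleR_left v(2) if_distrib cong: if_cong)
  let ?w = "w /\<^sub>R sqrt (sq_form A m w w)"
  have "sq_form A m ?w ?w = 1" using pos by (simp add: sq_form_scaleR_left sq_form_scaleR_right field_simps)
  moreover have "sq_form A m ?w (v j) = 0" "sq_form A m (v j) ?w = 0" if "j < k" for j
    using orth[OF that] sq_form_commute[of A m "v j" w] by (simp_all add: sq_form_scaleR_left sq_form_scaleR_right)
  moreover have "v i \<in> span (u ` {..<Suc k})" if "i < k" for i using v(1)[OF that] mono by blast
  moreover have "?w \<in> span (u ` {..<Suc k})" by (intro span_scale w)
  ultimately show ?case
    using v(2) by (intro exI[of _ "v(k := ?w)"]) (auto simp: less_Suc_eq)
qed auto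

text \<open>Grothendieck's argument: if \<open>v\<^sub>1, \<dots>, v\<^sub>d\<close> are orthonormal for the form, then
  \<open>\<Sum>i. (v\<^sub>i x)\<^sup>2 \<le> 1 / \<zeta>\<close> on the unit ball, and averaging over \<open>m\<close> gives \<open>d \<le> 1 / \<zeta>\<close>.\<close>

lemma dimension_bound_sq_form:
  fixes u :: "nat \<Rightarrow> 'a::real_normed_vector \<Rightarrow>\<^sub>L real"
  assumes ux: "\<And>i j. i < d \<Longrightarrow> j < d \<Longrightarrow> blinfun_apply (u i) (x j) = (if i = j then 1 else 0)"
    and A: "\<And>x. x \<in> A \<Longrightarrow> norm x \<le> 1" "\<And>x. x \<in> A \<Longrightarrow> 0 \<le> m x" "(\<Sum>x\<in>A. m x) = 1"
    and z: "0 < \<zeta>" "\<And>v. v \<in> span (u ` {..<d}) \<Longrightarrow> \<zeta> * (norm v)\<^sup>2 \<le> sq_form A m v v"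
  shows "d \<le> 1 / \<zeta>"
proof -
  have posdef: "0 < sq_form A m v v" if v: "v \<in> span (u ` {..<d})" "v \<noteq> 0" for v
  proof -
    have "0 < \<zeta> * (norm v)\<^sup>2" using z(1) v(2) by simp
    then show ?thesis using z(2)[OF v(1)] by linarith
  qed
  have "\<exists>v. (\<forall>i<d. v i \<in> span (u ` {..<d})) \<and>
    (\<forall>i<d. \<forall>j<d. sq_form A m (v i) (v j) = (if i = j then 1 else 0))"
    by (rule Gram_Schmidt_sq_form[OF ux posdef order_refl])
  then obtain v where "\<forall>i<d. v i \<in> span (u ` {..<d})"
      "\<forall>i<d. \<forall>j<d. sq_form A m (v i) (v j) = (if i = j then 1 else 0)" by blast
  then have v: "\<And>i. i < d \<Longrightarrow> v i \<in> span (u ` {..<d})"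
      "\<And>i j. i < d \<Longrightarrow> j < d \<Longrightarrow> sq_form A m (v i) (v j) = (if i = j then 1 else 0)" by blast+
  have bound: "(\<Sum>i<d. (blinfun_apply (v i) y)\<^sup>2) \<le> 1 / \<zeta>" if y: "y \<in> A" for y
  proof -
    define s where "s = (\<Sum>i<d. (blinfun_apply (v i) y)\<^sup>2)"
    \<comment> \<open>The element representing evaluation at \<open>y\<close>: its value at
      \<open>y\<close> and its square in the form are both \<open>s\<close>. Comparison with
      \<open>\<zeta> * (norm w)\<^sup>2\<close> gives
      \<open>\<zeta> * s\<^sup>2 \<le> s\<close>.\<close>
    define w where "w = (\<Sum>i<d. blinfun_apply (v i) y *\<^sub>R v i)"
    have w: "w \<in> span (u ` {..<d})" unfolding w_def by (intro span_sum span_scale v(1)) auto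
    have "blinfun_apply w y = s" by (simp add: w_def s_def blinfun.sum_left blinfun.scaleR_left power2_eq_square)
    then have "s \<le> norm w * 1"
      using norm_blinfun[of w y] mult_left_mono[OF A(1)[OF y], of "norm w"] by simp
    moreover have "s \<ge> 0" by (simp add: s_def sum_nonneg)
    ultimately have "s\<^sup>2 \<le> (norm w)\<^sup>2" by (intro power_mono) auto
    then have "\<zeta> * s\<^sup>2 \<le> \<zeta> * (norm w)\<^sup>2" using z(1) by (intro mult_left_mono) auto
    also have "\<dots> \<le> sq_form A m w w" by (rule z(2)[OF w])
    also have "\<dots> = s"
      by (simp add: w_def s_def sq_form_sum_left sq_form_sum_right sq_form_scaleR_left sq_form_scaleR_right
          v(2) if_distrib power2_eq_square cong: if_cong)
    finally have "\<zeta> * s * s \<le> 1 * s" by (simp add: power2_eq_square mult.assoc)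
    then have "\<zeta> * s \<le> 1" using \<open>s \<ge> 0\<close> by (cases "s = 0") (auto simp: mult_le_cancel_right)
    then show ?thesis using z(1) by (simp add: s_def field_simps)
  qed
  have "real d = (\<Sum>i<d. sq_form A m (v i) (v i))" using v(2) by simp
  also have "\<dots> = (\<Sum>y\<in>A. m y * (\<Sum>i<d. (blinfun_apply (v i) y)\<^sup>2))"
    by (simp add: sq_form_def sum_distrib_left power2_eq_square sum.swap[of _ A])
  also have "\<dots> \<le> (\<Sum>y\<in>A. m y * (1 / \<zeta>))" by (intro sum_mono mult_left_mono bound A)
  also have "\<dots> = 1 / \<zeta>" using A(3) by (simp flip: sum_distrib_right sum_divide_distrib)
  finally show ?thesis .
qed

text \<open>For \<open>p < 2\<close> no multiple of the square dominates the p-th power near 0.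
  Subtracting \<open>e\<close> discards the small values, and on the rest the square is at least
  \<open>e powr (2 / p)\<close>.\<close>

lemma powr_le_add_square:
  fixes s e p :: real
  assumes "\<bar>s\<bar> \<le> 1" "0 < e" "1 \<le> p"
  shows "e powr (2 / p) * (\<bar>s\<bar> powr p - e) \<le> s\<^sup>2"
proof (cases "\<bar>s\<bar> powr p \<le> e")
  case True
  then have "e powr (2 / p) * (\<bar>s\<bar> powr p - e) \<le> 0" by (intro mult_nonneg_nonpos) auto
  then show ?thesis using zero_le_power2[of s] by linarith
next
  case False
  have "e powr (2 / p) \<le> (\<bar>s\<bar> powr p) powr (2 / p)"
    using False assms by (intro powr_mono2) auto
  also have "\<dots> = s\<^sup>2" using assms(3) by (cases "s = 0") (auto simp: powr_powr)
  finally have le: "e powr (2 / p) \<le> s\<^sup>2" .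
  have "\<bar>s\<bar> powr p \<le> 1 powr p" using assms by (intro powr_mono2) auto
  then have "e powr (2 / p) * (\<bar>s\<bar> powr p - e) \<le> e powr (2 / p) * 1"
    using assms(2) by (intro mult_left_mono) auto
  with le show ?thesis by simp
qed

text \<open>A finite form of Pietsch's domination theorem: \<open>small\<close> bounds the p-summing
  norm of the identity of the dual, and minimax yields a finitely supported probability measure on
  the unit ball for the given \<open>u i\<close>, up to \<open>e\<close>.\<close>

lemma averaging_weights:
  fixes u :: "nat \<Rightarrow> 'a::real_normed_vector \<Rightarrow>\<^sub>L real"
  assumes p: "1 \<le> p" and L: "1 \<le> L"
    and small: "\<And>n (v :: nat \<Rightarrow> 'a \<Rightarrow>\<^sub>L real).
      (\<And>x. norm x \<le> 1 \<Longrightarrow> (\<Sum>i<n. \<bar>blinfun_apply (v i) x\<bar> powr p) \<le> 1) \<Longrightarrow> (\<Sum>i<n. norm (v i) powr p) < L"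
    and u: "\<And>i. i < N \<Longrightarrow> norm (u i) = 1" and e: "0 < e"
  shows "\<exists>A m. (\<forall>x\<in>A. norm x \<le> 1) \<and> (\<forall>x\<in>A. 0 \<le> m x) \<and> (\<Sum>x\<in>A. m x) = 1 \<and>
    (\<forall>i<N. 1 / L - e \<le> (\<Sum>x\<in>A. m x * \<bar>blinfun_apply (u i) x\<bar> powr p))"
proof -
  define val where "val x i = \<bar>blinfun_apply (u i) x\<bar> powr p" for x i
  define C where "C = {k. \<exists>A m. finite A \<and> (\<forall>x\<in>A. norm x \<le> 1) \<and> (\<forall>x\<in>A. 0 \<le> m x) \<and> (\<Sum>x\<in>A. m x) = 1 \<and>
      k = (\<lambda>i. \<Sum>x\<in>A. m x * val x i)}"
  have val1: "0 \<le> val x i \<and> val x i \<le> 1" if "norm x \<le> 1" "i < N" for x i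
  proof -
    have "\<bar>blinfun_apply (u i) x\<bar> \<le> norm (u i) * norm x" using norm_blinfun[of "u i" x] by simp
    also have "\<dots> \<le> 1" using u[OF that(2)] that(1) by simp
    finally have "\<bar>blinfun_apply (u i) x\<bar> powr p \<le> 1 powr p" using p by (intro powr_mono2) auto
    then show ?thesis by (simp add: val_def)
  qed
  have "\<exists>k\<in>C. \<forall>i<N. 1 / L - e \<le> k i"
  proof (rule minimax_Frank_Wolfe[where K = "val ` {x. norm x \<le> 1}"])
    have "val 0 \<in> C" unfolding C_def by (intro CollectI exI[of _ "{0}"] exI[of _ "\<lambda>_. 1"]) auto
    then show "C \<noteq> {}" by blast
    show "1 / L \<le> 1" using L by simp
    show "0 < e" by fact
    fix k l and t :: real
    assume k: "k \<in> C" "l \<in> val ` {x. norm x \<le> 1}" and t: "0 \<le> t" "t \<le> 1"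
    obtain A m where A: "finite A" "\<And>x. x \<in> A \<Longrightarrow> norm x \<le> 1" "\<And>x. x \<in> A \<Longrightarrow> 0 \<le> m x"
      "(\<Sum>x\<in>A. m x) = 1" "k = (\<lambda>i. \<Sum>x\<in>A. m x * val x i)" using k(1) by (auto simp: C_def)
    obtain y where y: "norm y \<le> 1" "l = val y" using k(2) by auto
    \<comment> \<open>\<open>y\<close> may already belong to \<open>A\<close>, so the two
      contributions are added separately.\<close>
    define m' where "m' x = (1 - t) * (if x \<in> A then m x else 0) + t * (if x = y then 1 else 0)" for x
    have sum_m': "(\<Sum>x\<in>insert y A. m' x * f x) = (1 - t) * (\<Sum>x\<in>A. m x * f x) + t * f y" for f
    proof -
      have "(\<Sum>x\<in>insert y A. m' x * f x) = (1 - t) * (\<Sum>x\<in>insert y A. if x \<in> A then m x * f x else 0)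
          + t * (\<Sum>x\<in>insert y A. if x = y then f x else 0)"
        unfolding sum_distrib_left sum.distrib[symmetric]
        by (rule sum.cong) (auto simp: m'_def algebra_simps)
      also have "(\<Sum>x\<in>insert y A. if x \<in> A then m x * f x else 0) = (\<Sum>x\<in>A. m x * f x)"
        using A(1) by (intro sum.mono_neutral_cong_right) auto
      also have "(\<Sum>x\<in>insert y A. if x = y then f x else 0) = f y"
        using A(1) by (subst sum.delta) auto
      finally show ?thesis .
    qed
    have "finite (insert y A)" "\<forall>x\<in>insert y A. norm x \<le> 1" using A y by auto
    moreover have "\<forall>x\<in>insert y A. 0 \<le> m' x" using A t by (auto simp: m'_def)
    moreover have "(\<Sum>x\<in>insert y A. m' x) = 1" using sum_m'[of "\<lambda>_. 1"] A(4) by simp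
    moreover have "(\<lambda>i. (1 - t) * k i + t * l i) = (\<lambda>i. \<Sum>x\<in>insert y A. m' x * val x i)"
      by (simp add: sum_m' A(5) y(2))
    ultimately show "(\<lambda>i. (1 - t) * k i + t * l i) \<in> C" unfolding C_def by blast
  next
    fix k i assume k: "k \<in> C \<union> val ` {x. norm x \<le> 1}" and i: "i < N"
    from k show "0 \<le> k i \<and> k i \<le> 1"
    proof
      assume "k \<in> C"
      then obtain A m where A: "\<And>x. x \<in> A \<Longrightarrow> norm x \<le> 1" "\<And>x. x \<in> A \<Longrightarrow> 0 \<le> m x"
        "(\<Sum>x\<in>A. m x) = 1" "k = (\<lambda>i. \<Sum>x\<in>A. m x * val x i)" by (auto simp: C_def)
      have "0 \<le> k i" unfolding A(4) using A(1,2) val1 i by (intro sum_nonneg mult_nonneg_nonneg) auto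
      moreover have "k i \<le> (\<Sum>x\<in>A. m x * 1)"
        unfolding A(4) using A(1,2) val1 i by (intro sum_mono mult_left_mono) auto
      ultimately show ?thesis using A(3) by simp
    qed (use val1 i in auto)
  next
    fix c :: "nat \<Rightarrow> real" assume c: "\<And>i. 0 \<le> c i"
    show "\<exists>l\<in>val ` {x. norm x \<le> 1}. 1 / L * (\<Sum>i<N. c i) \<le> (\<Sum>i<N. c i * l i)"
    proof (rule ccontr)
      assume "\<not> ?thesis"
      then have less: "(\<Sum>i<N. c i * val x i) < 1 / L * (\<Sum>i<N. c i)" if "norm x \<le> 1" for x
        using that by (force simp: not_le)
      define D where "D = 1 / L * (\<Sum>i<N. c i)"
      have "D > 0" using less[of 0] by (simp add: D_def val_def)
      then have D: "D > 0" "(\<Sum>i<N. c i) = L * D" using L by (auto simp: D_def)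
      \<comment> \<open>If the dual condition fails, this scaling makes the weak sum of p-th powers
        at most 1 and the strong one equal to \<open>L\<close>, contradicting
        \<open>small\<close>.\<close>
      define v where "v i = ((c i / D) powr (1 / p)) *\<^sub>R u i" for i
      have root: "((c i / D) powr (1 / p) * r) powr p = c i * r powr p / D" if "0 \<le> r" for i r
        using c[of i] D p that by (simp add: powr_mult powr_powr)
      have "(\<Sum>i<N. norm (v i) powr p) < L"
      proof (rule small)
        fix x :: 'a assume x: "norm x \<le> 1"
        have "(\<Sum>i<N. \<bar>blinfun_apply (v i) x\<bar> powr p) = (\<Sum>i<N. c i * val x i) / D"
          by (simp add: v_def blinfun.scaleR_left abs_mult root val_def sum_divide_distrib)
        also have "\<dots> \<le> 1" using less[OF x] D(1) unfolding D_def[symmetric] by simp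
        finally show "(\<Sum>i<N. \<bar>blinfun_apply (v i) x\<bar> powr p) \<le> 1" .
      qed
      moreover have "norm (v i) powr p = c i / D" if "i < N" for i
        using root[of 1 i] u[OF that] by (simp add: v_def)
      then have "(\<Sum>i<N. norm (v i) powr p) = (\<Sum>i<N. c i) / D"
        by (simp add: sum_divide_distrib)
      ultimately show False using D by simp
    qed
  qed
  then obtain A m where A: "\<forall>x\<in>A. norm x \<le> 1" "\<forall>x\<in>A. 0 \<le> m x" "(\<Sum>x\<in>A. m x) = 1"
      "\<forall>i<N. 1 / L - e \<le> (\<Sum>x\<in>A. m x * val x i)"
    unfolding C_def by blast
  then show ?thesis unfolding val_def by blast
qed

text \<open>A form of the Dvoretzky--Rogers theorem: the identity of an infinite-dimensional dual space is
  not absolutely \<open>p\<close>-summing.\<close>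

lemma Dvoretzky_Rogers:
  fixes L p :: real
  assumes p: "1 \<le> p"
    and bio: "\<And>d. \<exists>(u :: nat \<Rightarrow> 'a::real_normed_vector \<Rightarrow>\<^sub>L real) x.
      \<forall>i<d. \<forall>j<d. blinfun_apply (u i) (x j) = (if i = j then 1 else 0)"
  obtains n and v :: "nat \<Rightarrow> 'a::real_normed_vector \<Rightarrow>\<^sub>L real"
  where "\<And>x. norm x \<le> 1 \<Longrightarrow> (\<Sum>i<n. \<bar>blinfun_apply (v i) x\<bar> powr p) \<le> 1" "L \<le> (\<Sum>i<n. norm (v i) powr p)"
proof (rule ccontr)
  note witness = that
  assume "\<not> thesis"
  define L' where "L' = max 1 L"
  have L: "1 \<le> L'" by (simp add: L'_def)
  have small: "(\<Sum>i<n. norm (v i) powr p) < L'"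
    if "\<And>x. norm x \<le> 1 \<Longrightarrow> (\<Sum>i<n. \<bar>blinfun_apply (v i) x\<bar> powr p) \<le> 1" for n and v :: "nat \<Rightarrow> 'a \<Rightarrow>\<^sub>L real"
    using \<open>\<not> thesis\<close> witness[of v n] that by (force simp: L'_def)
  \<comment> \<open>One \<open>e\<close> is lost in the averaging and one in passing to squares; at
    least \<open>e\<close> remains of \<open>1 / L'\<close>.\<close>
  define e where "e = 1 / (4 * L')"
  have e: "e > 0" "1 / L' - e - e \<ge> e" using L by (auto simp: e_def field_simps)
  define \<zeta> where "\<zeta> = e powr (2 / p) * e"
  have z: "\<zeta> > 0" using e by (simp add: \<zeta>_def)
  \<comment> \<open>A dimension beyond the bound that \<open>dimension_bound_sq_form\<close> will
    give with \<open>\<zeta> / 2\<close>.\<close>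
  obtain d :: nat where d: "1 / (\<zeta> / 2) < d" using reals_Archimedean2 by blast
  obtain u :: "nat \<Rightarrow> 'a \<Rightarrow>\<^sub>L real" and x
    where ux: "\<And>i j. i < d \<Longrightarrow> j < d \<Longrightarrow> blinfun_apply (u i) (x j) = (if i = j then 1 else 0)"
    using bio[of d] by blast
  define E where "E = span (u ` {..<d})"
  define R where "R = (\<Sum>i<d. norm (x i))"
  obtain K where K: "compact K" "\<And>a. (\<forall>i<d. \<bar>a i\<bar> \<le> R) \<Longrightarrow> (\<Sum>i<d. a i *\<^sub>R u i) \<in> K"
    using compact_bounded_combinations[of d R u] by blast
  have "closed {v :: 'a \<Rightarrow>\<^sub>L real. norm v = 1}" by (intro closed_Collect_eq continuous_intros)
  then have "closed (sphere (0 :: 'a \<Rightarrow>\<^sub>L real) 1)" by (simp add: sphere_def)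
  \<comment> \<open>A finite net reduces the sphere of the span to finitely many functionals. At
    distance \<open>\<zeta> / 4\<close> the form changes by at most \<open>\<zeta> / 2\<close>, as a
    difference of squares is a difference times a sum bounded by 2.\<close>
  then have "compact (K \<inter> sphere 0 1)" by (intro compact_Int_closed K)
  then obtain T where T: "finite T" "T \<subseteq> K \<inter> sphere 0 1" "K \<inter> sphere 0 1 \<subseteq> (\<Union>v\<in>T. ball v (\<zeta> / 4))"
    using seq_compact_imp_totally_bounded[OF compact_imp_seq_compact, of "K \<inter> sphere 0 1"] z
    by (metis divide_pos_pos zero_less_numeral)
  obtain t where t: "bij_betw t {..<card T} T" using ex_bij_betw_nat_finite[OF T(1)] by (auto simp: atLeast0LessThan)
  have t1: "norm (t i) = 1" if "i < card T" for i
    using bij_betwE[OF t] that T(2) by fastforce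
  have "\<exists>A m. (\<forall>x\<in>A. norm x \<le> 1) \<and> (\<forall>x\<in>A. 0 \<le> m x) \<and> (\<Sum>x\<in>A. m x) = 1 \<and>
    (\<forall>i<card T. 1 / L' - e \<le> (\<Sum>x\<in>A. m x * \<bar>blinfun_apply (t i) x\<bar> powr p))"
    by (rule averaging_weights[OF p L small t1 e(1)])
  then obtain A m where Am: "\<forall>x\<in>A. norm x \<le> 1" "\<forall>x\<in>A. 0 \<le> m x" "(\<Sum>x\<in>A. m x) = 1"
    "\<forall>i<card T. 1 / L' - e \<le> (\<Sum>x\<in>A. m x * \<bar>blinfun_apply (t i) x\<bar> powr p)" by blast
  then have A: "\<And>x. x \<in> A \<Longrightarrow> norm x \<le> 1" "\<And>x. x \<in> A \<Longrightarrow> 0 \<le> m x" "(\<Sum>x\<in>A. m x) = 1"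
    and avg: "\<And>i. i < card T \<Longrightarrow> 1 / L' - e \<le> (\<Sum>x\<in>A. m x * \<bar>blinfun_apply (t i) x\<bar> powr p)"
    by blast+
  have sq_T: "\<zeta> \<le> sq_form A m v v" if v: "v \<in> T" for v
  proof -
    obtain i where i: "i < card T" "v = t i" using t v by (auto simp: bij_betw_def)
    have "e \<le> (\<Sum>x\<in>A. m x * \<bar>blinfun_apply v x\<bar> powr p) - e * (\<Sum>x\<in>A. m x)"
      using avg[OF i(1)] e(2) i(2) A(3) by simp
    also have "\<dots> = (\<Sum>x\<in>A. m x * (\<bar>blinfun_apply v x\<bar> powr p - e))"
      by (simp add: sum_distrib_left algebra_simps sum_subtractf)
    finally have "\<zeta> \<le> e powr (2 / p) * (\<Sum>x\<in>A. m x * (\<bar>blinfun_apply v x\<bar> powr p - e))"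
      unfolding \<zeta>_def using e by (intro mult_left_mono) auto
    also have "\<dots> = (\<Sum>x\<in>A. m x * (e powr (2 / p) * (\<bar>blinfun_apply v x\<bar> powr p - e)))"
      by (simp add: sum_distrib_left mult.left_commute)
    also have "\<dots> \<le> (\<Sum>x\<in>A. m x * (blinfun_apply v x)\<^sup>2)"
    proof (intro sum_mono mult_left_mono powr_le_add_square)
      fix x assume x: "x \<in> A"
      have "\<bar>blinfun_apply v x\<bar> \<le> norm v * norm x" using norm_blinfun[of v x] by simp
      then show "\<bar>blinfun_apply v x\<bar> \<le> 1" using t1[OF i(1)] i(2) A(1)[OF x] by simp
    qed (use A e p in auto)
    finally show ?thesis by (simp add: sq_form_def power2_eq_square)
  qed
  have sphere: "\<zeta> / 2 \<le> sq_form A m v v" if v: "v \<in> E" "norm v = 1" for v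
  proof -
    have "\<bar>blinfun_apply v (x i)\<bar> \<le> R" if "i < d" for i
    proof -
      have "\<bar>blinfun_apply v (x i)\<bar> \<le> norm (x i)" using norm_blinfun[of v "x i"] v(2) by simp
      also have "\<dots> \<le> R" unfolding R_def using that by (intro member_le_sum) auto
      finally show ?thesis .
    qed
    then have "(\<Sum>i<d. blinfun_apply v (x i) *\<^sub>R u i) \<in> K" by (intro K) auto
    then have "v \<in> K" using span_biorthogonal(1)[OF ux order_refl, where v = v] v(1) by (simp add: E_def)
    then obtain w where w: "w \<in> T" "dist w v < \<zeta> / 4" using T(3) v(2) by auto
    have "sq_form A m w w - sq_form A m v v
        = (\<Sum>x\<in>A. m x * ((blinfun_apply w x - blinfun_apply v x) * (blinfun_apply w x + blinfun_apply v x)))"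
      by (simp add: sq_form_def algebra_simps sum_subtractf)
    also have "\<dots> \<le> (\<Sum>x\<in>A. m x * (\<zeta> / 4 * 2))"
    proof (intro sum_mono mult_left_mono)
      fix x assume x: "x \<in> A"
      have "\<bar>blinfun_apply w x - blinfun_apply v x\<bar> \<le> norm (w - v) * norm x"
        using norm_blinfun[of "w - v" x] by (simp add: blinfun.diff_left)
      also have "\<dots> \<le> \<zeta> / 4 * 1" using w(2) A(1)[OF x] z by (intro mult_mono) (auto simp: dist_norm)
      finally have 1: "\<bar>blinfun_apply w x - blinfun_apply v x\<bar> \<le> \<zeta> / 4" by simp
      have "norm w = 1" using w(1) T(2) by auto
      then have 2: "\<bar>blinfun_apply w x + blinfun_apply v x\<bar> \<le> 2"
        using norm_blinfun[of w x] norm_blinfun[of v x] v(2) A(1)[OF x] by simp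
      have "\<bar>blinfun_apply w x - blinfun_apply v x\<bar> * \<bar>blinfun_apply w x + blinfun_apply v x\<bar> \<le> \<zeta> / 4 * 2"
        using 1 2 z by (intro mult_mono) auto
      then show "(blinfun_apply w x - blinfun_apply v x) * (blinfun_apply w x + blinfun_apply v x) \<le> \<zeta> / 4 * 2"
        by (metis abs_mult abs_ge_self order_trans)
    qed (use A in auto)
    also have "\<dots> = \<zeta> / 2" using A(3) by (simp flip: sum_distrib_right sum_divide_distrib)
    finally show ?thesis using sq_T[OF w(1)] by simp
  qed
  have "d \<le> 1 / (\<zeta> / 2)"
  proof (rule dimension_bound_sq_form[OF ux A])
    show "0 < \<zeta> / 2" using z by simp
    fix v assume v: "v \<in> span (u ` {..<d})"
    show "\<zeta> / 2 * (norm v)\<^sup>2 \<le> sq_form A m v v"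
    proof (cases "v = 0")
      case False
      have "\<zeta> / 2 \<le> sq_form A m (v /\<^sub>R norm v) (v /\<^sub>R norm v)"
        using v False by (intro sphere) (auto simp: E_def span_scale)
      then show ?thesis
        using False by (simp add: sq_form_scaleR_left sq_form_scaleR_right power2_eq_square field_simps)
    qed (simp add: sq_form_def)
  qed auto
  then show False using d by simp
qed

subsection \<open>Uniform integrability of weakly null sequences\<close>

lemma integrable_bounded_mult:
  fixes f g :: "'a \<Rightarrow> real"
  assumes "integrable M f" "g \<in> borel_measurable M" "\<And>x. \<bar>g x\<bar> \<le> C"
  shows "integrable M (\<lambda>x. g x * f x)"
proof (rule Bochner_Integration.integrable_bound)
  show "integrable M (\<lambda>x. C * \<bar>f x\<bar>)" using assms(1) by simp
  show "AE x in M. norm (g x * f x) \<le> norm (C * \<bar>f x\<bar>)"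
  proof (rule AE_I2)
    fix x
    have "\<bar>g x\<bar> * \<bar>f x\<bar> \<le> \<bar>C\<bar> * \<bar>f x\<bar>" using assms(3)[of x] by (intro mult_right_mono) auto
    then show "norm (g x * f x) \<le> norm (C * \<bar>f x\<bar>)" by (simp add: abs_mult)
  qed
qed (use assms in auto)

lemma integrable_indicator_abs:
  fixes f :: "'a \<Rightarrow> real"
  assumes "integrable M f" "A \<in> sets M"
  shows "integrable M (\<lambda>x. indicator A x * \<bar>f x\<bar>)"
  using assms by (intro integrable_bounded_mult[where C = 1]) auto

text \<open>By dominated convergence the part of \<open>f\<close> above some level \<open>k\<close>
  has integral below \<open>e / 2\<close>; the part below it contributes at most \<open>k\<close>
  times the measure of \<open>A\<close>.\<close>

lemma absolute_continuity_integral: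
  fixes f :: "'a \<Rightarrow> real"
  assumes fin: "finite_measure M" and f: "integrable M f" and e: "0 < e"
  shows "\<exists>d>0. \<forall>A\<in>sets M. measure M A < d \<longrightarrow> (\<integral>x. indicator A x * \<bar>f x\<bar> \<partial>M) < e"
proof -
  interpret finite_measure M by (rule fin)
  have "(\<lambda>k::nat. \<integral>x. \<bar>f x\<bar> - min \<bar>f x\<bar> (real k) \<partial>M) \<longlonglongrightarrow> (\<integral>x. 0 \<partial>M)"
  proof (rule integral_dominated_convergence[where w = "\<lambda>x. \<bar>f x\<bar>"])
    show "AE x in M. (\<lambda>k::nat. \<bar>f x\<bar> - min \<bar>f x\<bar> (real k)) \<longlonglongrightarrow> 0"
    proof (rule AE_I2)
      fix x
      obtain N :: nat where "\<bar>f x\<bar> \<le> N" using real_arch_simple by blast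
      then have "\<forall>\<^sub>F k in sequentially. \<bar>f x\<bar> - min \<bar>f x\<bar> (real k) = 0"
        by (intro eventually_sequentiallyI[of N]) auto
      then show "(\<lambda>k::nat. \<bar>f x\<bar> - min \<bar>f x\<bar> (real k)) \<longlonglongrightarrow> 0" by (rule tendsto_eventually)
    qed
  qed (use f in auto)
  then have "\<forall>\<^sub>F k::nat in sequentially. (\<integral>x. \<bar>f x\<bar> - min \<bar>f x\<bar> (real k) \<partial>M) < e / 2"
    using e by (intro order_tendstoD(2)) auto
  then obtain k :: nat where k: "(\<integral>x. \<bar>f x\<bar> - min \<bar>f x\<bar> (real k) \<partial>M) < e / 2"
    by (meson eventually_sequentially order_refl)
  have int: "integrable M (\<lambda>x. \<bar>f x\<bar> - min \<bar>f x\<bar> (real k))" using f by simp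
  show ?thesis
  proof (intro exI conjI ballI impI)
    show "0 < e / (2 * (real k + 1))" using e by simp
    fix A assume A: "A \<in> sets M" "measure M A < e / (2 * (real k + 1))"
    have "(\<integral>x. indicator A x * \<bar>f x\<bar> \<partial>M) \<le> (\<integral>x. (\<bar>f x\<bar> - min \<bar>f x\<bar> (real k)) + real k * indicator A x \<partial>M)"
    proof (rule integral_mono)
      show "integrable M (\<lambda>x. indicator A x * \<bar>f x\<bar>)" by (rule integrable_indicator_abs[OF f A(1)])
      show "integrable M (\<lambda>x. (\<bar>f x\<bar> - min \<bar>f x\<bar> (real k)) + real k * indicator A x)"
        using int A(1) by (intro Bochner_Integration.integrable_add) (auto simp: emeasure_eq_measure)
    qed (auto simp: indicator_def)
    also have "\<dots> = (\<integral>x. \<bar>f x\<bar> - min \<bar>f x\<bar> (real k) \<partial>M) + real k * measure M A"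
      using int A(1) by (subst Bochner_Integration.integral_add) (auto simp: emeasure_eq_measure)
    also have "\<dots> < e / 2 + e / 2"
    proof (rule add_strict_mono[OF k])
      have "real k * measure M A \<le> (real k + 1) * measure M A" by (simp add: mult_right_mono)
      also have "\<dots> < e / 2" using A(2) by (simp add: field_simps)
      finally show "real k * measure M A < e / 2" .
    qed
    finally show "(\<integral>x. indicator A x * \<bar>f x\<bar> \<partial>M) < e" by simp
  qed
qed

text \<open>A common \<open>d\<close> for an initial segment is what forces the gliding hump to move
  on to a later index.\<close>

lemma absolute_continuity_integral_finite:
  fixes h :: "nat \<Rightarrow> 'a \<Rightarrow> real"
  assumes fin: "finite_measure M" and h: "\<And>i. integrable M (h i)" and e: "0 < e"
  shows "\<exists>d>0. \<forall>i\<le>n. \<forall>A\<in>sets M. measure M A < d \<longrightarrow> (\<integral>x. indicator A x * \<bar>h i x\<bar> \<partial>M) < e"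
proof -
  have int: "integrable M (\<lambda>x. \<Sum>i\<le>n. \<bar>h i x\<bar>)" using h by auto
  from absolute_continuity_integral[OF fin int e] obtain d where d: "d > 0"
    "\<And>A. A \<in> sets M \<Longrightarrow> measure M A < d \<Longrightarrow> (\<integral>x. indicator A x * \<bar>\<Sum>i\<le>n. \<bar>h i x\<bar>\<bar> \<partial>M) < e" by blast
  show ?thesis
  proof (intro exI[of _ d] conjI allI impI ballI d(1))
    fix i A assume i: "i \<le> n" and A: "A \<in> sets M" "measure M A < d"
    have "\<bar>h i x\<bar> \<le> (\<Sum>i\<le>n. \<bar>h i x\<bar>)" for x
      using i by (intro member_le_sum[of i "{..n}" "\<lambda>i. \<bar>h i x\<bar>"]) auto
    then have "(\<integral>x. indicator A x * \<bar>h i x\<bar> \<partial>M) \<le> (\<integral>x. indicator A x * \<bar>\<Sum>i\<le>n. \<bar>h i x\<bar>\<bar> \<partial>M)"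
    proof (intro integral_mono)
      show "integrable M (\<lambda>x. indicator A x * \<bar>h i x\<bar>)" by (rule integrable_indicator_abs[OF h A(1)])
      show "integrable M (\<lambda>x. indicator A x * \<bar>\<Sum>i\<le>n. \<bar>h i x\<bar>\<bar>)"
        by (rule integrable_indicator_abs[OF int A(1)])
    qed (auto simp: indicator_def)
    then show "(\<integral>x. indicator A x * \<bar>h i x\<bar> \<partial>M) < e" using d(2)[OF A] by linarith
  qed
qed

text \<open>Gliding hump: on each new set \<open>A\<close> carrying mass \<open>\<ge> e\<close> of some \<open>h n\<close> the test function is
  overwritten by \<open>s * sgn (h n x)\<close>.  Since the two signs \<open>s\<close> give values differing by \<open>2 * e\<close>, one of them
  makes the integral against \<open>h n\<close> large, and no disjointness of the sets is needed.\<close>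

lemma weakly_null_imp_uniformly_integrable:
  fixes h :: "nat \<Rightarrow> 'a \<Rightarrow> real"
  assumes fin: "finite_measure M" and h: "\<And>n. integrable M (h n)"
    and null: "\<And>g. g \<in> borel_measurable M \<Longrightarrow> (\<And>x. \<bar>g x\<bar> \<le> 1) \<Longrightarrow> (\<lambda>n. \<integral>x. g x * h n x \<partial>M) \<longlonglongrightarrow> 0"
    and e: "0 < e"
  shows "\<exists>d>0. \<forall>n. \<forall>A\<in>sets M. measure M A < d \<longrightarrow> (\<integral>x. indicator A x * \<bar>h n x\<bar> \<partial>M) < e"
proof (rule ccontr)
  assume "\<not> ?thesis"
  then have bad: "\<exists>n. \<exists>A\<in>sets M. measure M A < d \<and> e \<le> (\<integral>x. indicator A x * \<bar>h n x\<bar> \<partial>M)" if "d > 0" for d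
    using that by (force simp: not_less)
  interpret finite_measure M by (rule fin)
  \<comment> \<open>A stage is an index, a test function with integral at least \<open>e\<close>
    against it, and a tolerance: on sets smaller than \<open>d\<close> all functions up to that
    index have mass below \<open>e / 4\<close>.\<close>
  define P where "P s \<longleftrightarrow> (case s of (n, G, d) \<Rightarrow> G \<in> borel_measurable M \<and> (\<forall>x. \<bar>G x\<bar> \<le> 1) \<and>
      e \<le> \<bar>\<integral>x. G x * h n x \<partial>M\<bar> \<and> 0 < d \<and>
      (\<forall>i\<le>n. \<forall>A\<in>sets M. measure M A < d \<longrightarrow> (\<integral>x. indicator A x * \<bar>h i x\<bar> \<partial>M) < e / 4))"
    for s :: "nat \<times> ('a \<Rightarrow> real) \<times> real"
  \<comment> \<open>Tolerances halve and each change lives on a set smaller than a quarter of the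
    current one, so all later changes together stay within the tolerance.\<close>
  define Q where "Q s s' \<longleftrightarrow> (case (s, s') of ((n, G, d), (n', G', d')) \<Rightarrow> n < n' \<and> d' \<le> d / 2 \<and>
      (\<exists>A\<in>sets M. measure M A < d / 4 \<and> (\<forall>x. x \<notin> A \<longrightarrow> G' x = G x)))"
    for s s' :: "nat \<times> ('a \<Rightarrow> real) \<times> real"
  have step: "\<exists>n' G' d'. P (n', G', d') \<and> d' \<le> d / 2 \<and>
      (\<exists>A\<in>sets M. measure M A < d / 4 \<and> e \<le> (\<integral>x. indicator A x * \<bar>h n' x\<bar> \<partial>M) \<and> (\<forall>x. x \<notin> A \<longrightarrow> G' x = G x))"
    if G: "G \<in> borel_measurable M" "\<And>x. \<bar>G x\<bar> \<le> 1" and d: "d > 0" for G d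
  proof -
    obtain n A where A: "A \<in> sets M" "measure M A < d / 4" "e \<le> (\<integral>x. indicator A x * \<bar>h n x\<bar> \<partial>M)"
      using bad[of "d / 4"] d by auto
    define a where "a = (\<integral>x. indicator A x * \<bar>h n x\<bar> \<partial>M)"
    define b where "b = (\<integral>x. (indicator (space M - A) x * G x) * h n x \<partial>M)"
    have hm: "h n \<in> borel_measurable M" using h[of n] by simp
    have G': "\<exists>s::real. \<bar>s\<bar> = 1 \<and> a \<le> \<bar>s * a + b\<bar>"
    proof (cases "b \<ge> 0")
      case True then show ?thesis by (intro exI[of _ 1]) auto
    next
      case False then show ?thesis by (intro exI[of _ "-1"]) auto
    qed
    then obtain s :: real where s: "\<bar>s\<bar> = 1" "a \<le> \<bar>s * a + b\<bar>" by blast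
    define G' where "G' x = (if x \<in> A then s * sgn (h n x) else G x)" for x
    have "G' \<in> borel_measurable M" unfolding G'_def using A(1) G(1) hm by measurable
    moreover have "\<bar>G' x\<bar> \<le> 1" for x using G(2)[of x] s(1) by (simp add: G'_def abs_mult abs_sgn_eq)
    moreover have "(\<integral>x. G' x * h n x \<partial>M) = s * a + b"
    proof -
      have "(\<integral>x. G' x * h n x \<partial>M)
          = (\<integral>x. s * (indicator A x * \<bar>h n x\<bar>) + (indicator (space M - A) x * G x) * h n x \<partial>M)"
        by (rule Bochner_Integration.integral_cong) (auto simp: G'_def indicator_def abs_sgn mult_ac)
      also have "\<dots> = s * a + b"
        unfolding a_def b_def
      proof (subst Bochner_Integration.integral_add)
        show "integrable M (\<lambda>x. s * (indicator A x * \<bar>h n x\<bar>))"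
          by (intro integrable_mult_right integrable_indicator_abs A h)
        show "integrable M (\<lambda>x. indicator (space M - A) x * G x * h n x)"
          using A(1) h[of n] G by (intro integrable_bounded_mult[where C = 1]) (auto simp: indicator_def)
      qed simp
      finally show ?thesis .
    qed
    moreover obtain d0 where "d0 > 0"
      "\<forall>i\<le>n. \<forall>A\<in>sets M. measure M A < d0 \<longrightarrow> (\<integral>x. indicator A x * \<bar>h i x\<bar> \<partial>M) < e / 4"
      using absolute_continuity_integral_finite[where h = h and n = n and e = "e / 4", OF fin h] e by auto
    ultimately have "P (n, G', min (d / 2) d0)" using s(2) A(3) d by (auto simp: P_def a_def)
    moreover have "\<exists>A\<in>sets M. measure M A < d / 4 \<and> e \<le> (\<integral>x. indicator A x * \<bar>h n x\<bar> \<partial>M) \<and> (\<forall>x. x \<notin> A \<longrightarrow> G' x = G x)"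
      using A by (intro bexI[of _ A]) (auto simp: G'_def)
    ultimately show ?thesis by (meson min.cobounded1)
  qed
  have "\<exists>s. \<forall>k. P (s k) \<and> Q (s k) (s (Suc k))"
  proof (rule dependent_nat_choice)
    show "\<exists>s. P s" using step[of "\<lambda>_. 0" 1] by auto
  next
    fix s and k :: nat assume s: "P s"
    obtain n G d where sn: "s = (n, G, d)" by (cases s)
    have G: "G \<in> borel_measurable M" "\<And>x. \<bar>G x\<bar> \<le> 1" "d > 0"
      and ac: "\<And>i A. i \<le> n \<Longrightarrow> A \<in> sets M \<Longrightarrow> measure M A < d \<Longrightarrow> (\<integral>x. indicator A x * \<bar>h i x\<bar> \<partial>M) < e / 4"
      using s unfolding P_def sn by auto
    obtain n' G' d' A where *: "P (n', G', d')" "d' \<le> d / 2" "A \<in> sets M" "measure M A < d / 4"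
      "e \<le> (\<integral>x. indicator A x * \<bar>h n' x\<bar> \<partial>M)" "\<forall>x. x \<notin> A \<longrightarrow> G' x = G x"
      using step[OF G] by blast
    \<comment> \<open>The new set is within the old tolerance, so no index up to \<open>n\<close>
      can have mass \<open>e\<close> on it.\<close>
    have "n < n'"
    proof (rule ccontr)
      assume "\<not> n < n'"
      then have "(\<integral>x. indicator A x * \<bar>h n' x\<bar> \<partial>M) < e / 4" using ac[of n' A] * G(3) by simp
      then show False using *(5) e by simp
    qed
    then have "Q s (n', G', d')" using * by (auto simp: Q_def sn)
    then show "\<exists>s'. P s' \<and> Q s s'" using *(1) by blast
  qed
  then obtain s where s: "\<And>k. P (s k)" "\<And>k. Q (s k) (s (Suc k))" by blast
  define n where "n k = fst (s k)" for k
  define G where "G k = fst (snd (s k))" for k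
  define D where "D k = snd (snd (s k))" for k
  have s_eq: "s k = (n k, G k, D k)" for k by (simp add: n_def G_def D_def)
  have G: "G k \<in> borel_measurable M" "\<bar>G k x\<bar> \<le> 1" "e \<le> \<bar>\<integral>x. G k x * h (n k) x \<partial>M\<bar>" "0 < D k" for k x
    using s(1)[of k] unfolding s_eq P_def by auto
  have ac: "(\<integral>x. indicator A x * \<bar>h (n k) x\<bar> \<partial>M) < e / 4" if "A \<in> sets M" "measure M A < D k" for k A
    using s(1)[of k] that unfolding s_eq P_def by auto
  have Q: "n k < n (Suc k)" "D (Suc k) \<le> D k / 2"
    "\<exists>A\<in>sets M. measure M A < D k / 4 \<and> (\<forall>x. x \<notin> A \<longrightarrow> G (Suc k) x = G k x)" for k
    using s(2)[of k] unfolding s_eq Q_def by auto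
  obtain A where A: "\<And>k. A k \<in> sets M" "\<And>k. measure M (A k) < D k / 4" "\<And>k x. x \<notin> A k \<Longrightarrow> G (Suc k) x = G k x"
    using Q(3) by metis
  have D: "D (j + k) \<le> D k * (1 / 2) ^ j" for j k
  proof (induction j)
    case (Suc j)
    then show ?case using Q(2)[of "j + k"] by simp
  qed simp
  define C where "C k = (\<Union>j. A (j + k))" for k
  have C: "C k \<in> sets M" "measure M (C k) < D k" for k
  proof -
    show "C k \<in> sets M" unfolding C_def using A(1) by auto
    have le: "measure M (A (j + k)) \<le> D k / 4 * (1 / 2) ^ j" for j
      using A(2)[of "j + k"] D[of j k] by simp
    have sums: "(\<lambda>j. D k / 4 * (1 / 2) ^ j) sums (D k / 4 * (1 / (1 - 1 / 2)))"
      by (intro sums_mult geometric_sums) simp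
    have summ: "summable (\<lambda>j. measure M (A (j + k)))"
      by (rule summable_comparison_test'[OF sums_summable[OF sums]]) (use le in auto)
    have "measure M (C k) \<le> (\<Sum>j. measure M (A (j + k)))"
      unfolding C_def by (rule finite_measure_subadditive_countably) (use A(1) summ in auto)
    also have "\<dots> \<le> (\<Sum>j. D k / 4 * (1 / 2) ^ j)"
      by (rule suminf_le[OF le summ sums_summable[OF sums]])
    also have "\<dots> = D k / 2" using sums_unique[OF sums] by simp
    finally show "measure M (C k) < D k" using G(4)[of k] by simp
  qed
  \<comment> \<open>Off each \<open>C k\<close> the sequence is eventually constant. Where it has no
    limit, \<open>lim\<close> is an unspecified value; the clipping keeps it in
    \<open>[-1, 1]\<close>.\<close>
  define g where "g x = max (- 1) (min 1 (lim (\<lambda>k. G k x)))" for x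
  have gm: "g \<in> borel_measurable M" unfolding g_def using G(1) by (intro borel_measurable_max borel_measurable_min borel_measurable_lim_metric) auto
  have g1: "\<bar>g x\<bar> \<le> 1" for x by (auto simp: g_def)
  have g_eq: "g x = G k x" if "x \<notin> C k" for x k
  proof -
    have "G (j + k) x = G k x" for j
    proof (induction j)
      case (Suc j)
      have "x \<notin> A (j + k)" using that by (auto simp: C_def)
      then show ?case using A(3) Suc by simp
    qed simp
    then have "(\<lambda>j. G (j + k) x) \<longlonglongrightarrow> G k x" by simp
    then have "(\<lambda>j. G j x) \<longlonglongrightarrow> G k x" by (rule LIMSEQ_offset)
    then have "lim (\<lambda>j. G j x) = G k x" by (rule limI)
    then show ?thesis using G(2)[of k x] by (auto simp: g_def)
  qed
  have big: "e / 2 \<le> \<bar>\<integral>x. g x * h (n k) x \<partial>M\<bar>" for k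
  proof -
    have i1: "integrable M (\<lambda>x. G k x * h (n k) x)" "integrable M (\<lambda>x. g x * h (n k) x)"
      using integrable_bounded_mult[OF h G(1,2)] integrable_bounded_mult[OF h gm g1] by auto
    have iC: "integrable M (\<lambda>x. indicator (C k) x * \<bar>h (n k) x\<bar>)"
      by (rule integrable_indicator_abs[OF h C(1)])
    have "\<bar>(\<integral>x. G k x * h (n k) x \<partial>M) - (\<integral>x. g x * h (n k) x \<partial>M)\<bar>
        = \<bar>\<integral>x. G k x * h (n k) x - g x * h (n k) x \<partial>M\<bar>"
      using i1 by simp
    also have "\<dots> \<le> (\<integral>x. \<bar>G k x * h (n k) x - g x * h (n k) x\<bar> \<partial>M)"
      by (rule integral_abs_bound)
    \<comment> \<open>Two functions bounded by 1 differ by at most 2 on \<open>C k\<close>, where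
      the mass is below \<open>e / 4\<close>; half of the lower bound \<open>e\<close>
      survives.\<close>
    also have "\<dots> \<le> (\<integral>x. 2 * (indicator (C k) x * \<bar>h (n k) x\<bar>) \<partial>M)"
    proof (rule integral_mono)
      fix x
      have "\<bar>G k x - g x\<bar> * \<bar>h (n k) x\<bar> \<le> 2 * indicator (C k) x * \<bar>h (n k) x\<bar>"
        using G(2)[of k x] g1[of x] g_eq[of x k] by (intro mult_right_mono) (auto simp: indicator_def)
      then show "\<bar>G k x * h (n k) x - g x * h (n k) x\<bar> \<le> 2 * (indicator (C k) x * \<bar>h (n k) x\<bar>)"
        by (simp add: abs_mult mult.assoc flip: left_diff_distrib)
    qed (use i1 iC in auto)
    also have "\<dots> < e / 2" using ac[OF C, of k] by simp
    finally show ?thesis using G(3)[of k] by linarith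
  qed
  have "strict_mono n" using Q(1) by (simp add: strict_mono_Suc_iff)
  then have "(\<lambda>k. \<integral>x. g x * h (n k) x \<partial>M) \<longlonglongrightarrow> 0"
    using LIMSEQ_subseq_LIMSEQ[OF null[OF gm g1]] by (simp add: o_def)
  then have "\<forall>\<^sub>F k in sequentially. \<bar>\<integral>x. g x * h (n k) x \<partial>M\<bar> < e / 2"
    using e by (auto dest: tendstoD[of _ _ _ "e / 2"] simp: dist_real_def)
  then show False using big by (auto simp: eventually_sequentially not_less[symmetric])
qed

subsection \<open>Operators on \<open>L\<^sub>1\<close>\<close>

abbreviation unit_measure :: "real measure" where
  "unit_measure \<equiv> lebesgue_on {0<..<1}"

lemma measure_unit_Ioo: "measure unit_measure ({0<..<1} \<inter> {a..<b}) \<le> \<bar>b - a\<bar>"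
proof -
  have "measure unit_measure ({0<..<1} \<inter> {a..<b}) = measure lebesgue ({0<..<1} \<inter> {a..<b})"
    by (rule measure_restrict_space) auto
  also have "\<dots> \<le> measure lebesgue {a..b}"
    by (rule measure_mono_fmeasurable) auto
  also have "\<dots> \<le> \<bar>b - a\<bar>" by simp
  finally show ?thesis .
qed

lemma finite_unit_measure: "finite_measure unit_measure"
  by (rule finite_measureI) (simp add: space_restrict_space emeasure_restrict_space)

lemma integral_unit_const: "(\<integral>t. c \<partial>unit_measure) = (c :: real)"
  by (simp add: lebesgue_integral_const measure_restrict_space)

lemma in_L1_iff: "f \<in> L1 \<longleftrightarrow> integrable unit_measure f"
  by (simp add: L1_def)

lemma L1_norm_nonneg: "0 \<le> L1_norm f"
  by (simp add: L1_norm_def)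

lemma L1_sum: "(\<And>j. j \<in> J \<Longrightarrow> f j \<in> L1) \<Longrightarrow> (\<lambda>t. \<Sum>j\<in>J. f j t) \<in> L1"
  by (auto simp: in_L1_iff)

lemma L1_bounded_linear_scale:
  assumes "L1_bounded_linear T" "f \<in> L1"
  shows "T (\<lambda>t. c * f t) = c *\<^sub>R T f"
  using assms by (simp add: L1_bounded_linear_def)

lemma L1_bounded_linear_add:
  assumes "L1_bounded_linear T" "f \<in> L1" "g \<in> L1"
  shows "T (\<lambda>t. f t + g t) = T f + T g"
  using assms by (simp add: L1_bounded_linear_def)

lemma L1_bounded_linear_sum:
  assumes T: "L1_bounded_linear T" and "finite J" and f: "\<And>j. j \<in> J \<Longrightarrow> f j \<in> L1"
  shows "T (\<lambda>t. \<Sum>j\<in>J. f j t) = (\<Sum>j\<in>J. T (f j))"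
  using assms(2) f
proof (induction J)
  case empty
  have "(\<lambda>_. 0) \<in> L1" by (simp add: in_L1_iff)
  from L1_bounded_linear_scale[OF T this, of 0] show ?case by simp
next
  case (insert j J)
  have "f j \<in> L1" "(\<lambda>t. \<Sum>j\<in>J. f j t) \<in> L1" using insert.prems by (auto intro: L1_sum)
  then have "T (\<lambda>t. f j t + (\<Sum>j\<in>J. f j t)) = T (f j) + T (\<lambda>t. \<Sum>j\<in>J. f j t)"
    by (rule L1_bounded_linear_add[OF T])
  then show ?case using insert by simp
qed

lemma L1_bounded_linear_diff:
  assumes T: "L1_bounded_linear T" and fg: "f \<in> L1" "g \<in> L1"
  shows "T (\<lambda>t. f t - g t) = T f - T g"
proof -
  have "(\<lambda>t. (-1) * g t) \<in> L1" using fg by (simp add: in_L1_iff)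
  then have "T (\<lambda>t. f t + (-1) * g t) = T f + T (\<lambda>t. (-1) * g t)"
    by (rule L1_bounded_linear_add[OF T fg(1)])
  also have "T (\<lambda>t. (-1) * g t) = (-1) *\<^sub>R T g"
    by (rule L1_bounded_linear_scale[OF T fg(2)])
  finally show ?thesis by simp
qed

text \<open>The easy half of the duality between L1 and bounded functions suffices for testing weak
  convergence.\<close>

lemma L1_bounded_linear_integral:
  assumes g: "g \<in> borel_measurable unit_measure" "\<And>x. \<bar>g x\<bar> \<le> 1"
  shows "L1_bounded_linear (\<lambda>f. \<integral>t. g t * f t \<partial>unit_measure)"
  unfolding L1_bounded_linear_def
proof (intro conjI ballI allI exI[of _ 1])
  have int: "integrable unit_measure (\<lambda>t. g t * f t)" if "f \<in> L1" for f
    using integrable_bounded_mult[OF _ g] that by (simp add: in_L1_iff)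
  fix f c assume f: "f \<in> L1"
  show "(\<integral>t. g t * (c * f t) \<partial>unit_measure) = c *\<^sub>R (\<integral>t. g t * f t \<partial>unit_measure)"
    by (simp add: mult.left_commute)
  have "norm (\<integral>t. g t * f t \<partial>unit_measure) \<le> (\<integral>t. \<bar>g t * f t\<bar> \<partial>unit_measure)"
    by simp
  also have "\<dots> \<le> (\<integral>t. \<bar>f t\<bar> \<partial>unit_measure)"
  proof (rule integral_mono)
    show "\<bar>g t * f t\<bar> \<le> \<bar>f t\<bar>" for t
      using mult_right_mono[OF g(2)[of t], of "\<bar>f t\<bar>"] by (simp add: abs_mult)
  qed (use int[OF f] f in \<open>auto simp: in_L1_iff\<close>)
  finally show "norm (\<integral>t. g t * f t \<partial>unit_measure) \<le> 1 * L1_norm f" by (simp add: L1_norm_def)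
  fix f' assume "f' \<in> L1"
  then show "(\<integral>t. g t * (f t + f' t) \<partial>unit_measure)
      = (\<integral>t. g t * f t \<partial>unit_measure) + (\<integral>t. g t * f' t \<partial>unit_measure)"
    using int f by (simp add: distrib_left)
qed

lemma L1_bounded_linear_functional:
  fixes w :: "'a::banach \<Rightarrow>\<^sub>L real"
  assumes "L1_bounded_linear T"
  shows "L1_bounded_linear (\<lambda>f. blinfun_apply w (T f))"
proof -
  obtain C where C: "\<And>f. f \<in> L1 \<Longrightarrow> norm (T f) \<le> C * L1_norm f"
    using assms unfolding L1_bounded_linear_def by blast
  have "norm (blinfun_apply w (T f)) \<le> (norm w * C) * L1_norm f" if "f \<in> L1" for f
    using norm_blinfun[of w "T f"] mult_left_mono[OF C[OF that] norm_ge_zero[of w]] by simp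
  then show ?thesis
    using assms unfolding L1_bounded_linear_def
    by (auto simp: blinfun.add_right blinfun.scaleR_right intro!: exI[of _ "norm w * C"])
qed

text \<open>Uniform integrability with bound 1 on \<open>N\<close> short intervals first gives a
  uniform L1 bound; Chebyshev's inequality then makes the sets of large values uniformly
  small.\<close>

lemma L1_uniform_truncation:
  assumes h: "\<And>n. h n \<in> L1"
    and null: "\<And>g. g \<in> borel_measurable unit_measure \<Longrightarrow> (\<And>x. \<bar>g x\<bar> \<le> 1) \<Longrightarrow>
      (\<lambda>n. \<integral>t. g t * h n t \<partial>unit_measure) \<longlonglongrightarrow> 0"
    and e: "0 < e"
  shows "\<exists>B>0. \<forall>n. (\<integral>t. indicator {t \<in> space unit_measure. B < \<bar>h n t\<bar>} t * \<bar>h n t\<bar> \<partial>unit_measure) < e"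
proof -
  interpret finite_measure unit_measure by (rule finite_unit_measure)
  have hi: "integrable unit_measure (h n)" for n using h by (simp add: in_L1_iff)
  have hm: "h n \<in> borel_measurable unit_measure" for n using hi by auto
  note ui = weakly_null_imp_uniformly_integrable[OF finite_unit_measure hi null]
  have "\<exists>d>0. \<forall>n. \<forall>A\<in>sets unit_measure. measure unit_measure A < d \<longrightarrow>
      (\<integral>x. indicator A x * \<bar>h n x\<bar> \<partial>unit_measure) < 1"
    by (rule ui) auto
  then obtain d1 where d1: "d1 > 0" "\<And>n A. A \<in> sets unit_measure \<Longrightarrow> measure unit_measure A < d1 \<Longrightarrow>
      (\<integral>x. indicator A x * \<bar>h n x\<bar> \<partial>unit_measure) < 1" by blast
  have "\<exists>d>0. \<forall>n. \<forall>A\<in>sets unit_measure. measure unit_measure A < d \<longrightarrow>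
      (\<integral>x. indicator A x * \<bar>h n x\<bar> \<partial>unit_measure) < e"
    by (rule ui) (use e in auto)
  then obtain d where d: "d > 0" "\<And>n A. A \<in> sets unit_measure \<Longrightarrow> measure unit_measure A < d \<Longrightarrow>
      (\<integral>x. indicator A x * \<bar>h n x\<bar> \<partial>unit_measure) < e" by blast
  obtain N :: nat where "1 / d1 < real N" using reals_Archimedean2 by blast
  moreover then have "N > 0" using d1(1) by (intro Nat.gr0I) auto
  ultimately have N: "N > 0" "1 / real N < d1" using d1(1) by (auto simp: field_simps)
  define A where "A k = {0<..<1} \<inter> {real k / N..<(real k + 1) / N}" for k
  have A: "A k \<in> sets unit_measure" "measure unit_measure (A k) < d1" for k
  proof -
    show "A k \<in> sets unit_measure" by (auto simp: A_def sets_restrict_space)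
    have "measure unit_measure (A k) \<le> \<bar>(real k + 1) / N - real k / N\<bar>"
      unfolding A_def by (rule measure_unit_Ioo)
    also have "\<dots> = 1 / N" by (simp add: add_divide_distrib)
    finally show "measure unit_measure (A k) < d1" using N by simp
  qed
  have bound: "(\<integral>t. \<bar>h n t\<bar> \<partial>unit_measure) \<le> real N" for n
  proof -
    have iA: "integrable unit_measure (\<lambda>t. indicator (A k) t * \<bar>h n t\<bar>)" for k
      by (rule integrable_indicator_abs[OF hi A(1)])
    have "(\<integral>t. \<bar>h n t\<bar> \<partial>unit_measure) \<le> (\<integral>t. (\<Sum>k<N. indicator (A k) t * \<bar>h n t\<bar>) \<partial>unit_measure)"
    proof (rule integral_mono)
      fix t assume "t \<in> space unit_measure"
      then have t: "0 < t" "t < 1" by (auto simp: space_restrict_space)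
      define k where "k = nat \<lfloor>real N * t\<rfloor>"
      have k: "real k \<le> real N * t" "real N * t < real k + 1" using t by (auto simp: k_def)
      have "real N * t < real N" using t N by simp
      then have "k < N" using k by linarith
      have "t \<in> A k" using k t N by (auto simp: A_def field_simps)
      then have "\<bar>h n t\<bar> = indicator (A k) t * \<bar>h n t\<bar>" by simp
      also have "\<dots> \<le> (\<Sum>k<N. indicator (A k) t * \<bar>h n t\<bar>)"
        using \<open>k < N\<close> by (intro member_le_sum[of k "{..<N}" "\<lambda>k. indicator (A k) t * \<bar>h n t\<bar>"]) auto
      finally show "\<bar>h n t\<bar> \<le> (\<Sum>k<N. indicator (A k) t * \<bar>h n t\<bar>)" .
    next
      show "integrable unit_measure (\<lambda>t. \<Sum>k<N. indicator (A k) t * \<bar>h n t\<bar>)"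
        by (intro Bochner_Integration.integrable_sum iA)
    qed (use hi in auto)
    also have "\<dots> = (\<Sum>k<N. \<integral>t. indicator (A k) t * \<bar>h n t\<bar> \<partial>unit_measure)"
      by (rule Bochner_Integration.integral_sum) (rule iA)
    also have "\<dots> \<le> (\<Sum>k<N. 1)" using d1(2)[OF A] by (intro sum_mono less_imp_le)
    finally show ?thesis by simp
  qed
  \<comment> \<open>\<open>B * d\<close> exceeds the L1 bound \<open>N\<close>, so Chebyshev gives
    measure strictly below \<open>d\<close>.\<close>
  define B where "B = (real N + 1) / d"
  have B: "B > 0" using d(1) by (simp add: B_def)
  have "(\<integral>t. indicator {t \<in> space unit_measure. B < \<bar>h n t\<bar>} t * \<bar>h n t\<bar> \<partial>unit_measure) < e" for n
  proof (rule d(2))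
    let ?S = "{t \<in> space unit_measure. B < \<bar>h n t\<bar>}"
    show S: "?S \<in> sets unit_measure" using hm by measurable
    have "?S \<inter> space unit_measure = ?S" by blast
    then have "B * measure unit_measure ?S = (\<integral>t. B * indicator ?S t \<partial>unit_measure)"
      by (simp only: Bochner_Integration.integral_indicator integral_mult_right_zero)
    also have "\<dots> \<le> (\<integral>t. \<bar>h n t\<bar> \<partial>unit_measure)"
    proof (rule integral_mono)
      have "integrable unit_measure (indicator ?S :: real \<Rightarrow> real)"
        by (rule integrable_real_indicator[OF S]) (simp only: emeasure_eq_measure infinity_ennreal_def ennreal_less_top)
      then show "integrable unit_measure (\<lambda>t. B * indicator ?S t)" by (rule integrable_mult_right)
    qed (use hi[of n] B in \<open>auto simp: indicator_def\<close>)
    also have "\<dots> < real N + 1" using bound[of n] by simp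
    also have "\<dots> = B * d" using d(1) by (simp add: B_def)
    finally show "measure unit_measure ?S < d" using B by simp
  qed
  then show ?thesis using B by blast
qed

section \<open>Partition sums of an operator on L1\<close>

definition partition_sums :: "((real \<Rightarrow> real) \<Rightarrow> 'a::banach) \<Rightarrow> (('a \<Rightarrow>\<^sub>L real) \<Rightarrow> real) set" where
  "partition_sums T = {\<lambda>x. \<Sum>j\<in>J. \<bar>blinfun_apply x (T (\<lambda>t. of_bool (q t = j)))\<bar> | J (q :: real \<Rightarrow> nat).
     finite J \<and> q \<in> unit_measure \<rightarrow>\<^sub>M count_space UNIV \<and> range q \<subseteq> J}"

lemma level_set_L1:
  assumes "q \<in> unit_measure \<rightarrow>\<^sub>M count_space (UNIV :: nat set)"
  shows "(\<lambda>t. of_bool (q t = j)) \<in> L1"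
proof -
  interpret finite_measure unit_measure by (rule finite_unit_measure)
  have "q -` {j} \<inter> space unit_measure \<in> sets unit_measure"
    using assms by (rule measurable_sets) simp
  then have "integrable unit_measure (indicator (q -` {j} \<inter> space unit_measure) :: real \<Rightarrow> real)"
    by (simp add: emeasure_eq_measure)
  then show ?thesis
    unfolding in_L1_iff
    by (rule Bochner_Integration.integrable_cong[THEN iffD1, rotated 2]) (auto simp: indicator_def)
qed

text \<open>The L1 norms of the indicators add up to the length 1 of the interval.\<close>

lemma partition_sums_form:
  fixes T :: "(real \<Rightarrow> real) \<Rightarrow> 'a::banach"
  assumes bound: "\<And>f. f \<in> L1 \<Longrightarrow> norm (T f) \<le> K * L1_norm f" and g: "g \<in> partition_sums T"
  shows "\<exists>(J::nat set) y. finite J \<and> (\<Sum>j\<in>J. norm (y j)) \<le> K \<and>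
    g = (\<lambda>x. \<Sum>j\<in>J. \<bar>blinfun_apply x (y j)\<bar>)"
proof -
  obtain J and q :: "real \<Rightarrow> nat" where J: "finite J" and q: "q \<in> unit_measure \<rightarrow>\<^sub>M count_space UNIV" "range q \<subseteq> J"
    and g_eq: "g = (\<lambda>x. \<Sum>j\<in>J. \<bar>blinfun_apply x (T (\<lambda>t. of_bool (q t = j)))\<bar>)"
    using g by (auto simp: partition_sums_def)
  note L = level_set_L1[OF q(1)]
  have "(\<Sum>j\<in>J. norm (T (\<lambda>t. of_bool (q t = j)))) \<le> (\<Sum>j\<in>J. K * L1_norm (\<lambda>t. of_bool (q t = j)))"
    by (intro sum_mono bound L)
  also have "\<dots> = K * (\<Sum>j\<in>J. \<integral>t. of_bool (q t = j) \<partial>unit_measure)"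
    by (simp add: L1_norm_def sum_distrib_left)
  also have "(\<Sum>j\<in>J. \<integral>t. of_bool (q t = j) \<partial>unit_measure)
      = (\<integral>t. (\<Sum>j\<in>J. of_bool (q t = j) :: real) \<partial>unit_measure)"
    by (rule Bochner_Integration.integral_sum[symmetric]) (use L in \<open>auto simp: in_L1_iff\<close>)
  also have "(\<lambda>t. \<Sum>j\<in>J. of_bool (q t = j) :: real) = (\<lambda>_. 1)"
  proof
    fix t
    have "(\<Sum>j\<in>J. of_bool (q t = j) :: real) = (\<Sum>j\<in>J. if j = q t then 1 else 0)"
      by (rule sum.cong) auto
    then show "(\<Sum>j\<in>J. of_bool (q t = j) :: real) = 1" using J q(2) by auto
  qed
  also have "(\<integral>t. 1 \<partial>unit_measure) = (1::real)" by (rule integral_unit_const)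
  finally show ?thesis using J g_eq by auto
qed

text \<open>\<open>prod_encode\<close> labels the common refinement. \<open>T\<close> of a piece is
  the sum over its subpieces, and the triangle inequality does the rest.\<close>

lemma partition_sums_refine:
  fixes T :: "(real \<Rightarrow> real) \<Rightarrow> 'a::banach" and x :: "'a \<Rightarrow>\<^sub>L real"
  assumes T: "L1_bounded_linear T" and J: "finite J" "finite J'" and J': "range q' \<subseteq> J'"
    and r: "(\<lambda>t. prod_encode (q t, q' t)) \<in> unit_measure \<rightarrow>\<^sub>M count_space UNIV"
  shows "(\<Sum>j\<in>J. \<bar>blinfun_apply x (T (\<lambda>t. of_bool (q t = j)))\<bar>)
    \<le> (\<Sum>k\<in>prod_encode ` (J \<times> J'). \<bar>blinfun_apply x (T (\<lambda>t. of_bool (prod_encode (q t, q' t) = k)))\<bar>)"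
proof -
  have split: "T (\<lambda>t. of_bool (q t = j))
      = (\<Sum>j'\<in>J'. T (\<lambda>t. of_bool (prod_encode (q t, q' t) = prod_encode (j, j'))))" for j
  proof -
    have "(\<lambda>t. of_bool (q t = j)) = (\<lambda>t. \<Sum>j'\<in>J'. of_bool (prod_encode (q t, q' t) = prod_encode (j, j')) :: real)"
    proof
      fix t
      have "(\<Sum>j'\<in>J'. of_bool (prod_encode (q t, q' t) = prod_encode (j, j')) :: real)
          = (\<Sum>j'\<in>J'. if j' = q' t then of_bool (q t = j) else 0)"
        by (rule sum.cong) (auto simp: inj_prod_encode[THEN inj_eq])
      also have "\<dots> = of_bool (q t = j)" using J(2) J' by auto
      finally show "of_bool (q t = j) = (\<Sum>j'\<in>J'. of_bool (prod_encode (q t, q' t) = prod_encode (j, j')) :: real)" by simp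
    qed
    then show ?thesis
      by (simp only:) (rule L1_bounded_linear_sum[OF T J(2)], rule level_set_L1[OF r])
  qed
  have "(\<Sum>j\<in>J. \<bar>blinfun_apply x (T (\<lambda>t. of_bool (q t = j)))\<bar>)
      \<le> (\<Sum>j\<in>J. \<Sum>j'\<in>J'. \<bar>blinfun_apply x (T (\<lambda>t. of_bool (prod_encode (q t, q' t) = prod_encode (j, j'))))\<bar>)"
    unfolding split blinfun.sum_right by (intro sum_mono sum_abs)
  also have "\<dots> = (\<Sum>k\<in>J \<times> J'. \<bar>blinfun_apply x (T (\<lambda>t. of_bool (prod_encode (q t, q' t) = prod_encode k)))\<bar>)"
    unfolding sum.cartesian_product by (rule sum.cong) auto
  also have "\<dots> = (\<Sum>k\<in>prod_encode ` (J \<times> J'). \<bar>blinfun_apply x (T (\<lambda>t. of_bool (prod_encode (q t, q' t) = k)))\<bar>)"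
    by (subst sum.reindex) (auto intro: inj_prod_encode)
  finally show ?thesis .
qed

lemma measurable_prod_encode:
  assumes "q \<in> M \<rightarrow>\<^sub>M count_space UNIV" "q' \<in> M \<rightarrow>\<^sub>M count_space UNIV"
  shows "(\<lambda>t. prod_encode (q t, q' t)) \<in> M \<rightarrow>\<^sub>M count_space UNIV"
  using assms by measurable

lemma partition_sums_directed:
  fixes T :: "(real \<Rightarrow> real) \<Rightarrow> 'a::banach"
  assumes T: "L1_bounded_linear T"
  shows "upward_directed (partition_sums T)"
  unfolding upward_directed_def
proof (intro conjI ballI)
  have "(\<lambda>x. \<Sum>j\<in>{0}. \<bar>blinfun_apply x (T (\<lambda>t. of_bool (0 = j)))\<bar>) \<in> partition_sums T"
    unfolding partition_sums_def by (intro CollectI exI[of _ "{0::nat}"] exI[of _ "\<lambda>_. 0"]) auto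
  then show "partition_sums T \<noteq> {}" by blast
  fix g g' assume "g \<in> partition_sums T" "g' \<in> partition_sums T"
  then obtain J q J' q' where J: "finite J" "finite J'" and q: "q \<in> unit_measure \<rightarrow>\<^sub>M count_space (UNIV :: nat set)"
      "q' \<in> unit_measure \<rightarrow>\<^sub>M count_space (UNIV :: nat set)" and range: "range q \<subseteq> J" "range q' \<subseteq> J'"
    and g: "g = (\<lambda>x. \<Sum>j\<in>J. \<bar>blinfun_apply x (T (\<lambda>t. of_bool (q t = j)))\<bar>)"
      "g' = (\<lambda>x. \<Sum>j\<in>J'. \<bar>blinfun_apply x (T (\<lambda>t. of_bool (q' t = j)))\<bar>)"
    by (auto simp: partition_sums_def)
  define h where "h x = (\<Sum>k\<in>prod_encode ` (J \<times> J'). \<bar>blinfun_apply x (T (\<lambda>t. of_bool (prod_encode (q t, q' t) = k)))\<bar>)"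
    for x :: "'a \<Rightarrow>\<^sub>L real"
  \<comment> \<open>The same refinement with the labels paired in the opposite order, so that
    \<open>partition_sums_refine\<close> applies to \<open>g'\<close> as well.\<close>
  have h': "h x = (\<Sum>k\<in>prod_encode ` (J' \<times> J). \<bar>blinfun_apply x (T (\<lambda>t. of_bool (prod_encode (q' t, q t) = k)))\<bar>)" for x
  proof -
    have "h x = (\<Sum>k\<in>J \<times> J'. \<bar>blinfun_apply x (T (\<lambda>t. of_bool (prod_encode (q t, q' t) = prod_encode k)))\<bar>)"
      unfolding h_def by (subst sum.reindex) (auto intro: inj_prod_encode)
    also have "\<dots> = (\<Sum>k\<in>J' \<times> J. \<bar>blinfun_apply x (T (\<lambda>t. of_bool (prod_encode (q' t, q t) = prod_encode k)))\<bar>)"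
      by (rule sum.reindex_bij_witness[of _ prod.swap prod.swap])
        (auto simp: inj_prod_encode[THEN inj_eq] conj_commute)
    also have "\<dots> = (\<Sum>k\<in>prod_encode ` (J' \<times> J). \<bar>blinfun_apply x (T (\<lambda>t. of_bool (prod_encode (q' t, q t) = k)))\<bar>)"
      by (subst sum.reindex) (auto intro: inj_prod_encode)
    finally show ?thesis .
  qed
  have "h \<in> partition_sums T"
    unfolding partition_sums_def
  proof (intro CollectI exI conjI)
    show "h = (\<lambda>x. \<Sum>k\<in>prod_encode ` (J \<times> J'). \<bar>blinfun_apply x (T (\<lambda>t. of_bool (prod_encode (q t, q' t) = k)))\<bar>)"
      by (simp add: h_def fun_eq_iff)
  qed (use J q range measurable_prod_encode in auto)
  moreover have "g \<le> h"
    unfolding g h_def le_fun_def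
    by (intro allI partition_sums_refine[OF T J range(2)] measurable_prod_encode q)
  moreover have "g' \<le> h"
    unfolding g h' le_fun_def
    by (intro allI partition_sums_refine[OF T J(2,1) range(1)] measurable_prod_encode q)
  ultimately show "\<exists>h\<in>partition_sums T. g \<le> h \<and> g' \<le> h" by blast
qed

text \<open>The levels of \<open>q\<close> cut the values of \<open>h\<close>, truncated to \<open>[-B, B]\<close>, into steps of length \<open>e\<close>.\<close>

lemma partition_sum_lower_bound:
  fixes T :: "(real \<Rightarrow> real) \<Rightarrow> 'a::banach" and v :: "'a \<Rightarrow>\<^sub>L real"
  assumes T: "L1_bounded_linear T" and bound: "\<And>f. f \<in> L1 \<Longrightarrow> norm (T f) \<le> K * L1_norm f" and K: "0 \<le> K"
    and h: "h \<in> L1" and B: "0 < B" and e: "0 < e"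
    and tail: "(\<integral>t. indicator {t \<in> space unit_measure. B < \<bar>h t\<bar>} t * \<bar>h t\<bar> \<partial>unit_measure) \<le> e"
    and v: "norm v \<le> 1"
  shows "\<exists>g\<in>partition_sums T. blinfun_apply v (T h) - 2 * K * e \<le> B * g v"
proof -
  interpret finite_measure unit_measure by (rule finite_unit_measure)
  have hm[measurable]: "h \<in> borel_measurable unit_measure" using h by (auto simp: in_L1_iff)
  have S: "{t \<in> space unit_measure. B < \<bar>h t\<bar>} \<in> sets unit_measure" by measurable
  have tail_int: "integrable unit_measure (\<lambda>t. indicator {t \<in> space unit_measure. B < \<bar>h t\<bar>} t * \<bar>h t\<bar>)"
    using h by (intro integrable_indicator_abs S) (simp add: in_L1_iff)
  define q where "q t = nat \<lfloor>(max (- B) (min B (h t)) + B) / e\<rfloor>" for t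
  define lev where "lev j = real j * e - B" for j
  define J where "J = {..nat \<lfloor>2 * B / e\<rfloor>}"
  have qm: "q \<in> unit_measure \<rightarrow>\<^sub>M count_space UNIV" unfolding q_def by measurable
  have arg: "0 \<le> (max (- B) (min B (h t)) + B) / e" "(max (- B) (min B (h t)) + B) / e \<le> 2 * B / e" for t
    using B e by (auto intro!: divide_right_mono divide_nonneg_pos)
  have range: "range q \<subseteq> J" unfolding q_def J_def using arg(2) by (auto intro!: nat_mono floor_mono)
  have lev_J: "\<bar>lev j\<bar> \<le> B" if "j \<in> J" for j
  proof -
    have "int j \<le> \<lfloor>2 * B / e\<rfloor>" using that B e by (auto simp: J_def le_nat_iff)
    then have "real j \<le> 2 * B / e" by (simp add: le_floor_iff)
    then have "real j * e \<le> 2 * B" using e by (simp add: field_simps)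
    moreover have "0 \<le> real j * e" using e by simp
    ultimately show ?thesis unfolding lev_def by linarith
  qed
  have near: "\<bar>max (- B) (min B (h t)) - lev (q t)\<bar> \<le> e" for t
  proof -
    let ?a = "(max (- B) (min B (h t)) + B) / e"
    have "real (q t) \<le> ?a" "?a < real (q t) + 1" using arg(1)[of t] unfolding q_def by auto
    then have "real (q t) * e \<le> max (- B) (min B (h t)) + B" "max (- B) (min B (h t)) + B < (real (q t) + 1) * e"
      using e by (auto simp: field_simps)
    then show ?thesis by (auto simp: lev_def algebra_simps)
  qed
  let ?b = "\<lambda>j t. of_bool (q t = j) :: real"
  have b: "?b j \<in> L1" for j by (rule level_set_L1[OF qm])
  define s where "s t = (\<Sum>j\<in>J. lev j * ?b j t)" for t
  have lb: "(\<lambda>t. lev j * ?b j t) \<in> L1" for j using b[of j] by (auto simp: in_L1_iff)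
  have sL: "s \<in> L1" unfolding s_def by (rule L1_sum[OF lb])
  have s_eq: "s t = lev (q t)" for t
  proof -
    have "s t = (\<Sum>j\<in>J. if j = q t then lev j else 0)" unfolding s_def by (rule sum.cong) auto
    also have "\<dots> = lev (q t)" using range by (auto simp: J_def)
    finally show ?thesis .
  qed
  have "L1_norm (\<lambda>t. h t - s t)
      \<le> (\<integral>t. indicator {t \<in> space unit_measure. B < \<bar>h t\<bar>} t * \<bar>h t\<bar> + e \<partial>unit_measure)"
    unfolding L1_norm_def
  proof (rule integral_mono)
    show "integrable unit_measure (\<lambda>t. \<bar>h t - s t\<bar>)" using h sL by (auto simp: in_L1_iff)
    show "integrable unit_measure (\<lambda>t. indicator {t \<in> space unit_measure. B < \<bar>h t\<bar>} t * \<bar>h t\<bar> + e)"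
      by (intro Bochner_Integration.integrable_add tail_int) simp
    fix t assume t: "t \<in> space unit_measure"
    \<comment> \<open>Rounding costs at most \<open>e\<close>; clipping costs at most the absolute
      value of \<open>h t\<close>, and only where that exceeds \<open>B\<close>.\<close>
    show "\<bar>h t - s t\<bar> \<le> indicator {t \<in> space unit_measure. B < \<bar>h t\<bar>} t * \<bar>h t\<bar> + e"
      using near[of t] t B unfolding s_eq by (auto simp: indicator_def)
  qed
  also have "\<dots> = (\<integral>t. indicator {t \<in> space unit_measure. B < \<bar>h t\<bar>} t * \<bar>h t\<bar> \<partial>unit_measure) + e"
    by (subst Bochner_Integration.integral_add[OF tail_int]) (simp, simp only: integral_unit_const)
  also have "\<dots> \<le> 2 * e" using tail by simp
  finally have diff: "L1_norm (\<lambda>t. h t - s t) \<le> 2 * e" .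
  have dL: "(\<lambda>t. h t - s t) \<in> L1" using h sL by (auto simp: in_L1_iff)
  have "blinfun_apply v (T (\<lambda>t. h t - s t)) \<le> norm v * norm (T (\<lambda>t. h t - s t))"
    using norm_blinfun[of v "T (\<lambda>t. h t - s t)"] by simp
  also have "\<dots> \<le> 1 * norm (T (\<lambda>t. h t - s t))" using v by (intro mult_right_mono) auto
  also have "\<dots> \<le> K * (2 * e)" using bound[OF dL] mult_left_mono[OF diff K] by simp
  finally have 1: "blinfun_apply v (T h) - blinfun_apply v (T s) \<le> 2 * K * e"
    unfolding L1_bounded_linear_diff[OF T h sL] by (simp add: blinfun.diff_right)
  have "T s = (\<Sum>j\<in>J. lev j *\<^sub>R T (?b j))"
    unfolding s_def using L1_bounded_linear_sum[OF T, of J "\<lambda>j t. lev j * ?b j t"] lb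
      L1_bounded_linear_scale[OF T b] by (simp add: J_def)
  then have "blinfun_apply v (T s) = (\<Sum>j\<in>J. lev j * blinfun_apply v (T (?b j)))"
    by (simp add: blinfun.sum_right blinfun.scaleR_right)
  also have "\<dots> \<le> (\<Sum>j\<in>J. B * \<bar>blinfun_apply v (T (?b j))\<bar>)"
  proof (rule sum_mono)
    fix j assume "j \<in> J"
    have "lev j * blinfun_apply v (T (?b j)) \<le> \<bar>lev j\<bar> * \<bar>blinfun_apply v (T (?b j))\<bar>"
      by (metis abs_ge_self abs_mult)
    also have "\<dots> \<le> B * \<bar>blinfun_apply v (T (?b j))\<bar>"
      using lev_J[OF \<open>j \<in> J\<close>] by (intro mult_right_mono) auto
    finally show "lev j * blinfun_apply v (T (?b j)) \<le> B * \<bar>blinfun_apply v (T (?b j))\<bar>" .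
  qed
  finally have 2: "blinfun_apply v (T s) \<le> B * (\<Sum>j\<in>J. \<bar>blinfun_apply v (T (?b j))\<bar>)"
    by (simp add: sum_distrib_left)
  have "(\<lambda>x. \<Sum>j\<in>J. \<bar>blinfun_apply x (T (?b j))\<bar>) \<in> partition_sums T"
    unfolding partition_sums_def using qm range by (auto simp: J_def)
  then show ?thesis using 1 2 by (intro bexI) auto
qed

section \<open>Oscillation from the failure of complete continuity\<close>

text \<open>Pigeonhole in place of weak-star compactness: the values on \<open>F\<close> are bounded
  and fall into finitely many cells of side \<open>d\<close>.\<close>

lemma nearby_functionals:
  fixes w :: "nat \<Rightarrow> 'a::real_normed_vector \<Rightarrow>\<^sub>L real"
  assumes I: "infinite I" and w: "\<And>n. norm (w n) \<le> 1" and F: "finite F" and d: "0 < d"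
  obtains m where "m \<in> I" "infinite {n \<in> I. \<forall>y\<in>F. \<bar>blinfun_apply (w n) y - blinfun_apply (w m) y\<bar> < d}"
proof -
  define key where "key n = restrict (\<lambda>y. \<lfloor>blinfun_apply (w n) y / d\<rfloor>) F" for n
  have "key n \<in> (\<Pi>\<^sub>E y\<in>F. {\<lfloor>- (norm y / d)\<rfloor>..\<lfloor>norm y / d\<rfloor>})" for n
  proof -
    have "\<bar>blinfun_apply (w n) y\<bar> \<le> norm y" for y
      using norm_blinfun[of "w n" y] mult_right_mono[OF w[of n], of "norm y"] by simp
    then have "- norm y \<le> blinfun_apply (w n) y" "blinfun_apply (w n) y \<le> norm y" for y
      by (meson abs_le_D1 abs_le_D2 minus_le_iff)+
    then have "(- norm y) / d \<le> blinfun_apply (w n) y / d" "blinfun_apply (w n) y / d \<le> norm y / d" for y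
      using d by (meson divide_right_mono less_imp_le)+
    then have "- (norm y / d) \<le> blinfun_apply (w n) y / d" "blinfun_apply (w n) y / d \<le> norm y / d" for y
      by (simp_all only: minus_divide_left)
    then show ?thesis
      by (auto simp: key_def intro!: floor_mono)
  qed
  then have "key ` I \<subseteq> (\<Pi>\<^sub>E y\<in>F. {\<lfloor>- (norm y / d)\<rfloor>..\<lfloor>norm y / d\<rfloor>})" by blast
  then have "finite (key ` I)" by (rule finite_subset) (intro finite_PiE F finite_atLeastAtMost_int)
  from pigeonhole_infinite[OF I this] obtain m where m: "m \<in> I" "infinite {n \<in> I. key n = key m}" by blast
  have "\<bar>blinfun_apply (w n) y - blinfun_apply (w m) y\<bar> < d" if "key n = key m" "y \<in> F" for n y
  proof -
    have "\<lfloor>blinfun_apply (w n) y / d\<rfloor> = \<lfloor>blinfun_apply (w m) y / d\<rfloor>"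
      using fun_cong[OF that(1), of y] that(2) by (simp add: key_def)
    then have "\<bar>blinfun_apply (w n) y / d - blinfun_apply (w m) y / d\<bar> < 1" by linarith
    then have "\<bar>blinfun_apply (w n) y - blinfun_apply (w m) y\<bar> / d < 1"
      using d by (simp add: abs_divide flip: diff_divide_distrib)
    then show ?thesis using d by simp
  qed
  then have "infinite {n \<in> I. \<forall>y\<in>F. \<bar>blinfun_apply (w n) y - blinfun_apply (w m) y\<bar> < d}"
    using m(2) by (elim infinite_super[rotated]) auto
  then show thesis using that m(1) by blast
qed

lemma not_CCP_oscillation:
  assumes "\<not> CCP TYPE('a::banach)"
  obtains T :: "(real \<Rightarrow> real) \<Rightarrow> 'a::banach" and K c :: real
  where "L1_bounded_linear T" "0 < K" "\<And>f. f \<in> L1 \<Longrightarrow> norm (T f) \<le> K * L1_norm f" "0 < c"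
    "\<And>F d. finite F \<Longrightarrow> 0 < d \<Longrightarrow>
      \<exists>v g. g \<in> partition_sums T \<and> norm v \<le> 1 \<and> (\<forall>y\<in>F. \<bar>blinfun_apply v y\<bar> < d) \<and> c \<le> g v"
proof -
  obtain T :: "(real \<Rightarrow> real) \<Rightarrow> 'a" and f f0
    where T: "L1_bounded_linear T" and weak: "L1_weakly_converges f f0" and "\<not> (\<lambda>n. T (f n)) \<longlonglongrightarrow> T f0"
    using assms by (auto simp: CCP_def Dunford_Pettis_def)
  then obtain e where e: "e > 0" "\<And>N. \<exists>n\<ge>N. e \<le> dist (T (f n)) (T f0)"
    unfolding LIMSEQ_def by (metis not_less)
  have f: "\<And>n. f n \<in> L1" "f0 \<in> L1"
    and conv: "\<And>\<phi> :: (real \<Rightarrow> real) \<Rightarrow> real. L1_bounded_linear \<phi> \<Longrightarrow> (\<lambda>n. \<phi> (f n)) \<longlonglongrightarrow> \<phi> f0"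
    using weak by (auto simp: L1_weakly_converges_def)
  define h where "h n = (\<lambda>t. f n t - f0 t)" for n
  have h: "h n \<in> L1" for n using f by (auto simp: h_def in_L1_iff)
  have null: "(\<lambda>n. \<phi> (h n)) \<longlonglongrightarrow> 0" if "L1_bounded_linear \<phi>" for \<phi> :: "(real \<Rightarrow> real) \<Rightarrow> real"
  proof -
    have "(\<lambda>n. \<phi> (f n) - \<phi> f0) \<longlonglongrightarrow> \<phi> f0 - \<phi> f0" by (intro tendsto_diff conv that tendsto_const)
    then show ?thesis using L1_bounded_linear_diff[OF that f(1) f(2)] by (simp add: h_def)
  qed
  have Th: "T (h n) = T (f n) - T f0" for n
    unfolding h_def by (rule L1_bounded_linear_diff[OF T f(1) f(2)])
  define I where "I = {n. e \<le> norm (T (h n))}"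
  have I: "infinite I" using e(2) by (auto simp: infinite_nat_iff_unbounded_le I_def Th dist_norm)
  have "\<exists>w :: 'a \<Rightarrow>\<^sub>L real. norm w \<le> 1 \<and> blinfun_apply w (T (h n)) = norm (T (h n))" for n
    by (rule norming_functional[of "T (h n)"]) blast
  then obtain w :: "nat \<Rightarrow> 'a \<Rightarrow>\<^sub>L real"
    where w: "\<And>n. norm (w n) \<le> 1" "\<And>n. blinfun_apply (w n) (T (h n)) = norm (T (h n))" by metis
  obtain K0 where K0: "\<And>f. f \<in> L1 \<Longrightarrow> norm (T f) \<le> K0 * L1_norm f"
    using T unfolding L1_bounded_linear_def by blast
  \<comment> \<open>Made positive because \<open>K\<close> is divided by below.\<close>
  define K where "K = max 1 K0"
  have K: "K > 0" "\<And>f. f \<in> L1 \<Longrightarrow> norm (T f) \<le> K * L1_norm f"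
  proof -
    show "K > 0" by (simp add: K_def)
    fix f assume "f \<in> L1"
    then have "norm (T f) \<le> K0 * L1_norm f" by (rule K0)
    also have "\<dots> \<le> K * L1_norm f" by (intro mult_right_mono L1_norm_nonneg) (simp add: K_def)
    finally show "norm (T f) \<le> K * L1_norm f" .
  qed
  \<comment> \<open>The tail bound makes the error in \<open>partition_sum_lower_bound\<close> equal
    to \<open>e / 8\<close>, leaving \<open>3 * e / 8 - e / 8 = e / 4\<close> for
    \<open>B * g v\<close>; hence the constant \<open>e / (4 * B)\<close>.\<close>
  have "\<exists>B>0. \<forall>n. (\<integral>t. indicator {t \<in> space unit_measure. B < \<bar>h n t\<bar>} t * \<bar>h n t\<bar> \<partial>unit_measure) < e / (16 * K)"
    by (rule L1_uniform_truncation[OF h]) (use null L1_bounded_linear_integral e(1) K(1) in auto)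
  then obtain B where B: "B > 0"
    "\<And>n. (\<integral>t. indicator {t \<in> space unit_measure. B < \<bar>h n t\<bar>} t * \<bar>h n t\<bar> \<partial>unit_measure) < e / (16 * K)" by blast
  show thesis
  proof (rule that[OF T K])
    show "0 < e / (4 * B)" using e(1) B(1) by simp
    fix F :: "'a set" and d :: real assume F: "finite F" and d: "0 < d"
    \<comment> \<open>\<open>m\<close> is fixed first. Infinitely many close indices remain, so
      \<open>n\<close> can be taken so late that \<open>w m\<close> is below \<open>e / 4\<close> at
      \<open>T (h n)\<close>.\<close>
    obtain m where m: "infinite {n \<in> I. \<forall>y\<in>F. \<bar>blinfun_apply (w n) y - blinfun_apply (w m) y\<bar> < d}"
      by (rule nearby_functionals[OF I w(1) F d])
    have "(\<lambda>n. blinfun_apply (w m) (T (h n))) \<longlonglongrightarrow> 0"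
      by (rule null[OF L1_bounded_linear_functional[OF T]])
    then have "\<forall>\<^sub>F n in sequentially. blinfun_apply (w m) (T (h n)) < e / 4"
      using e(1) by (intro order_tendstoD(2)) auto
    then obtain N where N: "\<And>n. N \<le> n \<Longrightarrow> blinfun_apply (w m) (T (h n)) < e / 4"
      by (auto simp: eventually_sequentially)
    obtain n where n: "N \<le> n" "n \<in> I" "\<And>y. y \<in> F \<Longrightarrow> \<bar>blinfun_apply (w n) y - blinfun_apply (w m) y\<bar> < d"
      using m unfolding infinite_nat_iff_unbounded_le by blast
    \<comment> \<open>Halved to return to the unit ball; the value at \<open>T (h n)\<close> is
      still at least \<open>(e - e / 4) / 2\<close>.\<close>
    define v where "v = (w n - w m) /\<^sub>R 2"
    have v_apply: "blinfun_apply v y = (blinfun_apply (w n) y - blinfun_apply (w m) y) / 2" for y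
      by (simp add: v_def blinfun.scaleR_left blinfun.diff_left)
    have "norm (w n - w m) \<le> 1 + 1" by (rule norm_triangle_le_diff) (use w(1)[of n] w(1)[of m] in simp)
    then have v: "norm v \<le> 1" by (simp add: v_def)
    have small: "\<bar>blinfun_apply v y\<bar> < d" if "y \<in> F" for y
      using n(3)[OF that] d by (simp add: v_apply)
    have "e \<le> blinfun_apply (w n) (T (h n))" using n(2) w(2) by (simp add: I_def)
    then have big: "3 * e / 8 \<le> blinfun_apply v (T (h n))" using N[OF n(1)] by (simp add: v_apply)
    obtain g where g: "g \<in> partition_sums T"
      "blinfun_apply v (T (h n)) - 2 * K * (e / (16 * K)) \<le> B * g v"
      using partition_sum_lower_bound[OF T K(2) less_imp_le[OF K(1)] h B(1) _ less_imp_le[OF B(2)] v] e(1) K(1)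
      by (metis divide_pos_pos mult_pos_pos zero_less_numeral)
    have "2 * K * (e / (16 * K)) = e / 8" using K(1) by simp
    then have "e / 4 \<le> B * g v" using g(2) big by linarith
    then have "e / (4 * B) \<le> g v" using B(1) by (simp add: field_simps)
    then show "\<exists>v g. g \<in> partition_sums T \<and> norm v \<le> 1 \<and> (\<forall>y\<in>F. \<bar>blinfun_apply v y\<bar> < d) \<and> e / (4 * B) \<le> g v"
      using g(1) v small by blast
  qed
qed

theorem proposition6p1:
  fixes p lam :: real
  assumes "1 \<le> p"
    and "\<not> CCP TYPE('a::banach)"
    and "lam > 0"
  shows "\<not> Fatou_property lam (FBL p :: (('a \<Rightarrow>\<^sub>L real) \<Rightarrow> real) set) (Hp_norm p)
       \<and> \<not> Fatou_property lam (Iw_closure p :: (('a \<Rightarrow>\<^sub>L real) \<Rightarrow> real) set) (Hp_norm p)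
       \<and> \<not> Fatou_property lam (Hwp p :: (('a \<Rightarrow>\<^sub>L real) \<Rightarrow> real) set) (Hp_norm p)"
proof -
  obtain T :: "(real \<Rightarrow> real) \<Rightarrow> 'a" and K c :: real
    where T: "L1_bounded_linear T" "0 < K" "\<And>f. f \<in> L1 \<Longrightarrow> norm (T f) \<le> K * L1_norm f" and c: "0 < c"
      and osc: "\<And>F d. finite F \<Longrightarrow> 0 < d \<Longrightarrow>
        \<exists>v g. g \<in> partition_sums T \<and> norm v \<le> 1 \<and> (\<forall>y\<in>F. \<bar>blinfun_apply v y\<bar> < d) \<and> c \<le> g v"
    using not_CCP_oscillation[OF assms(2)] by metis
  have form: "\<exists>(J::nat set) y. finite J \<and> (\<Sum>j\<in>J. norm (y j)) \<le> K \<and>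
      g = (\<lambda>x. \<Sum>j\<in>J. \<bar>blinfun_apply x (y j)\<bar>)" if "g \<in> partition_sums T" for g
    by (rule partition_sums_form[OF T(3) that])
  have norm_osc: "\<exists>v :: 'a \<Rightarrow>\<^sub>L real. c / K \<le> norm v \<and> (\<forall>y\<in>F. \<bar>blinfun_apply v y\<bar> < d)"
    if F: "finite F" "0 < d" for F :: "'a set" and d
  proof -
    obtain v g where v: "g \<in> partition_sums T" "\<forall>y\<in>F. \<bar>blinfun_apply v y\<bar> < d" "c \<le> g v"
      using osc[OF F] by blast
    obtain J y where J: "(\<Sum>j\<in>(J::nat set). norm (y j)) \<le> K" "g = (\<lambda>x. \<Sum>j\<in>J. \<bar>blinfun_apply x (y j)\<bar>)"
      using form[OF v(1)] by blast
    have "g v \<le> (\<Sum>j\<in>J. norm v * norm (y j))"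
      unfolding J(2) using norm_blinfun[of v] by (intro sum_mono) auto
    also have "\<dots> = norm v * (\<Sum>j\<in>J. norm (y j))" by (simp add: sum_distrib_left)
    also have "\<dots> \<le> norm v * K" by (intro mult_left_mono J) auto
    finally have "c / K \<le> norm v" using v(3) T(2) by (simp add: field_simps)
    then show ?thesis using v(2) by blast
  qed
  \<comment> \<open>One more than \<open>lam\<close> times the norm bound for the
    truncations.\<close>
  define r where "r = lam * (2 / c * K) + 1"
  have r: "0 \<le> r" using assms(3) c T(2) by (simp add: r_def)
  have "0 < c / K" using c T(2) by simp
  from biorthogonal_system[OF this norm_osc] have bio: "\<exists>(u :: nat \<Rightarrow> 'a \<Rightarrow>\<^sub>L real) x.
      \<forall>i<d. \<forall>j<d. blinfun_apply (u i) (x j) = (if i = j then 1 else 0)" for d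
    by blast
  obtain n and u :: "nat \<Rightarrow> 'a \<Rightarrow>\<^sub>L real"
    where u: "\<And>x. norm x \<le> 1 \<Longrightarrow> (\<Sum>i<n. \<bar>blinfun_apply (u i) x\<bar> powr p) \<le> 1"
      "(2 * r) powr p \<le> (\<Sum>i<n. norm (u i) powr p)"
    using Dvoretzky_Rogers[OF assms(1) bio, of "(2 * r) powr p"] by blast
  \<comment> \<open>Points nearly norming the \<open>u i\<close>, up to the factor 2 allowed by
    \<open>Hp_norm_ge\<close>; \<open>z\<close> is the maximum of the evaluations at these
    points.\<close>
  have "\<exists>x. norm x \<le> 1 \<and> norm (u i) / 2 \<le> \<bar>blinfun_apply (u i) x\<bar>" for i
  proof (rule ccontr)
    assume none: "\<not> ?thesis"
    have "norm (u i) \<le> norm (u i) / 2"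
    proof (rule norm_blinfun_bound)
      fix x
      show "norm (blinfun_apply (u i) x) \<le> norm (u i) / 2 * norm x"
      proof (cases "x = 0")
        case False
        then have "norm (x /\<^sub>R norm x) \<le> 1" by simp
        then have "\<bar>blinfun_apply (u i) (x /\<^sub>R norm x)\<bar> < norm (u i) / 2"
          using none not_le by blast
        then show ?thesis using False by (simp add: blinfun.scaleR_right abs_mult field_simps)
      qed simp
    qed simp
    moreover have "norm (u i) / 2 > 0" using none by (metis abs_ge_zero norm_zero not_le zero_le_one order_trans)
    ultimately show False by simp
  qed
  then obtain x where x: "\<And>i. norm (x i) \<le> 1" "\<And>i. norm (u i) / 2 \<le> \<bar>blinfun_apply (u i) (x i)\<bar>" by metis
  obtain z where "z \<in> FVL" "\<forall>w. 0 \<le> z w" "\<forall>w. \<forall>i<n. \<bar>blinfun_apply w (x i)\<bar> \<le> z w"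
    "\<forall>w. z w \<le> (\<Sum>i<n. \<bar>blinfun_apply w (x i)\<bar>)"
    "\<forall>w. \<forall>b\<ge>0. (\<forall>i<n. \<bar>blinfun_apply w (x i)\<bar> \<le> b) \<longrightarrow> z w \<le> b"
    using max_abs_eval_in_FVL[of n x] by blast
  then have z: "z \<in> FVL" "\<And>w. 0 \<le> z w" "\<And>w i. i < n \<Longrightarrow> \<bar>blinfun_apply w (x i)\<bar> \<le> z w"
    "\<And>w. z w \<le> (\<Sum>i<n. \<bar>blinfun_apply w (x i)\<bar>)"
    "\<And>w b. 0 \<le> b \<Longrightarrow> (\<And>i. i < n \<Longrightarrow> \<bar>blinfun_apply w (x i)\<bar> \<le> b) \<Longrightarrow> z w \<le> b"
    by blast+
  have z_norm: "z w \<le> norm w" for w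
  proof (rule z(5))
    show "\<bar>blinfun_apply w (x i)\<bar> \<le> norm w" for i
      using norm_blinfun[of w "x i"] mult_left_mono[OF x(1)[of i] norm_ge_zero[of w]] by simp
  qed simp
  have "Hp_norm p z \<le> ennreal (\<Sum>i<n. norm (x i))"
    by (rule Hp_norm_le_of_dominated) (use assms(1) z(2,4) in auto)
  then have finite: "Hp_norm p z < \<infinity>"
    by (metis ennreal_less_top infinity_ennreal_def le_less_trans)
  have "ennreal lam * ennreal (2 / c * K) < ennreal r"
    using assms(3) c T(2) by (simp add: r_def ennreal_less_iff flip: ennreal_mult)
  also have "\<dots> \<le> Hp_norm p z"
  proof (rule Hp_norm_ge[OF assms(1) u(1) _ r u(2)])
    show "norm (u i) / 2 \<le> z (u i)" if "i < n" for i using x(2)[of i] z(3)[OF that, of "u i"] by linarith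
  qed
  finally have large: "ennreal lam * ennreal (2 / c * K) < Hp_norm p z" .
  have "\<not> Fatou_property lam Z (Hp_norm p)"
    if "Z = FBL p \<or> Z = Iw_closure p \<or> Z = Hwp p" for Z :: "(('a \<Rightarrow>\<^sub>L real) \<Rightarrow> real) set"
    by (rule not_Fatou_property[OF assms(1) that form partition_sums_directed[OF T(1)] c osc z(1) finite z(2) z_norm large])
  then show ?thesis by blast
qed

end
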